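(* Let $L$ be a lattice of signature $(2,n)$ with $n\ge3$, let $\Gamma$ be a finite-index subgroup of $\mathrm O^+(L)$, let $\lambda=(\lambda_1\ge\cdots\ge\lambda_n\ge0)$ be a partition with ${}^t\lambda_1+{}^t\lambda_2\le n$, let $k\in\mathbb Z$, let $I\subset L$ be a primitive isotropic sublattice of rank $1$, and let $f=\sum_{l}a(l)q^l$ be the Fourier expansion at the $I$-cusp of a modular form $f$ of weight $(\lambda,k)$ with respect to $\Gamma$. Assume that $\lambda\neq1,\det$. Then $a(0)=0$.
   Context: A lattice is a free $\mathbb Z$-module of finite rank with a nondegenerate symmetric bilinear form $(\cdot,\cdot)$ with values in $\mathbb Z$; $L_F=L\otimes_{\mathbb Z}F$. $\mathcal D$ is a fixed connected component of $\{[\omega]\in\mathbb P(L_{\mathbb C}) : (\omega,\omega)=0,\ (\omega,\bar\omega)>0\}$; $\mathrm O^+(L_{\mathbb R})$ is the subgroup of $\mathrm O(L_{\mathbb R})$ preserving $\mathcal D$ and $\mathrm O^+(L)=\mathrm O(L)\cap \mathrm O^+(L_{\mathbb R})$. Over $\mathcal D$: $\mathcal L\subset L_{\mathbb C}\otimes\mathcal O_{\mathcal D}$ is the tautological line bundle (fiber $\mathbb C\omega$) and $\mathcal E=\mathcal L^\perp/\mathcal L$ (fiber $\omega^\perp/\mathbb C\omega$) with its induced nondegenerate quadratic form. For a partition $\lambda$ as in the claim (${}^t\lambda$ the transpose), $d=|\lambda|$ and an $n$-dimensional complex quadratic space $V$, $V^{[d]}\subset V^{\otimes d}$ is the intersection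 of the kernels of all contractions $V^{\otimes d}\to V^{\otimes (d-2)}$ and $V_\lambda=c_\lambda\cdot V^{[d]}$, where $c_\lambda=b_\lambda a_\lambda$ is the Young symmetrizer of the column canonical tableau ($a_\lambda$ the sum over the row subgroup, $b_\lambda$ the signed sum over the column subgroup); $V_\lambda$ is the irreducible representation of $\mathrm O(V)$ labelled by $\lambda$. $\lambda=1$ means $(0)$, $\lambda=\det$ means $(1^n)$. Applying this fiberwise to $\mathcal E$ gives $\mathcal E_\lambda$; $\mathcal E_{\lambda,k}=\mathcal E_\lambda\otimes\mathcal L^{\otimes k}$. A modular form of weight $(\lambda,k)$ is a $\Gamma$-invariant holomorphic section of $\mathcal E_{\lambda,k}$ over $\mathcal D$. Fourier expansion at the $I$-cusp. Put $V(I)=(I^\perp/I)_{\mathbb C}$. The pairing with $I_{\mathbb C}$ gives $\mathcal L\simeq I_{\mathbb C}^\vee\otimes\mathcal O_{\mathcal D}$, and the isomorphisms $I_{\mathbb C}^\perp/I_{\mathbb C}\leftarrow I_{\mathbb C}^\perp\cap\omega^\perp\to\omega^\perp/\mathbb C\omega$ give $\mathcal E\simeq V(I)\otimes\mathcal O_{\mathcal D}$; hence $\mathcal E_{\lambda,k}\simeq V(I)_{\lambda,k}\otimes\mathcal O_{\mathcal D}$, $V(I)_{\lambda,k}=V(I)_\lambda\otimes(I_{\mathbb C}^\vee)^{\otimes k}$. Let $U(I)_F=(I^\perp/I)_F\otimes I_F$ (generators of $I$ given norm $1$), regarded as a subgroup of $\mathrm O(L_F)$ by the Eichler transvections $E_{m\otimes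 l}(v)=v-(\tilde m,v)l+(l,v)\tilde m-\frac12(m,m)(l,v)l$ ($\tilde m\in I_F^\perp$ a lift of $m$), and $U(I)_{\mathbb Z}=U(I)_{\mathbb Q}\cap\Gamma$, a full lattice with dual $U(I)_{\mathbb Z}^\vee\subset U(I)_{\mathbb Q}$. Choose a rank $1$ isotropic $I'\subset L$ with $(I,I')\neq0$; with $e$ a generator of $I$, $e'\in I'_{\mathbb Q}$ with $(e,e')=1$, and $V(I)$ identified with $(I\oplus I')_{\mathbb C}^\perp$, the map $z\otimes e\mapsto[e'+z-\frac12(z,z)e]$ identifies $\mathcal D_I=\{Z\in U(I)_{\mathbb C}:\mathrm{Im}(Z)\in\mathcal C_I\}$ with $\mathcal D$, for one component $\mathcal C_I$ of $\{v\in U(I)_{\mathbb R}:(v,v)>0\}$. Via these identifications $f$ is a $V(I)_{\lambda,k}$-valued function on $\mathcal D_I$ invariant under translations by $U(I)_{\mathbb Z}$, so $f(Z)=\sum_{l\in U(I)_{\mathbb Z}^\vee}a(l)q^l$, $q^l=\exp(2\pi i(l,Z))$, $a(l)\in V(I)_{\lambda,k}$. *)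

theory Defs
  imports
    "HOL-Analysis.Analysis"
    "HOL-Algebra.Coset"
    "HOL-Combinatorics.Permutations"
    "HOL-Library.Function_Algebras"
begin

section \<open>Lattices and orthogonal groups\<close>

text \<open>
  A lattice \<open>L\<close> is presented by the Gram matrix \<open>G\<close> of a \<open>\<int>\<close>-basis indexed by a finite type
  \<open>'m\<close>. All the spaces \<open>L \<subseteq> L\<^sub>\<rat> \<subseteq> L\<^sub>\<real> \<subseteq> L\<^sub>\<complex>\<close> are taken inside
  \<open>L\<^sub>\<complex> = complex ^ 'm\<close>, as the vectors with coordinates in \<open>\<int>\<close>, \<open>\<rat>\<close>, \<open>\<real>\<close>, \<open>\<complex>\<close>.
\<close>

definition coords :: "complex set \<Rightarrow> (complex ^ 'm) set" where
  "coords F = {v. \<forall>i. v $ i \<in> F}"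

abbreviation lat :: "(complex ^ 'm) set" where
  "lat \<equiv> coords \<int>"

definition form :: "int ^ 'm ^ 'm \<Rightarrow> complex ^ 'm \<Rightarrow> complex ^ 'm \<Rightarrow> complex" where
  "form G v w = (\<Sum>i\<in>UNIV. \<Sum>j\<in>UNIV. of_int (G $ i $ j) * v $ i * w $ j)"

definition gram_matrix :: "int ^ 'm ^ 'm \<Rightarrow> bool" where
  "gram_matrix G \<longleftrightarrow> transpose G = G \<and> det G \<noteq> 0"

text \<open>Pairwise orthogonal vectors of nonzero norm are linearly independent, so \<open>b\<close> is an
  orthogonal basis of \<open>L\<^sub>\<real>\<close>.\<close>

definition signature :: "int ^ 'm ^ 'm \<Rightarrow> nat \<Rightarrow> nat \<Rightarrow> bool" where
  "signature G p q \<longleftrightarrow> CARD('m) = p + q \<and>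
     (\<exists>b :: 'm \<Rightarrow> complex ^ 'm.
        (\<forall>i. b i \<in> coords \<real>) \<and>
        (\<forall>i j. i \<noteq> j \<longrightarrow> form G (b i) (b j) = 0) \<and>
        card {i. Re (form G (b i) (b i)) > 0} = p \<and>
        card {i. Re (form G (b i) (b i)) < 0} = q)"

definition perp :: "int ^ 'm ^ 'm \<Rightarrow> (complex ^ 'm) set \<Rightarrow> (complex ^ 'm) set" where
  "perp G A = {v. \<forall>w\<in>A. form G v w = 0}"

definition cnj_vec :: "complex ^ 'm \<Rightarrow> complex ^ 'm" where
  "cnj_vec v = (\<chi> i. cnj (v $ i))"

definition Im_vec :: "complex ^ 'm \<Rightarrow> complex ^ 'm" where
  "Im_vec v = (\<chi> i. complex_of_real (Im (v $ i)))"

text \<open>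
  The affine cone over \<open>{[\<omega>] \<in> \<P>(L\<^sub>\<complex>) : (\<omega>,\<omega>) = 0, (\<omega>,\<omega>\<^sup>-) > 0}\<close>. The fibres of the projection
  to projective space are the connected sets \<open>\<complex>\<^sup>* \<omega>\<close>, so its connected components are
  exactly the cones over the components of the projective domain. Throughout, \<open>D\<close> is the cone
  of nonzero vectors over the type IV domain, i.e. the complement of the zero section in the
  tautological line bundle. (\<open>(\<omega>,\<omega>\<^sup>-)\<close> is automatically real.)
\<close>

definition period_cone :: "int ^ 'm ^ 'm \<Rightarrow> (complex ^ 'm) set" where
  "period_cone G = {w. form G w w = 0 \<and> Re (form G w (cnj_vec w)) > 0}"

text \<open>\<open>orth G F\<close> is \<open>\<O>(L\<^sub>F)\<close>, acting on \<open>L\<^sub>\<complex>\<close> by scalar extension.\<close>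

definition orth :: "int ^ 'm ^ 'm \<Rightarrow> complex set \<Rightarrow> (complex ^ 'm ^ 'm) set" where
  "orth G F = {g. (\<lambda>v. g *v v) ` coords F = coords F \<and>
                  (\<forall>v w. form G (g *v v) (g *v w) = form G v w)}"

definition orth_plus_real :: "int ^ 'm ^ 'm \<Rightarrow> (complex ^ 'm) set \<Rightarrow> (complex ^ 'm ^ 'm) set" where
  "orth_plus_real G D = {g \<in> orth G \<real>. (\<lambda>v. g *v v) ` D = D}"

definition orth_plus :: "int ^ 'm ^ 'm \<Rightarrow> (complex ^ 'm) set \<Rightarrow> (complex ^ 'm ^ 'm) monoid" where
  "orth_plus G D =
     \<lparr>carrier = orth G \<int> \<inter> orth_plus_real G D, mult = (**), one = mat 1\<rparr>"

definition finite_index_subgroup ::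
    "int ^ 'm ^ 'm \<Rightarrow> (complex ^ 'm) set \<Rightarrow> (complex ^ 'm ^ 'm) set \<Rightarrow> bool" where
  "finite_index_subgroup G D \<Gamma> \<longleftrightarrow>
     subgroup \<Gamma> (orth_plus G D) \<and> finite (rcosets\<^bsub>orth_plus G D\<^esub> \<Gamma>)"


section \<open>Tensors\<close>

text \<open>
  A tensor in \<open>L\<^sub>\<complex>\<^sup>\<otimes>\<^sup>d\<close> is its coordinate function on multi-indices: a function on lists over
  \<open>'m\<close> that vanishes off the lists of length \<open>d\<close>.
\<close>

type_synonym 'm tensor = "'m list \<Rightarrow> complex"

definition tscale :: "complex \<Rightarrow> 'm tensor \<Rightarrow> 'm tensor" where
  "tscale c t = (\<lambda>is. c * t is)"

global_interpretation tens: vector_space "tscale :: complex \<Rightarrow> 'm tensor \<Rightarrow> 'm tensor"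
  by unfold_locales (auto simp: tscale_def plus_fun_def algebra_simps)

definition pure_tensor :: "(complex ^ 'm) list \<Rightarrow> 'm tensor" where
  "pure_tensor vs =
     (\<lambda>is. if length is = length vs then (\<Prod>k<length vs. (vs ! k) $ (is ! k)) else 0)"

text \<open>
  For subspaces \<open>K \<subseteq> W \<subseteq> L\<^sub>\<complex>\<close>, the tensor power \<open>(W/K)\<^sup>\<otimes>\<^sup>d\<close> is the quotient of \<open>tpow d W\<close> by
  \<open>tpow_rel d W K\<close>; its elements are represented as cosets.
\<close>

definition tpow :: "nat \<Rightarrow> (complex ^ 'm) set \<Rightarrow> 'm tensor set" where
  "tpow d W = tens.span {pure_tensor vs |vs. length vs = d \<and> set vs \<subseteq> W}"

definition tpow_rel :: "nat \<Rightarrow> (complex ^ 'm) set \<Rightarrow> (complex ^ 'm) set \<Rightarrow> 'm tensor set" where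
  "tpow_rel d W K =
     tens.span {pure_tensor vs |vs. length vs = d \<and> set vs \<subseteq> W \<and> set vs \<inter> K \<noteq> {}}"

definition tcoset :: "'m tensor set \<Rightarrow> 'm tensor \<Rightarrow> 'm tensor set" where
  "tcoset N t = {t + u |u. u \<in> N}"

definition tmap :: "complex ^ 'm ^ 'm \<Rightarrow> 'm tensor \<Rightarrow> 'm tensor" where
  "tmap g t = (\<lambda>is. \<Sum>js | length js = length is.
                 (\<Prod>k<length is. g $ (is ! k) $ (js ! k)) * t js)"

text \<open>\<open>contraction G p q\<close> pairs the tensor factors in positions \<open>p < q\<close> (counted from \<open>0\<close>).\<close>

definition contraction :: "int ^ 'm ^ 'm \<Rightarrow> nat \<Rightarrow> nat \<Rightarrow> 'm tensor \<Rightarrow> 'm tensor" where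
  "contraction G p q t =
     (\<lambda>js. \<Sum>x\<in>UNIV. \<Sum>y\<in>UNIV. of_int (G $ x $ y) *
        t (take p js @ [x] @ drop p (take (q - 1) js) @ [y] @ drop (q - 1) js))"

text \<open>Left action of permutations of \<open>{..<d}\<close>: the factor in position \<open>k\<close> moves to position
  \<open>\<sigma> k\<close>.\<close>

definition tperm :: "(nat \<Rightarrow> nat) \<Rightarrow> 'm tensor \<Rightarrow> 'm tensor" where
  "tperm \<sigma> t = (\<lambda>is. t (map (\<lambda>k. is ! \<sigma> k) [0..<length is]))"


section \<open>Partitions and Young symmetrizers\<close>

text \<open>A partition \<open>\<lambda>\<^sub>1 \<ge> \<dots> \<ge> \<lambda>\<^sub>n \<ge> 0\<close> is the list of its \<open>n\<close> parts, zeros included.\<close>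

definition is_partition :: "nat \<Rightarrow> nat list \<Rightarrow> bool" where
  "is_partition n lam \<longleftrightarrow> length lam = n \<and> sorted_wrt (\<ge>) lam"

text \<open>Columns are counted from \<open>0\<close>: \<open>col_len lam j\<close> is the part of index \<open>j + 1\<close> of the
  transposed partition.\<close>

definition col_len :: "nat list \<Rightarrow> nat \<Rightarrow> nat" where
  "col_len lam j = card {i. i < length lam \<and> j < lam ! i}"

definition is_box :: "nat list \<Rightarrow> nat \<Rightarrow> nat \<Rightarrow> bool" where
  "is_box lam i j \<longleftrightarrow> i < length lam \<and> j < lam ! i"

text \<open>The column canonical tableau, with entries \<open>0, \<dots>, d - 1\<close>: down the first column, then
  down the second one, and so on.\<close>

definition tableau :: "nat list \<Rightarrow> nat \<Rightarrow> nat \<Rightarrow> nat" where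
  "tableau lam i j = (\<Sum>j'<j. col_len lam j') + i"

definition row_group :: "nat list \<Rightarrow> (nat \<Rightarrow> nat) set" where
  "row_group lam = {\<sigma>. \<sigma> permutes {..<sum_list lam} \<and>
     (\<forall>i j. is_box lam i j \<longrightarrow> (\<exists>j'. is_box lam i j' \<and> \<sigma> (tableau lam i j) = tableau lam i j'))}"

definition col_group :: "nat list \<Rightarrow> (nat \<Rightarrow> nat) set" where
  "col_group lam = {\<sigma>. \<sigma> permutes {..<sum_list lam} \<and>
     (\<forall>i j. is_box lam i j \<longrightarrow> (\<exists>i'. is_box lam i' j \<and> \<sigma> (tableau lam i j) = tableau lam i' j))}"

definition row_sym :: "nat list \<Rightarrow> 'm tensor \<Rightarrow> 'm tensor" where
  "row_sym lam t = (\<Sum>\<sigma>\<in>row_group lam. tperm \<sigma> t)"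

definition col_antisym :: "nat list \<Rightarrow> 'm tensor \<Rightarrow> 'm tensor" where
  "col_antisym lam t = (\<Sum>\<sigma>\<in>col_group lam. tscale (of_int (sign \<sigma>)) (tperm \<sigma> t))"

definition young_symmetrizer :: "nat list \<Rightarrow> 'm tensor \<Rightarrow> 'm tensor" where
  "young_symmetrizer lam t = col_antisym lam (row_sym lam t)"

text \<open>
  Let \<open>K \<subseteq> W \<inter> W\<^sup>\<bottom>\<close>, so that \<open>V = W/K\<close> carries the induced form. \<open>traceless G d W K\<close> is
  the preimage of \<open>V\<^sup>[\<^sup>d\<^sup>]\<close> in \<open>tpow d W\<close>: all contractions vanish in \<open>V\<^sup>\<otimes>\<^sup>d\<^sup>-\<^sup>2\<close>. \<open>schur\<close> is
  \<open>V\<^sub>\<lambda> = c\<^sub>\<lambda> V\<^sup>[\<^sup>d\<^sup>]\<close> as a set of cosets, and \<open>schur_sub\<close> is the special case \<open>K = 0\<close>,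
  without the quotient.
\<close>

definition traceless ::
    "int ^ 'm ^ 'm \<Rightarrow> nat \<Rightarrow> (complex ^ 'm) set \<Rightarrow> (complex ^ 'm) set \<Rightarrow> 'm tensor set" where
  "traceless G d W K =
     {t \<in> tpow d W. \<forall>p q. p < q \<and> q < d \<longrightarrow> contraction G p q t \<in> tpow_rel (d - 2) W K}"

definition schur ::
    "int ^ 'm ^ 'm \<Rightarrow> nat list \<Rightarrow> (complex ^ 'm) set \<Rightarrow> (complex ^ 'm) set \<Rightarrow> 'm tensor set set" where
  "schur G lam W K =
     (\<lambda>t. tcoset (tpow_rel (sum_list lam) W K) (young_symmetrizer lam t))
       ` traceless G (sum_list lam) W K"

definition schur_sub ::
    "int ^ 'm ^ 'm \<Rightarrow> nat list \<Rightarrow> (complex ^ 'm) set \<Rightarrow> 'm tensor set" where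
  "schur_sub G lam V = young_symmetrizer lam ` traceless G (sum_list lam) V {0}"


section \<open>Vector-valued modular forms\<close>

text \<open>\<open>\<E>\<^sub>\<lambda>\<close> at \<open>[\<omega>]\<close>, where \<open>\<E>\<close> has fibre \<open>\<omega>\<^sup>\<bottom>/\<complex>\<omega>\<close>.\<close>

definition E_fibre :: "int ^ 'm ^ 'm \<Rightarrow> nat list \<Rightarrow> complex ^ 'm \<Rightarrow> 'm tensor set set" where
  "E_fibre G lam w = schur G lam (perp G {w}) (vec.span {w})"

definition holomorphic_vec :: "(complex ^ 'm) set \<Rightarrow> (complex ^ 'm \<Rightarrow> complex) \<Rightarrow> bool" where
  "holomorphic_vec U F \<longleftrightarrow>
     (\<forall>z\<in>U. \<exists>F'. (F has_derivative F') (at z) \<and> (\<forall>c v. F' (c *s v) = c * F' v))"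

text \<open>
  A section \<open>f\<close> of \<open>\<E>\<^sub>\<lambda> \<otimes> \<L>\<^sup>\<otimes>\<^sup>k\<close> is encoded by the map \<open>s\<close> on the nonzero vectors of \<open>\<L>\<close> with
  \<open>f([\<omega>]) = s(\<omega>) \<otimes> \<omega>\<^sup>\<otimes>\<^sup>k\<close>; thus \<open>s(c\<omega>) = c\<^sup>-\<^sup>k s(\<omega>)\<close>.
  As \<open>\<E> = \<L>\<^sup>\<bottom>/\<L>\<close> is a quotient of a subbundle of \<open>L\<^sub>\<complex> \<otimes> \<O>\<close>, and a holomorphic function on a
  complex submanifold is locally the restriction of one on an open set of the ambient space,
  \<open>s\<close> is holomorphic iff it lifts locally to holomorphic \<open>L\<^sub>\<complex>\<^sup>\<otimes>\<^sup>d\<close>-valued functions.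
\<close>

definition holomorphic_section ::
    "(complex ^ 'm) set \<Rightarrow> (complex ^ 'm \<Rightarrow> 'm tensor set) \<Rightarrow> bool" where
  "holomorphic_section D s \<longleftrightarrow>
     (\<forall>w\<in>D. \<exists>U F. open U \<and> w \<in> U \<and> (\<forall>is. holomorphic_vec U (\<lambda>z. F z is)) \<and>
              (\<forall>z \<in> U \<inter> D. F z \<in> s z))"

definition modular_form ::
    "int ^ 'm ^ 'm \<Rightarrow> (complex ^ 'm) set \<Rightarrow> (complex ^ 'm ^ 'm) set \<Rightarrow> nat list \<Rightarrow> int \<Rightarrow>
     (complex ^ 'm \<Rightarrow> 'm tensor set) \<Rightarrow> bool" where
  "modular_form G D \<Gamma> lam k s \<longleftrightarrow>
     (\<forall>w\<in>D. s w \<in> E_fibre G lam w) \<and>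
     (\<forall>w\<in>D. \<forall>c. c \<noteq> 0 \<longrightarrow> s (c *s w) = tscale (c powi (- k)) ` s w) \<and>
     holomorphic_section D s \<and>
     (\<forall>\<gamma>\<in>\<Gamma>. \<forall>w\<in>D. s (\<gamma> *v w) = tmap \<gamma> ` s w)"


section \<open>Fourier expansion at a 0-dimensional cusp\<close>

definition int_span :: "complex ^ 'm \<Rightarrow> (complex ^ 'm) set" where
  "int_span e = range (\<lambda>c::int. of_int c *s e)"

definition isotropic_rank_one :: "int ^ 'm ^ 'm \<Rightarrow> (complex ^ 'm) set \<Rightarrow> bool" where
  "isotropic_rank_one G I \<longleftrightarrow>
     (\<exists>e \<in> lat. e \<noteq> 0 \<and> I = int_span e) \<and> (\<forall>x\<in>I. \<forall>y\<in>I. form G x y = 0)"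

definition primitive_sublattice :: "(complex ^ 'm) set \<Rightarrow> bool" where
  "primitive_sublattice I \<longleftrightarrow>
     (\<forall>x\<in>lat. \<forall>c::int. c \<noteq> 0 \<longrightarrow> of_int c *s x \<in> I \<longrightarrow> x \<in> I)"

text \<open>
  The choices on which the expansion depends: \<open>e\<close> generates \<open>I\<close>, \<open>I'\<close> is isotropic of rank
  1 with \<open>(I,I') \<noteq> 0\<close>, and \<open>e' \<in> I'\<^sub>\<rat>\<close> satisfies \<open>(e,e') = 1\<close>.
\<close>

definition cusp_data ::
    "int ^ 'm ^ 'm \<Rightarrow> (complex ^ 'm) set \<Rightarrow> complex ^ 'm \<Rightarrow> (complex ^ 'm) set \<Rightarrow> complex ^ 'm \<Rightarrow> bool"
  where
  "cusp_data G I e I' e' \<longleftrightarrow>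
     I = int_span e \<and>
     isotropic_rank_one G I' \<and> (\<exists>x\<in>I. \<exists>y\<in>I'. form G x y \<noteq> 0) \<and>
     (\<exists>r\<in>\<rat>. \<exists>y\<in>I'. e' = r *s y) \<and> form G e e' = 1"

text \<open>
  \<open>VI G e e'\<close> is \<open>(I \<oplus> I')\<^sub>\<complex>\<^sup>\<bottom>\<close>, which stands both for \<open>V(I)\<close> and, via \<open>z \<mapsto> z \<otimes> e\<close>, for
  \<open>U(I)\<^sub>\<complex>\<close>; then \<open>U(I)\<^sub>F\<close> is \<open>VI G e e' \<inter> coords F\<close>. Its bilinear form is the restriction of
  \<open>form G\<close>, since generators of \<open>I\<close> are given norm 1.
\<close>

definition VI :: "int ^ 'm ^ 'm \<Rightarrow> complex ^ 'm \<Rightarrow> complex ^ 'm \<Rightarrow> (complex ^ 'm) set" where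
  "VI G e e' = perp G {e, e'}"

definition eichler :: "int ^ 'm ^ 'm \<Rightarrow> complex ^ 'm \<Rightarrow> complex ^ 'm \<Rightarrow> complex ^ 'm ^ 'm" where
  "eichler G m l =
     matrix (\<lambda>v. v - form G m v *s l + form G l v *s m - (form G m m * form G l v / 2) *s l)"

definition U_int ::
    "int ^ 'm ^ 'm \<Rightarrow> (complex ^ 'm ^ 'm) set \<Rightarrow> complex ^ 'm \<Rightarrow> complex ^ 'm \<Rightarrow> (complex ^ 'm) set"
  where
  "U_int G \<Gamma> e e' = {z \<in> VI G e e' \<inter> coords \<rat>. eichler G z e \<in> \<Gamma>}"

definition U_dual ::
    "int ^ 'm ^ 'm \<Rightarrow> (complex ^ 'm ^ 'm) set \<Rightarrow> complex ^ 'm \<Rightarrow> complex ^ 'm \<Rightarrow> (complex ^ 'm) set"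
  where
  "U_dual G \<Gamma> e e' =
     {l \<in> VI G e e' \<inter> coords \<rat>. \<forall>z \<in> U_int G \<Gamma> e e'. form G l z \<in> \<int>}"

definition tube_map ::
    "int ^ 'm ^ 'm \<Rightarrow> complex ^ 'm \<Rightarrow> complex ^ 'm \<Rightarrow> complex ^ 'm \<Rightarrow> complex ^ 'm" where
  "tube_map G e e' z = e' + z - (form G z z / 2) *s e"

definition tube_domain ::
    "int ^ 'm ^ 'm \<Rightarrow> complex ^ 'm \<Rightarrow> complex ^ 'm \<Rightarrow> (complex ^ 'm) set \<Rightarrow> (complex ^ 'm) set"
  where
  "tube_domain G e e' C = {z \<in> VI G e e'. Im_vec z \<in> C}"

text \<open>
  \<open>C\<close> is the component for which the tube domain is identified with \<open>D\<close>, i.e. every point of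
  the cone \<open>D\<close> is a nonzero multiple of the image of a point of the tube domain and conversely.
  (Injectivity is automatic, as \<open>tube_map G e e' z\<close> pairs to \<open>1\<close> with \<open>e\<close>.)
\<close>

definition tube_component ::
    "int ^ 'm ^ 'm \<Rightarrow> (complex ^ 'm) set \<Rightarrow> complex ^ 'm \<Rightarrow> complex ^ 'm \<Rightarrow> (complex ^ 'm) set \<Rightarrow> bool"
  where
  "tube_component G D e e' C \<longleftrightarrow>
     C \<in> components {v \<in> VI G e e' \<inter> coords \<real>. Re (form G v v) > 0} \<and>
     D = {c *s tube_map G e e' z |c z. c \<noteq> 0 \<and> z \<in> tube_domain G e e' C}"

text \<open>
  The isomorphism \<open>(\<omega>\<^sup>\<bottom>/\<complex>\<omega>)\<^sup>\<otimes>\<^sup>d \<rightarrow> (I\<^sup>\<bottom>/I)\<^sub>\<complex>\<^sup>\<otimes>\<^sup>d\<close> on cosets, induced by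
  \<open>I\<^sub>\<complex>\<^sup>\<bottom>/I\<^sub>\<complex> \<leftarrow> I\<^sub>\<complex>\<^sup>\<bottom> \<inter> \<omega>\<^sup>\<bottom> \<rightarrow> \<omega>\<^sup>\<bottom>/\<complex>\<omega>\<close>: choose a representative in
  \<open>(I\<^sub>\<complex>\<^sup>\<bottom> \<inter> \<omega>\<^sup>\<bottom>)\<^sup>\<otimes>\<^sup>d\<close> and take its class.
\<close>

definition cusp_iso ::
    "int ^ 'm ^ 'm \<Rightarrow> nat \<Rightarrow> complex ^ 'm \<Rightarrow> complex ^ 'm \<Rightarrow> 'm tensor set \<Rightarrow> 'm tensor set" where
  "cusp_iso G d e w S =
     {t + u |t u. t \<in> S \<inter> tpow d (perp G {e} \<inter> perp G {w}) \<and>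
                  u \<in> tpow_rel d (perp G {e}) (vec.span {e})}"

text \<open>
  The \<open>V(I)\<^sub>\<lambda>\<^sub>,\<^sub>k\<close>-valued function on the tube domain defined by a section. The isomorphism
  \<open>\<L> \<simeq> I\<^sub>\<complex>\<^sup>\<or> \<otimes> \<O>\<close> sends \<open>tube_map G e e' z\<close> to the generator \<open>e\<^sup>\<or>\<close> of \<open>I\<^sub>\<complex>\<^sup>\<or>\<close> dual to \<open>e\<close>, so
  the value is the coefficient of \<open>(e\<^sup>\<or>)\<^sup>\<otimes>\<^sup>k\<close>; it is given by its representative in the tensor
  power of \<open>(I \<oplus> I')\<^sub>\<complex>\<^sup>\<bottom>\<close>, which maps isomorphically to \<open>(I\<^sup>\<bottom>/I)\<^sub>\<complex>\<close>.
\<close>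

definition cusp_function ::
    "int ^ 'm ^ 'm \<Rightarrow> nat list \<Rightarrow> complex ^ 'm \<Rightarrow> complex ^ 'm \<Rightarrow>
     (complex ^ 'm \<Rightarrow> 'm tensor set) \<Rightarrow> complex ^ 'm \<Rightarrow> 'm tensor" where
  "cusp_function G lam e e' s z =
     (THE t. t \<in> tpow (sum_list lam) (VI G e e') \<and>
             t \<in> cusp_iso G (sum_list lam) e (tube_map G e e' z) (s (tube_map G e e' z)))"

definition fourier_expansion ::
    "int ^ 'm ^ 'm \<Rightarrow> (complex ^ 'm ^ 'm) set \<Rightarrow> nat list \<Rightarrow> complex ^ 'm \<Rightarrow> complex ^ 'm \<Rightarrow>
     (complex ^ 'm) set \<Rightarrow> (complex ^ 'm \<Rightarrow> 'm tensor set) \<Rightarrow> (complex ^ 'm \<Rightarrow> 'm tensor) \<Rightarrow> bool"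
  where
  "fourier_expansion G \<Gamma> lam e e' C s a \<longleftrightarrow>
     (\<forall>l \<in> U_dual G \<Gamma> e e'. a l \<in> schur_sub G lam (VI G e e')) \<and>
     (\<forall>z \<in> tube_domain G e e' C. \<forall>is.
        ((\<lambda>l. a l is * exp (2 * of_real pi * \<i> * form G l z))
           has_sum cusp_function G lam e e' s z is) (U_dual G \<Gamma> e e'))"

end

theory Submission
  imports
    Defs
    "HOL-Computational_Algebra.Polynomial"
    "HOL-Analysis.Kronecker_Approximation_Theorem"
begin

text \<open>
  Write \<open>V = (I \<oplus> I')\<^sup>\<bottom>\<close>, a complex quadratic space of dimension \<open>n\<close>; the constant term \<open>a(0)\<close>
  lies in \<open>V\<^sub>\<lambda>\<close>. It is fixed by every element of \<open>\<Gamma>\<close> that fixes \<open>e\<close> and \<open>e'\<close>. These elements form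
  an arithmetic subgroup of the orthogonal group of \<open>V\<close>, which has real signature \<open>(1, n - 1)\<close>, so
  Borel density predicts that \<open>a(0)\<close> is fixed by the whole of \<open>SO(V)\<close>. The representation \<open>V\<^sub>\<lambda>\<close> has
  no nonzero \<open>SO(V)\<close>-invariant vector unless \<open>\<lambda>\<close> is \<open>(0)\<close> or \<open>(1\<^sup>n)\<close>. Both of the general
  theorems are replaced by short direct arguments.

  \<^item> Invariance under the discrete group (\<open>constant_term_invariant\<close>). If \<open>\<gamma>\<close> fixes \<open>e\<close> and \<open>e'\<close>,
    then \<open>f(\<gamma>Z) = \<gamma> f(Z)\<close> on the tube domain. For a generic real vector \<open>x\<close>, the average of
    \<open>f(Z + jx)\<close> over \<open>j < N\<close> tends to \<open>a(0)\<close>, because \<open>(l,x)\<close> is not an integer for any rational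
    \<open>l \<noteq> 0\<close>; averaging both sides of the equation gives \<open>a(0) = \<gamma> a(0)\<close>.

  \<^item> From discrete to infinitesimal invariance (\<open>rotation_kills\<close>). Let \<open>u, v \<in> V\<close> be orthogonal
    lattice vectors of norms \<open>A > 0\<close> and \<open>-B < 0\<close> with \<open>AB\<close> not a square. A solution of Pell's
    equation for \<open>AB\<close> gives an integral isometry of infinite order that moves only the plane of
    \<open>u, v\<close>, and a power of it lies in \<open>\<Gamma>\<close>. It belongs to a one-parameter group whose action on
    tensors is a Laurent polynomial in the parameter \<open>s\<close>; a tensor fixed for infinitely many \<open>s\<close>
    is fixed for all \<open>s\<close>, so the derivative at \<open>s = 1\<close>, which is the rotation \<open>u \<and> v\<close> of the Lie
    algebra \<open>so(V)\<close>, kills \<open>a(0)\<close>. If \<open>AB\<close> is a square, then \<open>v\<close> is perturbed to \<open>x v \<plusminus> w\<close> with a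
    vector \<open>w\<close> orthogonal to \<open>u\<close> and \<open>v\<close>, which exists because \<open>n \<ge> 3\<close>. Linearity in
    \<open>u\<close> and \<open>v\<close> then gives all rational pairs.

  \<^item> Absence of invariants (\<open>traceless_schur_rotation_invariant_zero\<close>). The Casimir element of
    \<open>so(V)\<close>, with one of its two factors acting only at the position \<open>p\<close>, shows that a traceless
    tensor \<open>t\<close> killed by \<open>so(V)\<close> satisfies \<open>\<Sum> (p k) t = - (n - 1) t\<close>, where \<open>k\<close> runs over the
    other positions. For \<open>t\<close> in the image of the Young symmetrizer and \<open>p\<close> in the last column,
    of length \<open>c\<close> and preceded by \<open>J\<close> columns, the same sum is \<open>(J - (c - 1)) t\<close>: each earlier
    column contributes \<open>t\<close> by a Garnir relation, and each other box of the last column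
    contributes \<open>- t\<close>. Hence \<open>(n + J - c) t = 0\<close>. As \<open>c \<le> n\<close>, the factor vanishes only for
    \<open>J = 0\<close> and \<open>c = n\<close>, that is for \<open>\<lambda> = (1\<^sup>n)\<close>.
\<close>

section \<open>The bilinear form\<close>

lemma form_add_left: "form G (u + v) w = form G u w + form G v w"
  by (simp add: form_def algebra_simps sum.distrib)

lemma form_add_right: "form G w (u + v) = form G w u + form G w v"
  by (simp add: form_def algebra_simps sum.distrib)

lemma form_scale_left: "form G (c *s u) w = c * form G u w"
  by (simp add: form_def algebra_simps sum_distrib_left)

lemma form_scale_right: "form G w (c *s u) = c * form G w u"
  by (simp add: form_def algebra_simps sum_distrib_left)

lemma form_diff_left: "form G (u - v) w = form G u w - form G v w"
  by (simp add: form_def algebra_simps sum_subtractf)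

lemma form_diff_right: "form G w (u - v) = form G w u - form G w v"
  by (simp add: form_def algebra_simps sum_subtractf)

lemma form_zero_left [simp]: "form G 0 w = 0"
  by (simp add: form_def)

lemma form_zero_right [simp]: "form G w 0 = 0"
  by (simp add: form_def)

lemmas form_linear = form_add_left form_add_right form_scale_left form_scale_right
  form_diff_left form_diff_right

lemma form_sum_left: "form G (sum u A) w = (\<Sum>i\<in>A. form G (u i) w)"
  by (induction A rule: infinite_finite_induct) (simp_all add: form_linear)

lemma form_sum_right: "form G w (sum u A) = (\<Sum>i\<in>A. form G w (u i))"
  by (induction A rule: infinite_finite_induct) (simp_all add: form_linear)

lemma gram_matrix_sym:
  assumes "gram_matrix G"
  shows "G $ j $ i = G $ i $ j"
proof -
  have "transpose G $ i $ j = G $ i $ j"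
    using assms by (simp add: gram_matrix_def)
  then show ?thesis by (simp add: transpose_def)
qed

lemma form_sym: "gram_matrix G \<Longrightarrow> form G u v = form G v u"
  unfolding form_def
  by (subst sum.swap) (intro sum.cong refl, simp add: gram_matrix_sym mult_ac)

lemma form_axis_right: "form G v (axis j 1) = (\<Sum>i\<in>UNIV. of_int (G $ i $ j) * v $ i)"
  by (simp add: form_def axis_def if_distrib sum.delta cong: if_cong)

lemma vec_expand: "(v :: complex ^ 'm) = (\<Sum>i\<in>UNIV. v $ i *s axis i 1)"
  by (simp add: basis_expansion)

lemma form_expand_left: "form G v w = (\<Sum>i\<in>UNIV. v $ i * form G (axis i 1) w)"
  by (subst vec_expand[of v]) (simp only: form_sum_left form_scale_left)

lemma form_expand_right: "form G v w = (\<Sum>i\<in>UNIV. w $ i * form G v (axis i 1))"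
  by (subst vec_expand[of w]) (simp only: form_sum_right form_scale_right)

lemma form_nondegenerate:
  assumes "gram_matrix G" "\<And>w. form G v w = 0"
  shows "v = 0"
proof -
  let ?M = "map_matrix (of_int :: int \<Rightarrow> complex) G"
  have "det ?M = of_int (det G)"
    by (simp add: det_def map_matrix_def of_int_sum of_int_prod)
  then have "invertible ?M"
    using assms(1) by (simp add: gram_matrix_def invertible_det_nz)
  then obtain N where N: "?M ** N = mat 1"
    by (auto simp: invertible_def)
  have "v v* ?M = 0"
    using assms(2)[of "axis _ 1"]
    by (simp add: vec_eq_iff vector_matrix_mult_def form_axis_right map_matrix_def mult.commute)
  then have "v v* (?M ** N) = 0"
    by (metis vector_matrix_mul_assoc vector_matrix_mult_0)
  then show ?thesis by (simp add: N)
qed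

section \<open>Tensor powers of subspaces\<close>

lemma finite_lists_length: "finite {js :: 'm::finite list. length js = n}"
  using finite_lists_length_eq[of "UNIV :: 'm set" n] by simp

lemma sum_lists_Suc:
  fixes F :: "'m::finite list \<Rightarrow> 'a::comm_monoid_add"
  shows "(\<Sum>js | length js = Suc n. F js) = (\<Sum>j\<in>UNIV. \<Sum>js | length js = n. F (j # js))"
proof -
  have "(\<Sum>js | length js = Suc n. F js) =
        (\<Sum>(j, js)\<in>UNIV \<times> {js. length js = n}. F (j # js))"
    by (rule sum.reindex_bij_witness[of _ "\<lambda>(j, js). j # js" "\<lambda>js. (hd js, tl js)"])
      (auto simp: length_Suc_conv)
  then show ?thesis by (simp add: sum.cartesian_product)
qed

text \<open>The expansion of a product of sums over all choices of indices: it reduces every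
  computation with \<^const>\<open>tmap\<close> to one tensor factor.\<close>

lemma sum_lists_prod:
  fixes F :: "nat \<Rightarrow> 'm::finite \<Rightarrow> 'a::comm_semiring_1"
  shows "(\<Sum>js | length js = n. \<Prod>k<n. F k (js ! k)) = (\<Prod>k<n. \<Sum>j\<in>UNIV. F k j)"
proof (induction n arbitrary: F)
  case 0
  then show ?case by simp
next
  case (Suc n)
  show ?case
    by (simp add: sum_lists_Suc prod.lessThan_Suc_shift Suc.IH[of "\<lambda>k. F (Suc k)"]
        sum_distrib_left[symmetric] sum_distrib_right[symmetric] del: prod.lessThan_Suc)
qed

lemma tmap_mult:
  fixes t :: "'m::finite tensor"
  shows "tmap (g ** h) t = tmap g (tmap h t)"
proof
  fix xs :: "'m list"
  let ?n = "length xs"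
  have "tmap g (tmap h t) xs = (\<Sum>js | length js = ?n. \<Sum>ls | length ls = ?n.
          (\<Prod>k<?n. g $ (xs ! k) $ (js ! k) * h $ (js ! k) $ (ls ! k)) * t ls)"
    unfolding tmap_def by (intro sum.cong) (auto simp: sum_distrib_left prod.distrib mult_ac)
  also have "\<dots> = (\<Sum>ls | length ls = ?n.
          (\<Prod>k<?n. (g ** h) $ (xs ! k) $ (ls ! k)) * t ls)"
    by (subst sum.swap)
      (simp add: sum_distrib_right[symmetric] matrix_matrix_mult_def
        sum_lists_prod[where F = "\<lambda>k j. g $ (xs ! k) $ j * h $ j $ (_ ! k)"])
  finally show "tmap (g ** h) t xs = tmap g (tmap h t) xs" by (simp add: tmap_def)
qed

lemma prod_delta_lists:
  fixes xs js :: "'m list"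
  assumes "length js = length xs"
  shows "(\<Prod>k<length xs. if xs ! k = js ! k then 1 else 0 :: complex) = (if js = xs then 1 else 0)"
proof (cases "js = xs")
  case False
  then obtain k where "k < length xs" "xs ! k \<noteq> js ! k"
    using assms by (metis nth_equalityI)
  then show ?thesis using False by (auto simp: prod_zero_iff)
qed simp

lemma tmap_one: "tmap (mat 1) t = t"
proof
  fix xs
  have "tmap (mat 1) t xs = (\<Sum>js | length js = length xs. (if js = xs then t js else 0))"
    unfolding tmap_def
    by (intro sum.cong) (auto simp: mat_def prod_delta_lists[simplified] prod_zero_iff)
  then show "tmap (mat 1) t xs = t xs" by (simp add: finite_lists_length sum.delta)
qed

lemma tmap_add: "tmap g (t + u) = tmap g t + tmap g u"
  by (rule ext) (simp add: tmap_def algebra_simps sum.distrib)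

lemma tmap_diff: "tmap g (t - u) = tmap g t - tmap g u"
  by (rule ext) (simp add: tmap_def algebra_simps sum_subtractf)

lemma tmap_scale: "tmap g (tscale c t) = tscale c (tmap g t)"
  by (rule ext) (simp add: tmap_def tscale_def algebra_simps sum_distrib_left)

lemma tmap_zero [simp]: "tmap g 0 = 0"
  by (rule ext) (simp add: tmap_def)

lemma tmap_pure: "tmap g (pure_tensor vs) = pure_tensor (map (\<lambda>v. g *v v) vs)"
proof
  fix xs
  show "tmap g (pure_tensor vs) xs = pure_tensor (map ((*v) g) vs) xs"
  proof (cases "length xs = length vs")
    case True
    have "tmap g (pure_tensor vs) xs = (\<Sum>js | length js = length vs.
       (\<Prod>k<length vs. g $ (xs ! k) $ (js ! k) * (vs ! k) $ (js ! k)))"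
      unfolding tmap_def pure_tensor_def using True by (simp add: prod.distrib)
    also have "\<dots> = (\<Prod>k<length vs. \<Sum>j\<in>UNIV. g $ (xs ! k) $ j * (vs ! k) $ j)"
      by (rule sum_lists_prod[where F = "\<lambda>k j. g $ (xs ! k) $ j * (vs ! k) $ j"])
    finally show ?thesis using True
      by (simp add: pure_tensor_def matrix_vector_mult_def)
  qed (simp add: tmap_def pure_tensor_def)
qed

lemma tpow_induct [consumes 1, case_names pure zero add scale]:
  assumes "t \<in> tpow d W"
    and "\<And>vs. length vs = d \<Longrightarrow> set vs \<subseteq> W \<Longrightarrow> Q (pure_tensor vs)"
    and "Q 0" and "\<And>s t. Q s \<Longrightarrow> Q t \<Longrightarrow> Q (s + t)" and "\<And>c t. Q t \<Longrightarrow> Q (tscale c t)"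
  shows "Q t"
  using assms(1) unfolding tpow_def
  by (rule tens.span_induct) (use assms in \<open>auto simp: tens.subspace_def\<close>)

lemma tpow_rel_induct [consumes 1, case_names pure zero add scale]:
  assumes "t \<in> tpow_rel d W K"
    and "\<And>vs. length vs = d \<Longrightarrow> set vs \<subseteq> W \<Longrightarrow> set vs \<inter> K \<noteq> {} \<Longrightarrow> Q (pure_tensor vs)"
    and "Q 0" and "\<And>s t. Q s \<Longrightarrow> Q t \<Longrightarrow> Q (s + t)" and "\<And>c t. Q t \<Longrightarrow> Q (tscale c t)"
  shows "Q t"
  using assms(1) unfolding tpow_rel_def
  by (rule tens.span_induct) (use assms in \<open>auto simp: tens.subspace_def\<close>)

lemma tpow_pure: "length vs = d \<Longrightarrow> set vs \<subseteq> W \<Longrightarrow> pure_tensor vs \<in> tpow d W"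
  unfolding tpow_def by (intro tens.span_base) auto

lemma tpow_rel_pure:
  "length vs = d \<Longrightarrow> set vs \<subseteq> W \<Longrightarrow> set vs \<inter> K \<noteq> {} \<Longrightarrow> pure_tensor vs \<in> tpow_rel d W K"
  unfolding tpow_rel_def by (intro tens.span_base) auto

lemma subspace_tpow: "tens.subspace (tpow d W)"
  by (simp add: tpow_def)

lemma subspace_tpow_rel: "tens.subspace (tpow_rel d W K)"
  by (simp add: tpow_rel_def)

lemmas tpow_closed = subspace_tpow[THEN tens.subspace_0] subspace_tpow[THEN tens.subspace_add]
  subspace_tpow[THEN tens.subspace_scale] subspace_tpow[THEN tens.subspace_sum]
  subspace_tpow[THEN tens.subspace_diff]

lemmas tpow_rel_closed = subspace_tpow_rel[THEN tens.subspace_0]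
  subspace_tpow_rel[THEN tens.subspace_add] subspace_tpow_rel[THEN tens.subspace_scale]
  subspace_tpow_rel[THEN tens.subspace_diff] subspace_tpow_rel[THEN tens.subspace_neg]

lemma tpow_rel_subset_tpow: "t \<in> tpow_rel d W K \<Longrightarrow> t \<in> tpow d W"
  by (induction rule: tpow_rel_induct) (blast intro: tpow_pure tpow_closed)+

lemma tmap_in_tpow:
  "t \<in> tpow d W \<Longrightarrow> (\<And>v. v \<in> W \<Longrightarrow> g *v v \<in> W') \<Longrightarrow> tmap g t \<in> tpow d W'"
  by (induction rule: tpow_induct)
    (fastforce simp: tmap_pure tmap_add tmap_scale intro: tpow_pure tpow_closed)+

lemma tmap_fixes_tpow: "t \<in> tpow d W \<Longrightarrow> (\<And>v. v \<in> W \<Longrightarrow> g *v v = v) \<Longrightarrow> tmap g t = t"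
proof (induction rule: tpow_induct)
  case (pure vs)
  then have "map ((*v) g) vs = vs" by (intro map_idI) auto
  then show ?case by (simp add: tmap_pure)
qed (simp_all add: tmap_add tmap_scale)

lemma pure_tensor_zero: "0 \<in> set vs \<Longrightarrow> pure_tensor vs = 0"
  by (rule ext) (force simp: pure_tensor_def in_set_conv_nth)

lemma tmap_kills_tpow_rel:
  "t \<in> tpow_rel d W K \<Longrightarrow> (\<And>v. v \<in> K \<Longrightarrow> g *v v = 0) \<Longrightarrow> tmap g t = 0"
proof (induction rule: tpow_rel_induct)
  case (pure vs)
  then obtain v where "v \<in> set vs" "g *v v = 0" by auto
  then have "0 \<in> set (map ((*v) g) vs)" by force
  then show ?case by (simp only: tmap_pure pure_tensor_zero)
qed (simp_all add: tmap_add tmap_scale)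

lemma pure_tensor_diff:
  fixes x y :: "complex ^ 'm"
  shows "pure_tensor (us @ x # vs) - pure_tensor (us @ y # vs) = pure_tensor (us @ (x - y) # vs)"
proof
  fix xs
  let ?n = "length us + Suc (length vs)"
  have split: "(\<Prod>k<?n. ((us @ z # vs) ! k) $ (xs ! k)) =
      z $ (xs ! length us) * (\<Prod>k\<in>{..<?n} - {length us}. ((us @ x # vs) ! k) $ (xs ! k))" for z
  proof -
    have "(\<Prod>k<?n. ((us @ z # vs) ! k) $ (xs ! k)) =
       z $ (xs ! length us) * (\<Prod>k\<in>{..<?n} - {length us}. ((us @ z # vs) ! k) $ (xs ! k))"
      by (subst prod.remove[of _ "length us"]) auto
    also have "(\<Prod>k\<in>{..<?n} - {length us}. ((us @ z # vs) ! k) $ (xs ! k)) =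
               (\<Prod>k\<in>{..<?n} - {length us}. ((us @ x # vs) ! k) $ (xs ! k))"
      by (intro prod.cong) (auto simp: nth_append nth_Cons split: nat.splits)
    finally show ?thesis .
  qed
  show "(pure_tensor (us @ x # vs) - pure_tensor (us @ y # vs)) xs =
        pure_tensor (us @ (x - y) # vs) xs"
    unfolding pure_tensor_def minus_apply using split[of x] split[of y] split[of "x - y"]
    by (simp add: left_diff_distrib del: prod.lessThan_Suc)
qed

text \<open>The factors of a pure tensor are changed one after the other; each change replaces one factor
  \<open>v\<close> by \<open>gv\<close>, and the difference is a pure tensor with the factor \<open>gv - v \<in> K\<close>.\<close>

lemma tmap_minus_in_tpow_rel:
  assumes "t \<in> tpow d W" and g: "\<And>v. v \<in> W \<Longrightarrow> g *v v \<in> W" "\<And>v. v \<in> W \<Longrightarrow> g *v v - v \<in> K"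
    and W: "\<And>u v. u \<in> W \<Longrightarrow> v \<in> W \<Longrightarrow> u - v \<in> W"
  shows "tmap g t - t \<in> tpow_rel d W K"
  using assms(1)
proof (induction rule: tpow_induct)
  case (pure vs)
  have "pure_tensor (us @ map ((*v) g) ws) - pure_tensor (us @ ws) \<in> tpow_rel d W K"
    if "length us + length ws = d" "set us \<subseteq> W" "set ws \<subseteq> W" for us ws
    using that
  proof (induction ws arbitrary: us)
    case Nil
    show ?case by (simp only: list.map diff_self tpow_rel_closed(1))
  next
    case (Cons x ws)
    have "pure_tensor ((us @ [g *v x]) @ map ((*v) g) ws) - pure_tensor ((us @ [g *v x]) @ ws)
          \<in> tpow_rel d W K"
      using Cons.prems g by (intro Cons.IH) auto
    moreover have "pure_tensor (us @ (g *v x) # ws) - pure_tensor (us @ x # ws) \<in> tpow_rel d W K"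
      unfolding pure_tensor_diff using Cons.prems g W by (intro tpow_rel_pure) auto
    ultimately have
      "(pure_tensor ((us @ [g *v x]) @ map ((*v) g) ws) - pure_tensor ((us @ [g *v x]) @ ws)) +
       (pure_tensor (us @ (g *v x) # ws) - pure_tensor (us @ x # ws)) \<in> tpow_rel d W K"
      by (rule tpow_rel_closed(2))
    then show ?case by (simp only: append_assoc append_Cons append_Nil list.map diff_add_cancel
        diff_add_eq[symmetric] add_diff_eq)
  qed
  from this[of "[]" vs] pure show ?case
    by (simp only: tmap_pure append_Nil list.size add_0 list.set empty_subsetI)
next
  case (add s t)
  have "tmap g (s + t) - (s + t) = (tmap g s - s) + (tmap g t - t)"
    by (simp only: tmap_add add_diff_add)
  then show ?case using tpow_rel_closed(2)[OF add] by (simp only:)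
next
  case (scale c t)
  have "tmap g (tscale c t) - tscale c t = tscale c (tmap g t - t)"
    by (simp only: tmap_scale tens.scale_right_diff_distrib)
  then show ?case using tpow_rel_closed(3)[OF scale, of c] by (simp only:)
qed (simp only: tmap_zero diff_self tpow_rel_closed(1))

lemma sum_tensor_apply: "(\<Sum>x\<in>A. (f x :: 'm tensor)) ys = (\<Sum>x\<in>A. f x ys)"
  by (induction A rule: infinite_finite_induct) auto

lemma tpow_support: "t \<in> tpow d W \<Longrightarrow> length xs \<noteq> d \<Longrightarrow> t xs = 0"
  by (induction rule: tpow_induct) (auto simp: pure_tensor_def tscale_def)

section \<open>Permutations of tensor factors\<close>

lemma tperm_add: "tperm \<sigma> (s + t) = tperm \<sigma> s + tperm \<sigma> t"
  by (rule ext) (simp add: tperm_def)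

lemma tperm_scale: "tperm \<sigma> (tscale c t) = tscale c (tperm \<sigma> t)"
  by (rule ext) (simp add: tperm_def tscale_def)

lemma tperm_zero [simp]: "tperm \<sigma> 0 = 0"
  by (rule ext) (simp add: tperm_def)

lemma tperm_sum: "tperm \<sigma> (sum f A) = (\<Sum>x\<in>A. tperm \<sigma> (f x))"
  by (induction A rule: infinite_finite_induct) (simp_all only: sum.infinite sum.empty
      sum.insert tperm_zero tperm_add not_False_eq_True)

lemma tperm_pure:
  assumes "\<sigma> permutes {..<length vs}"
  shows "tperm \<sigma> (pure_tensor vs) = pure_tensor (map (\<lambda>k. vs ! inv_into UNIV \<sigma> k) [0..<length vs])"
proof
  fix xs :: "'a list"
  show "tperm \<sigma> (pure_tensor vs) xs = pure_tensor (map (\<lambda>k. vs ! inv_into UNIV \<sigma> k) [0..<length vs]) xs"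
  proof (cases "length xs = length vs")
    case True
    have "(\<Prod>k<length vs. (vs ! k) $ (xs ! \<sigma> k)) = (\<Prod>k<length vs. (vs ! inv_into UNIV \<sigma> k) $ (xs ! k))"
      using prod.permute[OF permutes_inv[OF assms], of "\<lambda>k. (vs ! k) $ (xs ! \<sigma> k)"]
      by (simp add: o_def permutes_inverses[OF assms])
    then show ?thesis using True by (simp add: tperm_def pure_tensor_def)
  qed (simp add: tperm_def pure_tensor_def)
qed

lemma tperm_in_tpow:
  assumes "t \<in> tpow d W" "\<sigma> permutes {..<d}"
  shows "tperm \<sigma> t \<in> tpow d W"
  using assms(1)
proof (induction rule: tpow_induct)
  case (pure vs)
  have "inv_into UNIV \<sigma> k < d" if "k < d" for k
    using permutes_in_image[OF permutes_inv[OF assms(2)]] that by auto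
  then show ?case using assms(2) pure by (fastforce simp: tperm_pure intro!: tpow_pure)
qed (simp_all only: tperm_zero tperm_add tperm_scale tpow_closed)

lemma young_symmetrizer_in_tpow:
  assumes "t \<in> tpow (sum_list lam) W"
  shows "young_symmetrizer lam t \<in> tpow (sum_list lam) W"
  unfolding young_symmetrizer_def col_antisym_def row_sym_def
  by (intro tpow_closed tperm_in_tpow assms) (auto simp: row_group_def col_group_def)

lemma E_fibre_coset:
  assumes "S \<in> E_fibre G lam w"
  obtains t where "t \<in> tpow (sum_list lam) (perp G {w})"
    "S = tcoset (tpow_rel (sum_list lam) (perp G {w}) (vec.span {w})) t"
  using assms young_symmetrizer_in_tpow unfolding E_fibre_def schur_def traceless_def by blast

section \<open>The function at the cusp\<close>

lemma perp_diff: "u \<in> perp G A \<Longrightarrow> v \<in> perp G A \<Longrightarrow> u - v \<in> perp G A"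
  by (simp add: perp_def form_diff_left)

lemma perp_scale: "v \<in> perp G A \<Longrightarrow> c *s v \<in> perp G A"
  by (simp add: perp_def form_scale_left)

lemma perp_add: "u \<in> perp G A \<Longrightarrow> v \<in> perp G A \<Longrightarrow> u + v \<in> perp G A"
  by (simp add: perp_def form_add_left)

lemma linear_vecI:
  assumes "\<And>u v. f (u + v) = f u + f v" "\<And>c v. f (c *s v) = c *s f v"
  shows "Vector_Spaces.linear (*s) (*s) (f :: complex ^ 'm \<Rightarrow> complex ^ 'm)"
  using assms by unfold_locales auto

text \<open>If \<open>(w,u) = 1\<close>, this is the projection along \<open>w\<close> onto \<open>u\<^sup>\<bottom>\<close>.\<close>

definition proj_along :: "int ^ 'm ^ 'm \<Rightarrow> complex ^ 'm \<Rightarrow> complex ^ 'm \<Rightarrow> complex ^ 'm ^ 'm" where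
  "proj_along G u w = matrix (\<lambda>v. v - form G v u *s w)"

lemma proj_along_apply: "proj_along G u w *v v = v - form G v u *s w"
  unfolding proj_along_def
  by (rule matrix_works, rule linear_vecI)
    (simp_all add: form_linear vec_eq_iff algebra_simps)

locale hyperbolic_pair =
  fixes G :: "int ^ 'm ^ 'm" and e e' :: "complex ^ 'm"
  assumes gram: "gram_matrix G"
    and ee [simp]: "form G e e = 0" and e'e' [simp]: "form G e' e' = 0"
    and ee' [simp]: "form G e e' = 1"
begin

lemma e'e [simp]: "form G e' e = 1"
  using form_sym[OF gram] ee' by metis

lemma VI_iff: "v \<in> VI G e e' \<longleftrightarrow> form G v e = 0 \<and> form G v e' = 0"
  by (auto simp: VI_def perp_def)

lemma VI_iff': "v \<in> VI G e e' \<longleftrightarrow> form G e v = 0 \<and> form G e' v = 0"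
  using VI_iff form_sym[OF gram] by metis

lemma tube_map_isotropic:
  assumes "z \<in> VI G e e'"
  shows "form G (tube_map G e e' z) (tube_map G e e' z) = 0" 
    and "form G (tube_map G e e' z) e = 1"
  using assms VI_iff[of z] VI_iff'[of z] by (simp_all add: tube_map_def form_linear)

text \<open>
  The isomorphism \<open>\<omega>\<^sup>\<bottom>/\<complex>\<omega> \<rightarrow> V\<close> of the cusp trivialization is induced by the projection along \<open>w\<close>
  onto \<open>e\<^sup>\<bottom>\<close> followed by the projection along \<open>e\<close> onto \<open>e'\<^sup>\<bottom>\<close>. On tensor powers, each of them fixes
  the tensors over its image and kills the relations, so the coset contains at most one element of
  \<open>V\<^sup>\<otimes>\<^sup>d\<close>; each of them changes a tensor only by relations, so it contains one.
\<close>

lemma cusp_function_eq: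
  assumes z: "z \<in> VI G e e'" and w: "w = tube_map G e e' z"
    and f: "f w \<in> E_fibre G lam w" and t: "t \<in> f w"
  shows "cusp_function G lam e e' f z = tmap (proj_along G e' e ** proj_along G e w) t"
proof -
  let ?d = "sum_list lam" and ?W = "perp G {w}" and ?E = "perp G {e}"
  let ?N = "tpow_rel ?d ?W (vec.span {w})" and ?M = "tpow_rel ?d ?E (vec.span {e})"
  let ?p = "proj_along G e w" and ?r = "proj_along G e' e"
  have ww: "form G w w = 0" and we: "form G w e = 1" and ew: "form G e w = 1"
    using tube_map_isotropic[OF z] w form_sym[OF gram] by metis+
  obtain t0 where t0: "t0 \<in> tpow ?d ?W" "f w = tcoset ?N t0"
    using f by (rule E_fibre_coset)
  \<comment> \<open>the fibre value is the coset of any of its elements\<close>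
  have fw: "t + u \<in> f w \<longleftrightarrow> u \<in> ?N" for u
  proof -
    obtain u0 where u0: "u0 \<in> ?N" "t = t0 + u0" using t t0 by (auto simp: tcoset_def)
    have "t + u \<in> f w \<longleftrightarrow> u0 + u \<in> ?N"
      unfolding t0(2) tcoset_def u0(2) by (auto simp only: mem_Collect_eq add.assoc add_left_cancel)
    also have "\<dots> \<longleftrightarrow> u \<in> ?N"
      using tpow_rel_closed(2)[OF u0(1)] tpow_rel_closed(4)[of "u0 + u", OF _ u0(1)]
      by (metis add_diff_cancel_left')
    finally show ?thesis .
  qed
  have tW: "t \<in> tpow ?d ?W"
    using t t0 by (auto simp only: tcoset_def mem_Collect_eq intro: tpow_closed tpow_rel_subset_tpow)
  have pW: "?p *v v \<in> ?E \<inter> ?W" if "v \<in> ?W" for v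
    using that ww we by (simp add: proj_along_apply perp_def form_linear)
  have pfix: "tmap ?p s = s" if "s \<in> tpow ?d (?E \<inter> ?W)" for s
    using that by (rule tmap_fixes_tpow) (auto simp: proj_along_apply perp_def)
  have pN: "tmap ?p u = 0" if "u \<in> ?N" for u
    using that by (rule tmap_kills_tpow_rel) (auto simp: proj_along_apply vec.span_singleton form_linear we)
  have rE: "?r *v v \<in> VI G e e'" if "v \<in> ?E" for v
    using that by (simp add: proj_along_apply perp_def VI_def form_linear)
  have rfix: "tmap ?r s = s" if "s \<in> tpow ?d (VI G e e')" for s
    using that by (rule tmap_fixes_tpow) (auto simp: proj_along_apply VI_iff)
  have rM: "tmap ?r u = 0" if "u \<in> ?M" for u
    using that by (rule tmap_kills_tpow_rel) (auto simp: proj_along_apply vec.span_singleton form_linear)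
  define s where "s = tmap ?p t"
  have s: "s \<in> tpow ?d (?E \<inter> ?W)"
    unfolding s_def by (rule tmap_in_tpow[OF tW]) (rule pW)
  have "s - t \<in> ?N"
    unfolding s_def using tW
    by (rule tmap_minus_in_tpow_rel)
      (use pW in \<open>auto simp: proj_along_apply vec.span_singleton intro: perp_diff image_eqI[of _ _ "- _"]\<close>)
  then have sS: "s \<in> f w" using fw[of "s - t"] by (simp only: add_diff_cancel_left' add_diff_eq add_diff_cancel_left)
  have sE: "s \<in> tpow ?d ?E"
    using s by (induction rule: tpow_induct) (blast intro: tpow_pure tpow_closed)+
  have rsM: "tmap ?r s - s \<in> ?M"
    using sE
  proof (rule tmap_minus_in_tpow_rel)
    fix v assume "v \<in> ?E"
    then show "?r *v v \<in> ?E" using rE by (auto simp: VI_def perp_def)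
    show "?r *v v - v \<in> vec.span {e}"
      by (auto simp: proj_along_apply vec.span_singleton intro: image_eqI[of _ _ "- _"])
  qed (rule perp_diff)
  show ?thesis
    unfolding cusp_function_def w[symmetric]
  proof (rule the_equality)
    have "tmap (?r ** ?p) t = s + (tmap ?r s - s)"
      by (simp only: tmap_mult s_def add_diff_cancel_left' add_diff_eq add_diff_cancel_left)
    then have "tmap (?r ** ?p) t \<in> cusp_iso G ?d e w (f w)"
      unfolding cusp_iso_def using sS s rsM by blast
    moreover have "tmap (?r ** ?p) t \<in> tpow ?d (VI G e e')"
      unfolding tmap_mult s_def[symmetric] by (rule tmap_in_tpow[OF sE]) (rule rE)
    ultimately show "tmap (?r ** ?p) t \<in> tpow ?d (VI G e e') \<and>
      tmap (?r ** ?p) t \<in> cusp_iso G ?d e w (f w)" by blast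
  next
    fix x assume x: "x \<in> tpow ?d (VI G e e') \<and> x \<in> cusp_iso G ?d e w (f w)"
    then obtain s' u where *: "x = s' + u" "s' \<in> f w" "s' \<in> tpow ?d (?E \<inter> ?W)" "u \<in> ?M"
      unfolding cusp_iso_def by blast
    have "s' - t \<in> ?N"
      using fw[of "s' - t"] *(2) by (simp only: add_diff_cancel_left' add_diff_eq add_diff_cancel_left)
    then have "tmap ?p s' = tmap ?p t"
      using pN tmap_diff[of ?p s' t] by (metis eq_iff_diff_eq_0)
    have "x = tmap ?r s' + tmap ?r u"
      using rfix x *(1) tmap_add by metis
    also have "\<dots> = tmap ?r (tmap ?p t)"
      using rM[OF *(4)] pfix[OF *(3)] \<open>tmap ?p s' = tmap ?p t\<close> by (metis add.right_neutral)
    finally show "x = tmap (?r ** ?p) t" by (simp only: tmap_mult)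
  qed
qed

text \<open>An isometry that fixes \<open>e\<close> and \<open>e'\<close> commutes with every choice made in the trivialization.\<close>

lemma cusp_function_equivariant:
  assumes z: "z \<in> VI G e e'" "\<gamma> *v z \<in> VI G e e'"
    and \<gamma>: "\<And>u v. form G (\<gamma> *v u) (\<gamma> *v v) = form G u v" "\<gamma> *v e = e" "\<gamma> *v e' = e'"
    and f: "\<And>w. w \<in> {tube_map G e e' z, tube_map G e e' (\<gamma> *v z)} \<Longrightarrow> f w \<in> E_fibre G lam w"
    and inv: "f (\<gamma> *v tube_map G e e' z) = tmap \<gamma> ` f (tube_map G e e' z)"
  shows "cusp_function G lam e e' f (\<gamma> *v z) = tmap \<gamma> (cusp_function G lam e e' f z)"
proof -
  let ?w = "tube_map G e e' z"
  have w: "tube_map G e e' (\<gamma> *v z) = \<gamma> *v ?w"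
    by (simp add: tube_map_def \<gamma> algebra_simps vec.scale matrix_vector_mult_diff_distrib
       matrix_vector_right_distrib)
  have red: "proj_along G (\<gamma> *v u) (\<gamma> *v x) ** \<gamma> = \<gamma> ** proj_along G u x" for u x
    by (simp add: matrix_eq proj_along_apply \<gamma> matrix_vector_mul_assoc[symmetric] vec.scale
        matrix_vector_mult_diff_distrib)
  have "f ?w \<in> E_fibre G lam ?w" using f by blast
  then obtain t where "f ?w = tcoset (tpow_rel (sum_list lam) (perp G {?w}) (vec.span {?w})) t"
    by (rule E_fibre_coset)
  then have "t + 0 \<in> f ?w" using tpow_rel_closed(1) unfolding tcoset_def by blast
  then obtain t where t: "t \<in> f ?w" by blast
  have "cusp_function G lam e e' f (\<gamma> *v z) =
      tmap (proj_along G e' e ** proj_along G e (\<gamma> *v ?w)) (tmap \<gamma> t)"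
    by (rule cusp_function_eq[OF z(2) refl, unfolded w])
       (use f[of "\<gamma> *v ?w"] t inv w in auto)
  also have "\<dots> = tmap (proj_along G e' e ** proj_along G e (\<gamma> *v ?w) ** \<gamma>) t"
    by (simp only: tmap_mult)
  also have "proj_along G e' e ** proj_along G e (\<gamma> *v ?w) ** \<gamma> = \<gamma> ** (proj_along G e' e ** proj_along G e ?w)"
    using red[of e ?w] red[of e' e] by (metis \<gamma>(2,3) matrix_mul_assoc)
  also have "tmap (\<gamma> ** (proj_along G e' e ** proj_along G e ?w)) t = tmap \<gamma> (cusp_function G lam e e' f z)"
    using cusp_function_eq[of z ?w f lam t] z t f by (simp add: tmap_mult)
  finally show ?thesis .
qed

end

section \<open>Means of Fourier series\<close>

text \<open>The Cesaro means of the powers of a number \<open>w\<close> of modulus 1 are bounded by 1 and tend to 0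
  unless \<open>w = 1\<close>, so dominated convergence applies to the absolutely convergent series.\<close>

lemma cesaro_mean_of_unit_powers:
  fixes c w :: "'a \<Rightarrow> complex"
  assumes S: "\<And>j. ((\<lambda>l. c l * w l ^ j) has_sum S j) A"
    and w: "\<And>l. l \<in> A \<Longrightarrow> norm (w l) = 1" and l0: "l0 \<in> A" "w l0 = 1"
    and w1: "\<And>l. l \<in> A \<Longrightarrow> l \<noteq> l0 \<Longrightarrow> w l \<noteq> 1"
  shows "(\<lambda>N. (\<Sum>j<Suc N. S j) / of_nat (Suc N)) \<longlonglongrightarrow> c l0"
proof -
  define m where "m N l = (\<Sum>j<Suc N. w l ^ j) / of_nat (Suc N)" for N l
  let ?M = "count_space A"
  have int: "integrable ?M (\<lambda>l. c l * w l ^ j)" and val: "(\<integral>l. c l * w l ^ j \<partial>?M) = S j" for j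
  proof -
    have s: "Infinite_Set_Sum.abs_summable_on (\<lambda>l. c l * w l ^ j) A"
      using has_sum_imp_summable[OF S[of j]]
      by (simp only: summable_on_iff_abs_summable_on_complex abs_summable_equivalent)
    then show "integrable ?M (\<lambda>l. c l * w l ^ j)"
      by (simp add: Infinite_Set_Sum.abs_summable_on_def)
    show "(\<integral>l. c l * w l ^ j \<partial>?M) = S j"
      using infsetsum_infsum[OF s] infsumI[OF S[of j]] by (simp add: infsetsum_def)
  qed
  have norm_m: "norm (m N l) \<le> 1" if "l \<in> A" for N l
  proof -
    have "norm (\<Sum>j<Suc N. w l ^ j) \<le> (\<Sum>j<Suc N. norm (w l ^ j))" by (rule norm_sum)
    also have "\<dots> = of_nat (Suc N)" using w[OF that] by (simp add: norm_power)
    finally show ?thesis by (simp add: m_def norm_divide divide_simps del: of_nat_Suc sum.lessThan_Suc)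
  qed
  have lim_m: "(\<lambda>N. m N l) \<longlonglongrightarrow> (if l = l0 then 1 else 0)" if l: "l \<in> A" for l
  proof (cases "l = l0")
    case True
    then have "m N l = 1" for N by (simp add: m_def l0 del: of_nat_Suc sum.lessThan_Suc)
    then show ?thesis using True by simp
  next
    case False
    have bound: "norm (m N l) \<le> 2 / norm (w l - 1) * inverse (real (Suc N))" for N
    proof -
      have "norm (w l ^ Suc N - 1) \<le> 2"
        using norm_triangle_ineq4[of "w l ^ Suc N" 1] w[OF l] by (simp add: norm_power norm_mult)
      then have "norm (m N l) \<le> 2 / (norm (w l - 1) * real (Suc N))"
        unfolding m_def geometric_sum[OF w1[OF l False]] norm_divide norm_mult norm_of_nat
          divide_divide_eq_left
        by (intro divide_right_mono) auto
      then show ?thesis by (simp only: divide_inverse inverse_mult_distrib mult.assoc)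
    qed
    have "(\<lambda>N. 2 / norm (w l - 1) * inverse (real (Suc N))) \<longlonglongrightarrow> 0"
      by (rule tendsto_mult_right_zero[OF LIMSEQ_inverse_real_of_nat])
    then have "(\<lambda>N. m N l) \<longlonglongrightarrow> 0"
      by (rule Lim_null_comparison[rotated]) (rule always_eventually, rule allI, rule bound)
    then show ?thesis using False by simp
  qed
  have "(\<lambda>N. \<integral>l. c l * m N l \<partial>?M) \<longlonglongrightarrow> (\<integral>l. c l * (if l = l0 then 1 else 0) \<partial>?M)"
  proof (rule integral_dominated_convergence[where w = "\<lambda>l. norm (c l)"])
    show "integrable ?M (\<lambda>l. norm (c l))" using int[of 0] by simp
    show "AE l in ?M. (\<lambda>N. c l * m N l) \<longlonglongrightarrow> c l * (if l = l0 then 1 else 0)"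
      unfolding AE_count_space by (intro ballI tendsto_mult tendsto_const lim_m)
    show "AE l in ?M. norm (c l * m N l) \<le> norm (c l)" for N
      using norm_m by (auto simp: AE_count_space norm_mult mult_left_le)
  qed simp_all
  also have "(\<lambda>N. \<integral>l. c l * m N l \<partial>?M) = (\<lambda>N. (\<Sum>j<Suc N. S j) / of_nat (Suc N))"
  proof
    fix N
    have "(\<integral>l. c l * m N l \<partial>?M) = (\<integral>l. (\<Sum>j<Suc N. c l * w l ^ j) / of_nat (Suc N) \<partial>?M)"
      by (simp add: m_def sum_distrib_left del: of_nat_Suc sum.lessThan_Suc)
    also have "\<dots> = (\<Sum>j<Suc N. S j) / of_nat (Suc N)"
      using int by (simp add: val Bochner_Integration.integral_sum del: of_nat_Suc sum.lessThan_Suc)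
    finally show "(\<integral>l. c l * m N l \<partial>?M) = (\<Sum>j<Suc N. S j) / of_nat (Suc N)" .
  qed
  also have "(\<integral>l. c l * (if l = l0 then 1 else 0) \<partial>?M) = c l0"
  proof -
    let ?f = "\<lambda>l. c l * (if l = l0 then 1 else 0)"
    have fin: "finite {l \<in> A. ?f l \<noteq> 0}" by (rule finite_subset[of _ "{l0}"]) auto
    have "(\<integral>l. ?f l \<partial>?M) = (\<Sum>l | l \<in> A \<and> ?f l \<noteq> 0. ?f l)"
      by (rule lebesgue_integral_count_space_finite_support[OF fin])
    also have "\<dots> = (\<Sum>l\<in>{l0}. ?f l)"
      using l0 by (intro sum.mono_neutral_left) auto
    finally show ?thesis by simp
  qed
  finally show ?thesis .
qed

text \<open>The coordinates are distinct positive powers of one number \<open>\<theta>\<close>; an integral value of a rational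
  combination makes \<open>\<theta>\<close> a root of one of countably many nonzero polynomials.\<close>

lemma exists_generic_vector:
  obtains \<xi> :: "'m::finite \<Rightarrow> real" where
    "\<And>r :: 'm \<Rightarrow> rat. r \<noteq> (\<lambda>_. 0) \<Longrightarrow> (\<Sum>i\<in>UNIV. of_rat (r i) * \<xi> i) \<notin> \<int>"
proof -
  obtain h :: "'m \<Rightarrow> nat" where h: "inj h"
    using finite_imp_inj_to_nat_seg[of "UNIV :: 'm set"] by auto
  define p :: "('m \<Rightarrow> rat) \<Rightarrow> int \<Rightarrow> real poly" where
    "p r z = (\<Sum>i\<in>UNIV. monom (of_rat (r i)) (Suc (h i))) - [:of_int z:]" for r z
  have p0: "p r z \<noteq> 0" if r: "r \<noteq> (\<lambda>_. 0)" for r z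
  proof -
    obtain i where i: "r i \<noteq> 0" using r by auto
    have "coeff (p r z) (Suc (h i)) = (\<Sum>j\<in>UNIV. if j = i then of_rat (r j) else 0)"
      using h by (auto simp: p_def coeff_sum inj_eq intro!: sum.cong)
    then have "coeff (p r z) (Suc (h i)) = of_rat (r i)" by simp
    then show ?thesis using i by auto
  qed
  define B where "B = (\<Union>rz\<in>{r. r \<noteq> (\<lambda>_. 0)} \<times> UNIV. {x. poly (p (fst rz) (snd rz)) x = 0})"
  have "countable B"
    unfolding B_def using p0 by (intro countable_UN) (auto intro!: countable_finite poly_roots_finite)
  then obtain \<theta> where \<theta>: "\<theta> \<notin> B"
    using uncountable_UNIV_real by (metis UNIV_eq_I)
  show thesis
  proof (rule that[of "\<lambda>i. \<theta> ^ Suc (h i)"])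
    fix r :: "'m \<Rightarrow> rat" assume r: "r \<noteq> (\<lambda>_. 0)"
    show "(\<Sum>i\<in>UNIV. of_rat (r i) * \<theta> ^ Suc (h i)) \<notin> \<int>"
    proof
      assume "(\<Sum>i\<in>UNIV. of_rat (r i) * \<theta> ^ Suc (h i)) \<in> \<int>"
      then obtain z where "(\<Sum>i\<in>UNIV. of_rat (r i) * \<theta> ^ Suc (h i)) = of_int z"
        by (auto elim: Ints_cases)
      then have "poly (p r z) \<theta> = 0" by (simp add: p_def poly_sum poly_monom)
      then show False using \<theta> r by (force simp: B_def)
    qed
  qed
qed

section \<open>Vectors with integral, rational and real coordinates\<close>

lemma of_real_of_rat_complex: "complex_of_real (of_rat q) = of_rat q"
proof -
  obtain a b where "quotient_of q = (a, b)" by fastforce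
  then have "q = of_int a / of_int b" by (rule quotient_of_div)
  then show ?thesis by (simp add: of_rat_divide)
qed

lemma Rats_subset_Reals_complex: "(\<rat> :: complex set) \<subseteq> \<real>"
proof
  fix x :: complex assume "x \<in> \<rat>"
  then obtain q where "x = of_rat q" by (auto elim: Rats_cases)
  then show "x \<in> \<real>" by (metis of_real_of_rat_complex Reals_of_real)
qed

lemma coords_Rats_real: "v \<in> coords \<rat> \<Longrightarrow> v \<in> coords \<real>"
  using Rats_subset_Reals_complex by (auto simp: coords_def)

lemma coords_closed:
  assumes "F \<in> {\<int>, \<rat>, \<real>}"
  shows "u \<in> coords F \<Longrightarrow> v \<in> coords F \<Longrightarrow> u + v \<in> coords F"
    "u \<in> coords F \<Longrightarrow> v \<in> coords F \<Longrightarrow> u - v \<in> coords F"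
    "c \<in> F \<Longrightarrow> v \<in> coords F \<Longrightarrow> c *s v \<in> coords F"
    "u \<in> coords F \<Longrightarrow> v \<in> coords F \<Longrightarrow> form G u v \<in> F"
    "axis i 1 \<in> coords F" "0 \<in> coords F"
proof -
  have F: "a + b \<in> F" "a - b \<in> F" "a * b \<in> F" if "a \<in> F" "b \<in> F" for a b
    using assms that by auto
  have int: "of_int k \<in> F" for k using assms by auto
  have 01: "0 \<in> F" "1 \<in> F" using assms by auto
  have sum: "sum f A \<in> F" if "\<And>x. x \<in> A \<Longrightarrow> f x \<in> F" for f :: "'ix \<Rightarrow> complex" and A
    using that by (induction A rule: infinite_finite_induct) (auto intro: F 01)
  show "u \<in> coords F \<Longrightarrow> v \<in> coords F \<Longrightarrow> u + v \<in> coords F"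
    "u \<in> coords F \<Longrightarrow> v \<in> coords F \<Longrightarrow> u - v \<in> coords F"
    "c \<in> F \<Longrightarrow> v \<in> coords F \<Longrightarrow> c *s v \<in> coords F"
    "axis i 1 \<in> coords F" "0 \<in> coords F"
    using F 01 by (auto simp: coords_def axis_def)
  show "u \<in> coords F \<Longrightarrow> v \<in> coords F \<Longrightarrow> form G u v \<in> F"
    unfolding form_def coords_def by (intro sum F int) auto
qed

lemmas rat_coords = coords_closed[of "\<rat>", simplified]
lemmas real_coords = coords_closed[of "\<real>", simplified]
lemmas int_coords = coords_closed[of "\<int>", simplified]

lemma rational_multiple_in_lattice:
  assumes "v \<in> coords \<rat>"
  obtains N :: nat where "N > 0" "of_nat N *s v \<in> lat"
proof -
  have "\<exists>n::nat. n > 0 \<and> of_nat n * v $ i \<in> \<int>" for i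
  proof -
    have "v $ i \<in> \<rat>" using assms by (simp add: coords_def)
    then obtain q where "v $ i = of_rat q" by (auto elim: Rats_cases)
    moreover obtain a b where ab: "quotient_of q = (a, b)" by fastforce
    ultimately have "v $ i = of_int a / of_int b" "b > 0"
      using quotient_of_div[OF ab] quotient_of_denom_pos[OF ab] by (simp_all add: of_rat_divide)
    then have "of_nat (nat b) * v $ i = of_int a" "nat b > 0" by auto
    then show ?thesis by (metis Ints_of_int)
  qed
  then obtain n where n: "\<And>i. n i > 0" "\<And>i. of_nat (n i) * v $ i \<in> \<int>" by metis
  define N where "N = (\<Prod>i\<in>UNIV. n i)"
  have "of_nat N * v $ i \<in> \<int>" for i
  proof -
    have "N = n i * (\<Prod>j\<in>UNIV - {i}. n j)" unfolding N_def by (rule prod.remove) auto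
    then have "of_nat N * v $ i = of_nat (\<Prod>j\<in>UNIV - {i}. n j) * (of_nat (n i) * v $ i)"
      by (simp add: mult_ac)
    then show ?thesis using n(2)[of i] by (metis Ints_mult Ints_of_nat)
  qed
  moreover have "N > 0" using n(1) by (simp add: N_def prod_pos)
  ultimately show thesis using that by (auto simp: coords_def)
qed

section \<open>The constant term is invariant under the discrete stabilizer\<close>

locale rational_hyperbolic_pair = hyperbolic_pair +
  assumes e_rat: "e \<in> coords \<rat>" and e'_rat: "e' \<in> coords \<rat>"
begin

text \<open>The orthogonal projection onto \<open>V = (I \<oplus> I')\<^sup>\<bottom>\<close>.\<close>

definition proj :: "complex ^ 'a \<Rightarrow> complex ^ 'a" where
  "proj v = v - form G v e *s e' - form G v e' *s e"

lemma proj_in_VI: "proj v \<in> VI G e e'"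
  by (simp add: VI_iff proj_def form_linear)

lemma proj_VI: "v \<in> VI G e e' \<Longrightarrow> proj v = v"
  by (simp add: VI_iff proj_def)

lemma form_proj: "form G (proj u) v = form G u (proj v)"
  using form_sym[OF gram, of e v] form_sym[OF gram, of e' v] by (simp add: proj_def form_linear)

lemma proj_coords: "v \<in> coords \<rat> \<Longrightarrow> proj v \<in> coords \<rat>" "v \<in> coords \<real> \<Longrightarrow> proj v \<in> coords \<real>"
  unfolding proj_def using e_rat e'_rat coords_Rats_real by (auto intro!: rat_coords real_coords)

lemma VI_closed:
  "u \<in> VI G e e' \<Longrightarrow> v \<in> VI G e e' \<Longrightarrow> u + v \<in> VI G e e'"
  "u \<in> VI G e e' \<Longrightarrow> v \<in> VI G e e' \<Longrightarrow> u - v \<in> VI G e e'"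
  "v \<in> VI G e e' \<Longrightarrow> c *s v \<in> VI G e e'"
  unfolding VI_def by (auto intro: perp_add perp_diff perp_scale)

lemma exists_generic_translation:
  obtains x where "x \<in> VI G e e'" "x \<in> coords \<real>"
    "\<And>l. l \<in> VI G e e' \<Longrightarrow> l \<in> coords \<rat> \<Longrightarrow> l \<noteq> 0 \<Longrightarrow> form G l x \<notin> \<int>"
proof -
  obtain \<xi> :: "'a \<Rightarrow> real" where \<xi>:
    "\<And>r :: 'a \<Rightarrow> rat. r \<noteq> (\<lambda>_. 0) \<Longrightarrow> (\<Sum>i\<in>UNIV. of_rat (r i) * \<xi> i) \<notin> \<int>"
    using exists_generic_vector by blast
  define y :: "complex ^ 'a" where "y = (\<chi> i. of_real (\<xi> i))"
  show thesis
  proof (rule that[of "proj y"])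
    show "proj y \<in> coords \<real>" by (rule proj_coords) (simp add: y_def coords_def)
    fix l assume l: "l \<in> VI G e e'" "l \<in> coords \<rat>" "l \<noteq> 0"
    have "\<exists>q. form G l (axis i 1) = of_rat q" for i
      using rat_coords(4)[OF l(2) rat_coords(5)[of i]] by (auto elim: Rats_cases)
    then obtain r where r: "\<And>i. form G l (axis i 1) = of_rat (r i)" by metis
    have "r \<noteq> (\<lambda>_. 0)"
    proof
      assume "r = (\<lambda>_. 0)"
      then have "form G l w = 0" for w
        by (subst form_expand_right) (simp add: r)
      then show False using form_nondegenerate[OF gram] l(3) by blast
    qed
    moreover have "form G l (proj y) = of_real (\<Sum>i\<in>UNIV. of_rat (r i) * \<xi> i)"
    proof -
      have "form G l (proj y) = form G l y" using proj_VI[OF l(1)] by (simp flip: form_proj)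
      also have "\<dots> = (\<Sum>i\<in>UNIV. of_real (\<xi> i) * of_rat (r i))"
        by (subst form_expand_right) (simp add: r y_def)
      finally show ?thesis by (simp add: mult.commute of_real_of_rat_complex)
    qed
    ultimately show "form G l (proj y) \<notin> \<int>"
      using \<xi>[of r] by (simp only: of_real_in_Ints_iff not_False_eq_True)
  qed (rule proj_in_VI)
qed

lemma constant_term_mean:
  assumes a: "\<And>j. ((\<lambda>l. c l * exp (2 * of_real pi * \<i> * form G l (z + of_nat j *s x))) has_sum S j) A"
    and A: "0 \<in> A" "\<And>l. l \<in> A \<Longrightarrow> form G l x \<in> \<real>"
      "\<And>l. l \<in> A \<Longrightarrow> l \<noteq> 0 \<Longrightarrow> form G l x \<notin> \<int>"
  shows "(\<lambda>N. (\<Sum>j<Suc N. S j) / of_nat (Suc N)) \<longlonglongrightarrow> c 0"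
proof -
  let ?c = "\<lambda>l. c l * exp (2 * of_real pi * \<i> * form G l z)"
  let ?w = "\<lambda>l. exp (2 * of_real pi * \<i> * form G l x)"
  have "(\<lambda>N. (\<Sum>j<Suc N. S j) / of_nat (Suc N)) \<longlonglongrightarrow> ?c 0"
  proof (rule cesaro_mean_of_unit_powers[where c = ?c and w = ?w and A = A])
    fix j
    have "exp (2 * of_real pi * \<i> * form G l (z + of_nat j *s x)) =
        exp (2 * of_real pi * \<i> * form G l z) * ?w l ^ j" for l
      by (simp add: form_linear distrib_left exp_add mult_ac flip: exp_of_nat_mult)
    then show "((\<lambda>l. ?c l * ?w l ^ j) has_sum S j) A" using a[of j] by (simp add: mult.assoc)
  next
    fix l assume l: "l \<in> A"
    obtain b where b: "form G l x = of_real b" using A(2)[OF l] by (auto elim: Reals_cases)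
    show "norm (?w l) = 1" by (simp add: b)
    show "?w l \<noteq> 1" if "l \<noteq> 0"
    proof
      assume "?w l = 1"
      then obtain k :: int where "2 * pi * b = of_int (2 * k) * pi" by (auto simp: exp_eq_1 b)
      then have "b = of_int k" by auto
      then show False using A(3)[OF l that] b by auto
    qed
  qed (use A in auto)
  then show ?thesis by simp
qed

lemma tube_map_in_cone:
  assumes "tube_component G D e e' C" "z \<in> tube_domain G e e' C"
  shows "tube_map G e e' z \<in> D"
proof -
  have "tube_map G e e' z = 1 *s tube_map G e e' z" by simp
  moreover have D: "D = {c *s tube_map G e e' z |c z. c \<noteq> 0 \<and> z \<in> tube_domain G e e' C}"
    using assms by (simp add: tube_component_def)
  ultimately show ?thesis using assms(2) one_neq_zero unfolding D mem_Collect_eq by blast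
qed

text \<open>The tube map is injective even up to scalars: the pairing with \<open>e\<close> determines the scalar, and
  the projection to \<open>V\<close> recovers the point.\<close>

lemma tube_domain_of_cone:
  assumes "tube_component G D e e' C" "z \<in> VI G e e'" "tube_map G e e' z \<in> D"
  shows "z \<in> tube_domain G e e' C"
proof -
  obtain c z' where *: "tube_map G e e' z = c *s tube_map G e e' z'" "z' \<in> tube_domain G e e' C"
    using assms unfolding tube_component_def by blast
  then have z': "z' \<in> VI G e e'" by (simp add: tube_domain_def)
  have "1 = form G (c *s tube_map G e e' z') e"
    using tube_map_isotropic(2)[OF assms(2)] * by simp
  then have "c = 1" using tube_map_isotropic(2)[OF z'] by (simp add: form_linear)
  then have "tube_map G e e' z = tube_map G e e' z'" using * by simp
  then have "proj (tube_map G e e' z) = proj (tube_map G e e' z')" by simp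
  moreover have "proj (tube_map G e e' y) = y" if "y \<in> VI G e e'" for y
    using that VI_iff[of y] by (simp add: proj_def tube_map_def form_linear)
  ultimately show ?thesis using assms(2) z' * by metis
qed

lemma tube_domain_translate:
  assumes "z \<in> tube_domain G e e' C" "x \<in> VI G e e'" "x \<in> coords \<real>"
  shows "z + of_nat j *s x \<in> tube_domain G e e' C"
proof -
  have "Im (x $ i) = 0" for i
    using assms(3) by (simp add: coords_def complex_is_Real_iff)
  then have "Im_vec (z + of_nat j *s x) = Im_vec z"
    by (simp add: Im_vec_def vec_eq_iff)
  then show ?thesis using assms by (simp add: tube_domain_def VI_closed)
qed

lemma tube_domain_nonempty:
  assumes "tube_component G D e e' C"
  obtains y where "y \<in> VI G e e'" "y \<in> coords \<real>" "Re (form G y y) > 0"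
    "\<i> *s y \<in> tube_domain G e e' C"
proof -
  have C: "C \<in> components {v \<in> VI G e e' \<inter> coords \<real>. Re (form G v v) > 0}"
    using assms by (simp add: tube_component_def)
  then obtain y where y: "y \<in> C" using in_components_nonempty by fastforce
  then have *: "y \<in> VI G e e'" "y \<in> coords \<real>" "Re (form G y y) > 0"
    using in_components_subset[OF C] by auto
  then have "Re (y $ i) = y $ i" for i
    by (simp add: coords_def)
  then have "Im_vec (\<i> *s y) = y" by (simp add: Im_vec_def vec_eq_iff)
  then show thesis using that[OF *] * y by (simp add: tube_domain_def VI_closed)
qed

text \<open>Both sides of \<open>f(\<gamma>Z) = \<gamma> f(Z)\<close> are averaged over the translates \<open>Z + jx\<close>. On the left-hand
  side the argument moves by multiples of \<open>\<gamma>x\<close>, and \<open>\<gamma>x\<close> is as generic as \<open>x\<close>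
  since \<open>(l, \<gamma>x) = (\<gamma>\<^sup>-\<^sup>1 l, x)\<close>.\<close>

theorem constant_term_invariant:
  assumes tube: "tube_component G D e e' C"
    and f: "modular_form G D \<Gamma> lam k f" and four: "fourier_expansion G \<Gamma> lam e e' C f a"
    and \<gamma>: "\<gamma> \<in> \<Gamma>" "\<gamma> \<in> orth G \<int>" "(\<lambda>v. \<gamma> *v v) ` D = D" "\<gamma> *v e = e" "\<gamma> *v e' = e'"
  shows "tmap \<gamma> (a 0) = a 0"
proof
  fix xs :: "'a list"
  let ?F = "cusp_function G lam e e' f" and ?U = "U_dual G \<Gamma> e e'"
  have iso: "form G (\<gamma> *v u) (\<gamma> *v v) = form G u v" for u v
    using \<gamma>(2) by (simp add: orth_def)
  have \<gamma>VI: "\<gamma> *v u \<in> VI G e e' \<longleftrightarrow> u \<in> VI G e e'" for u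
    using iso[of u e] iso[of u e'] \<gamma> by (simp add: VI_iff)
  obtain y where "\<i> *s y \<in> tube_domain G e e' C"
    using tube_domain_nonempty[OF tube] by blast
  then obtain z where z: "z \<in> tube_domain G e e' C" by blast
  obtain x where x: "x \<in> VI G e e'" "x \<in> coords \<real>"
    "\<And>l. l \<in> VI G e e' \<Longrightarrow> l \<in> coords \<rat> \<Longrightarrow> l \<noteq> 0 \<Longrightarrow> form G l x \<notin> \<int>"
    using exists_generic_translation by blast
  define Z where "Z j = z + of_nat j *s x" for j :: nat
  have Z: "Z j \<in> tube_domain G e e' C" for j
    unfolding Z_def by (rule tube_domain_translate[OF z x(1,2)])
  have ZVI: "Z j \<in> VI G e e'" for j using Z by (simp add: tube_domain_def)
  have tube\<gamma>: "tube_map G e e' (\<gamma> *v u) = \<gamma> *v tube_map G e e' u" for u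
    by (simp add: tube_map_def \<gamma> iso vec.scale matrix_vector_mult_diff_distrib
       matrix_vector_right_distrib)
  have D: "tube_map G e e' (Z j) \<in> D" "tube_map G e e' (\<gamma> *v Z j) \<in> D" for j
    using tube_map_in_cone[OF tube Z] \<gamma>(3) unfolding tube\<gamma> by blast+
  then have \<gamma>Z: "\<gamma> *v Z j \<in> tube_domain G e e' C" for j
    using tube_domain_of_cone[OF tube] \<gamma>VI ZVI by blast
  have equiv: "?F (\<gamma> *v Z j) = tmap \<gamma> (?F (Z j))" for j
  proof (rule cusp_function_equivariant[OF ZVI _ iso \<gamma>(4,5)])
    show "\<gamma> *v Z j \<in> VI G e e'" using \<gamma>VI ZVI by blast
    show "f w \<in> E_fibre G lam w"
      if "w \<in> {tube_map G e e' (Z j), tube_map G e e' (\<gamma> *v Z j)}" for w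
      using that D[of j] f unfolding modular_form_def by blast
    show "f (\<gamma> *v tube_map G e e' (Z j)) = tmap \<gamma> ` f (tube_map G e e' (Z j))"
      using D(1)[of j] f \<gamma>(1) unfolding modular_form_def by blast
  qed
  have U: "l \<in> VI G e e'" "l \<in> coords \<rat>" if "l \<in> ?U" for l
    using that by (auto simp: U_dual_def)
  have U0: "0 \<in> ?U" by (auto simp: U_dual_def VI_iff coords_def)
  have real: "form G l x \<in> \<real>" if "l \<in> coords \<rat>" for l
    using that x(2) coords_Rats_real by (blast intro: real_coords)
  have sums: "((\<lambda>l. a l ys * exp (2 * of_real pi * \<i> * form G l z)) has_sum ?F z ys) ?U"
    if "z \<in> tube_domain G e e' C" for z ys
    using four that by (simp add: fourier_expansion_def)
  have mean: "(\<lambda>N. (\<Sum>j<Suc N. ?F (Z j) ys) / of_nat (Suc N)) \<longlonglongrightarrow> a 0 ys" for ys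
    using sums[OF Z] U0 real x(3) U unfolding Z_def
    by (intro constant_term_mean[where x = x and z = z and A = ?U]) blast+
  have "(\<lambda>N. \<Sum>js | length js = length xs. (\<Prod>k<length xs. \<gamma> $ (xs ! k) $ (js ! k)) *
          ((\<Sum>j<Suc N. ?F (Z j) js) / of_nat (Suc N))) \<longlonglongrightarrow> tmap \<gamma> (a 0) xs"
    unfolding tmap_def by (intro tendsto_sum tendsto_mult tendsto_const mean)
  also have "(\<lambda>N. \<Sum>js | length js = length xs. (\<Prod>k<length xs. \<gamma> $ (xs ! k) $ (js ! k)) *
          ((\<Sum>j<Suc N. ?F (Z j) js) / of_nat (Suc N))) =
      (\<lambda>N. (\<Sum>j<Suc N. ?F (\<gamma> *v Z j) xs) / of_nat (Suc N))"
  proof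
    fix N
    have "(\<Sum>j<Suc N. ?F (\<gamma> *v Z j) xs) = (\<Sum>j<Suc N. \<Sum>js | length js = length xs.
        (\<Prod>k<length xs. \<gamma> $ (xs ! k) $ (js ! k)) * ?F (Z j) js)"
      unfolding equiv tmap_def ..
    also have "\<dots> = (\<Sum>js | length js = length xs.
        (\<Prod>k<length xs. \<gamma> $ (xs ! k) $ (js ! k)) * (\<Sum>j<Suc N. ?F (Z j) js))"
      by (subst sum.swap) (simp only: sum_distrib_left)
    finally show "(\<Sum>js | length js = length xs. (\<Prod>k<length xs. \<gamma> $ (xs ! k) $ (js ! k)) *
          ((\<Sum>j<Suc N. ?F (Z j) js) / of_nat (Suc N))) =
        (\<Sum>j<Suc N. ?F (\<gamma> *v Z j) xs) / of_nat (Suc N)"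
      by (simp only: sum_divide_distrib[where A = "{js. length js = length xs}"]
          times_divide_eq_right)
  qed
  finally have lim: "(\<lambda>N. (\<Sum>j<Suc N. ?F (\<gamma> *v Z j) xs) / of_nat (Suc N)) \<longlonglongrightarrow> tmap \<gamma> (a 0) xs" .
  \<comment> \<open>\<open>\<gamma>\<close> permutes the lattice, and every rational vector is a multiple of a lattice vector\<close>
  have pre: "\<exists>l'. l' \<in> VI G e e' \<and> l' \<in> coords \<rat> \<and> \<gamma> *v l' = l" if l: "l \<in> ?U" for l
  proof -
    obtain N :: nat where N: "N > 0" "of_nat N *s l \<in> lat"
      using rational_multiple_in_lattice[OF U(2)[OF l]] by blast
    then have "of_nat N *s l \<in> (\<lambda>v. \<gamma> *v v) ` lat" using \<gamma>(2) by (simp add: orth_def)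
    then obtain v where v: "v \<in> lat" "of_nat N *s l = \<gamma> *v v" by blast
    have "\<gamma> *v (inverse (of_nat N) *s v) = l"
      using N(1) by (simp add: vec.scale flip: v(2))
    moreover have "inverse (of_nat N) *s v \<in> coords \<rat>"
      using v(1) Ints_subset_Rats by (auto simp: coords_def intro!: Rats_mult)
    ultimately show ?thesis using U(1)[OF l] \<gamma>VI by metis
  qed
  have gen: "form G l (\<gamma> *v x) \<in> \<real> \<and> (l \<noteq> 0 \<longrightarrow> form G l (\<gamma> *v x) \<notin> \<int>)" if l: "l \<in> ?U" for l
  proof -
    obtain l' where l': "l' \<in> VI G e e'" "l' \<in> coords \<rat>" "\<gamma> *v l' = l" using pre[OF l] by blast
    then have "form G l (\<gamma> *v x) = form G l' x" using iso by metis
    moreover have "l' \<noteq> 0" if "l \<noteq> 0" using that l'(3) by auto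
    ultimately show ?thesis using real x(3) l' by metis
  qed
  have "\<gamma> *v Z j = \<gamma> *v z + of_nat j *s (\<gamma> *v x)" for j
    by (simp add: Z_def matrix_vector_right_distrib vec.scale)
  then have "(\<lambda>N. (\<Sum>j<Suc N. ?F (\<gamma> *v Z j) xs) / of_nat (Suc N)) \<longlonglongrightarrow> a 0 xs"
    using sums[OF \<gamma>Z] U0 gen
    by (intro constant_term_mean[where x = "\<gamma> *v x" and z = "\<gamma> *v z" and A = ?U]) auto
  with lim show "tmap \<gamma> (a 0) xs = a 0 xs" by (rule LIMSEQ_unique)
qed

end

section \<open>Pell's equation\<close>

lemma nonsquare_norm_nonzero:
  fixes D :: int
  assumes D: "\<And>s::int. s\<^sup>2 \<noteq> D" and k: "k \<noteq> 0"
  shows "h\<^sup>2 - D * k\<^sup>2 \<noteq> 0"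
proof
  assume "h\<^sup>2 - D * k\<^sup>2 = 0"
  then have eq: "h\<^sup>2 = k\<^sup>2 * D" by simp
  then have "k dvd h" by (metis dvd_triv_left pow_divides_pow_iff pos2)
  then obtain s where "h = k * s" by (elim dvdE)
  then have "D = s\<^sup>2" using eq k by (simp add: power_mult_distrib)
  then show False using D[of s] by simp
qed

text \<open>Dirichlet's theorem gives \<open>\<bar>k \<surd>D - h\<bar> < 1/N\<close> with \<open>k \<le> N\<close>, and then
  \<open>\<bar>h\<^sup>2 - D k\<^sup>2\<bar> = \<bar>k \<surd>D - h\<bar> \<bar>k \<surd>D + h\<bar>\<close> is bounded. If only finitely many pairs occurred, their
  smallest gap would contradict a large choice of \<open>N\<close>.\<close>

lemma sqrt_approximations_infinite:
  fixes D :: int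
  assumes D: "D > 0" "\<And>s::int. s\<^sup>2 \<noteq> D"
  shows "infinite {(h, k). k > 0 \<and> \<bar>h\<^sup>2 - D * k\<^sup>2\<bar> \<le> \<lceil>2 * sqrt D + 1\<rceil>}" (is "infinite ?S")
proof
  assume fin: "finite ?S"
  have nonzero: "of_int k * sqrt D - of_int h \<noteq> 0" if "k > 0" for h k :: int
  proof
    assume "of_int k * sqrt D - of_int h = 0"
    then have "(of_int k * sqrt D)\<^sup>2 = (of_int h)\<^sup>2" by simp
    then have "real_of_int (k\<^sup>2 * D) = real_of_int (h\<^sup>2)" using D by (simp add: power_mult_distrib)
    then have "h\<^sup>2 - D * k\<^sup>2 = 0" by (simp only: of_int_eq_iff mult.commute diff_self)
    then show False using nonsquare_norm_nonzero[OF D(2)] that by simp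
  qed
  let ?gap = "\<lambda>(h, k). \<bar>of_int k * sqrt D - of_int h\<bar>"
  define \<delta> where "\<delta> = Min (insert 1 (?gap ` ?S))"
  have "\<delta> > 0" unfolding \<delta>_def using fin nonzero by (subst Min_gr_iff) auto
  then obtain N :: nat where N: "N > 0" "1 / real N < \<delta>"
    by (metis divide_inverse mult_1 reals_Archimedean gr0I of_nat_0_less_iff zero_less_Suc)
  obtain h k where hk: "0 < k" "k \<le> int N" "\<bar>of_int k * sqrt D - of_int h\<bar> < 1 / N"
    using Dirichlet_approx[OF N(1)] by blast
  have "\<bar>of_int h + of_int k * sqrt D\<bar> \<le> 1 + 2 * (of_int k * sqrt D)"
  proof -
    have "1 / real N \<le> 1" using N by simp
    moreover have "of_int k * sqrt D \<ge> 0" using hk D by simp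
    ultimately show ?thesis using hk(3) by linarith
  qed
  also have "\<dots> \<le> real N * (2 * sqrt D + 1)"
  proof -
    have "of_int k * sqrt D \<le> real N * sqrt D" using hk D by (intro mult_right_mono) auto
    moreover have "1 \<le> real N" using N by simp
    ultimately show ?thesis by (simp add: algebra_simps)
  qed
  finally have "\<bar>of_int k * sqrt D - of_int h\<bar> * \<bar>of_int h + of_int k * sqrt D\<bar>
      \<le> 1 / N * (real N * (2 * sqrt D + 1))"
    using hk(3) by (intro mult_mono) auto
  also have "\<dots> = 2 * sqrt D + 1" using N by simp
  also have "\<bar>of_int k * sqrt D - of_int h\<bar> * \<bar>of_int h + of_int k * sqrt D\<bar>
      = \<bar>of_int (h\<^sup>2 - D * k\<^sup>2)\<bar>"
  proof -
    have "(of_int k * sqrt D - of_int h) * (of_int h + of_int k * sqrt D)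
       = of_int k * of_int k * (sqrt D * sqrt D) - of_int h * of_int h" by (simp add: algebra_simps)
    also have "\<dots> = - of_int (h\<^sup>2 - D * k\<^sup>2)" using D by (simp add: power2_eq_square)
    finally show ?thesis by (metis abs_minus_cancel abs_mult)
  qed
  finally have "\<bar>h\<^sup>2 - D * k\<^sup>2\<bar> \<le> \<lceil>2 * sqrt D + 1\<rceil>" by linarith
  then have "(h, k) \<in> ?S" using hk by simp
  then have "\<delta> \<le> ?gap (h, k)" unfolding \<delta>_def using fin by (intro Min_le) auto
  then show False using hk N by simp
qed

text \<open>Two elements \<open>h + k \<surd>D\<close> with the same norm \<open>n\<close> that are congruent modulo \<open>n\<close> have a unit of
  norm 1 as their quotient, and the pigeonhole principle provides such a pair.\<close>

lemma pell_solution: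
  fixes D :: int
  assumes D: "D > 0" "\<And>s::int. s\<^sup>2 \<noteq> D"
  obtains x y :: int where "x\<^sup>2 - D * y\<^sup>2 = 1" "x > 0" "y > 0"
proof -
  define M where "M = \<lceil>2 * sqrt D + 1\<rceil>"
  let ?S = "{(h, k). k > 0 \<and> \<bar>h\<^sup>2 - D * k\<^sup>2\<bar> \<le> M}"
  let ?n = "\<lambda>(h, k). h\<^sup>2 - D * k\<^sup>2"
  let ?key = "\<lambda>p. (?n p, fst p mod \<bar>?n p\<bar>, snd p mod \<bar>?n p\<bar>)"
  have n0: "?n (h, k) \<noteq> 0" if "k > 0" for h k
    using nonsquare_norm_nonzero[OF D(2)] that by simp
  have inf: "infinite ?S" unfolding M_def by (rule sqrt_approximations_infinite[OF D])
  have "?key ` ?S \<subseteq> {-M..M} \<times> {0..M} \<times> {0..M}"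
  proof
    fix y assume "y \<in> ?key ` ?S"
    then obtain h k where p: "k > 0" "\<bar>?n (h, k)\<bar> \<le> M" "y = ?key (h, k)" by auto
    have "0 \<le> a mod \<bar>?n (h, k)\<bar> \<and> a mod \<bar>?n (h, k)\<bar> \<le> M" for a
    proof -
      have "0 < \<bar>?n (h, k)\<bar>" using n0[OF p(1), of h] by simp
      then show ?thesis using pos_mod_bound pos_mod_sign p(2) by (meson less_imp_le order_trans)
    qed
    then show "y \<in> {-M..M} \<times> {0..M} \<times> {0..M}" using p by (auto simp: abs_le_iff)
  qed
  then have "finite (?key ` ?S)" by (rule finite_subset) auto
  then have "\<not> inj_on ?key ?S" using inf finite_imageD by blast
  then obtain p1 p2 where p: "p1 \<in> ?S" "p2 \<in> ?S" "?key p1 = ?key p2" "p1 \<noteq> p2"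
    unfolding inj_on_def by blast
  obtain h1 k1 h2 k2 where "p1 = (h1, k1)" "p2 = (h2, k2)" by fastforce
  with p have k: "k1 > 0" "k2 > 0" and ne: "(h1, k1) \<noteq> (h2, k2)"
    and key: "?key (h1, k1) = ?key (h2, k2)" by auto
  define n where "n = ?n (h1, k1)"
  have n: "h1\<^sup>2 - D * k1\<^sup>2 = n" "h2\<^sup>2 - D * k2\<^sup>2 = n" "n \<noteq> 0"
    using key n0[OF k(1), of h1] by (auto simp: n_def)
  have "h1 mod \<bar>n\<bar> = h2 mod \<bar>n\<bar>" "k1 mod \<bar>n\<bar> = k2 mod \<bar>n\<bar>"
    using key n by auto
  then have "n dvd h2 - h1" "n dvd k2 - k1" by (metis abs_dvd_iff mod_eq_dvd_iff)+
  then obtain a b where ab: "h2 = h1 + n * a" "k2 = k1 + n * b"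
    by (metis add.commute diff_add_cancel dvdE)
  \<comment> \<open>\<open>x + y \<surd>D\<close> is the quotient \<open>(h1 + k1 \<surd>D) / (h2 + k2 \<surd>D)\<close>\<close>
  define x where "x = 1 + h1 * a - D * k1 * b"
  define y where "y = k1 * a - h1 * b"
  have x: "n * x = h1 * h2 - D * k1 * k2"
    using n(1) unfolding x_def ab by (simp add: algebra_simps power2_eq_square)
  have y: "n * y = k1 * h2 - h1 * k2"
    unfolding y_def ab by algebra
  have "n\<^sup>2 * (x\<^sup>2 - D * y\<^sup>2) = (n * x)\<^sup>2 - D * (n * y)\<^sup>2" by algebra
  also have "\<dots> = (h1\<^sup>2 - D * k1\<^sup>2) * (h2\<^sup>2 - D * k2\<^sup>2)" unfolding x y by algebra
  also have "\<dots> = n\<^sup>2 * 1" using n by (simp add: power2_eq_square)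
  finally have pell: "x\<^sup>2 - D * y\<^sup>2 = 1" using n(3) by simp
  have y0: "y \<noteq> 0"
  proof
    assume "y = 0"
    then have eq: "k1 * h2 = h1 * k2" using y by simp
    have "n * k2\<^sup>2 = (h1 * k2)\<^sup>2 - D * (k1 * k2)\<^sup>2"
      unfolding n(1)[symmetric] by algebra
    also have "\<dots> = n * k1\<^sup>2"
      unfolding eq[symmetric] n(2)[symmetric] by algebra
    finally have "n * k2\<^sup>2 = n * k1\<^sup>2" .
    then have "k1 = k2" using n(3) k by simp
    then show False using eq ne k by simp
  qed
  have "x \<noteq> 0"
  proof
    assume "x = 0"
    then have "- (D * y\<^sup>2) = 1" using pell by simp
    moreover have "D * y\<^sup>2 \<ge> 0" using D by simp
    ultimately show False by linarith
  qed
  then show thesis using that[of "\<bar>x\<bar>" "\<bar>y\<bar>"] pell y0 by simp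
qed

section \<open>The infinitesimal action on tensors\<close>

text \<open>The Lie algebra action: the derivative of \<open>tmap (1 + \<epsilon> M) t\<close> at \<open>\<epsilon> = 0\<close>.\<close>

definition tderiv :: "complex ^ 'm ^ 'm \<Rightarrow> 'm tensor \<Rightarrow> 'm tensor" where
  "tderiv M t = (\<lambda>xs. \<Sum>k<length xs. \<Sum>j\<in>UNIV. M $ (xs ! k) $ j * t (xs[k := j]))"

lemma sum_delta_off_position:
  fixes F :: "'m::finite list \<Rightarrow> complex"
  assumes k: "k < length xs"
  shows "(\<Sum>js | length js = length xs.
      (\<Prod>l\<in>{..<length xs} - {k}. if xs ! l = js ! l then 1 else 0) * F js) =
    (\<Sum>j\<in>UNIV. F (xs[k := j]))"
proof -
  let ?P = "\<lambda>js. \<Prod>l\<in>{..<length xs} - {k}. if xs ! l = js ! l then 1 else 0 :: complex"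
  have "(\<Sum>js | length js = length xs. ?P js * F js) =
        (\<Sum>js\<in>(\<lambda>j. xs[k := j]) ` UNIV. ?P js * F js)"
  proof (rule sum.mono_neutral_right)
    show "\<forall>js\<in>{js. length js = length xs} - range (\<lambda>j. xs[k := j]). ?P js * F js = 0"
    proof
      fix js assume js: "js \<in> {js. length js = length xs} - range (\<lambda>j. xs[k := j])"
      then have "js \<noteq> xs[k := js ! k]" by blast
      then obtain l where "l < length xs" "js ! l \<noteq> xs[k := js ! k] ! l"
        using js by (metis (mono_tags, lifting) DiffD1 length_list_update mem_Collect_eq nth_equalityI)
      then have "l \<noteq> k" "xs ! l \<noteq> js ! l" "l < length xs" using k by (auto simp: nth_list_update split: if_splits)
      then have "?P js = 0" by (intro prod_zero) auto
      then show "?P js * F js = 0" by simp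
    qed
  qed (auto simp: finite_lists_length)
  also have "\<dots> = (\<Sum>j\<in>UNIV. ?P (xs[k := j]) * F (xs[k := j]))"
    using k by (subst sum.reindex) (auto intro!: injI dest: arg_cong[of _ _ "\<lambda>l. l ! k"])
  also have "\<dots> = (\<Sum>j\<in>UNIV. F (xs[k := j]))"
    by (intro sum.cong refl) (simp add: nth_list_update)
  finally show ?thesis .
qed

text \<open>For fixed coordinates of the tensor, \<open>s\<^sup>d (M(s) t - t)\<close> is a polynomial in \<open>s\<close> with infinitely many
  zeros, hence zero; the claim is the vanishing of its derivative at 1, where \<open>s M(s)\<close> has the
  value 1 and the derivative \<open>C1 + 2 C2\<close>.\<close>

lemma tderiv_of_laurent_family:
  fixes C0 C1 C2 :: "complex ^ 'm ^ 'm" and M :: "complex \<Rightarrow> complex ^ 'm ^ 'm" and t :: "'m tensor"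
  assumes M: "\<And>s a b. s \<noteq> 0 \<Longrightarrow> s * M s $ a $ b = C0 $ a $ b + s * C1 $ a $ b + s\<^sup>2 * C2 $ a $ b"
    and one: "\<And>a b. C0 $ a $ b + C1 $ a $ b + C2 $ a $ b = (if a = b then 1 else 0)"
    and inf: "infinite {s. s \<noteq> 0 \<and> tmap (M s) t = t}"
  shows "tderiv (C1 + 2 *\<^sub>R C2) t xs = of_nat (length xs) * t xs"
proof -
  let ?d = "length xs"
  define Q where "Q a b = [: C0 $ a $ b, C1 $ a $ b, C2 $ a $ b :]" for a b
  have Qs: "poly (Q a b) s = s * M s $ a $ b" if "s \<noteq> 0" for a b s
    using that by (simp add: Q_def M power2_eq_square algebra_simps)
  have Q1: "poly (Q a b) 1 = (if a = b then 1 else 0)" for a b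
    using one[of a b] by (simp add: Q_def add.assoc)
  have Q': "poly (pderiv (Q a b)) 1 = (C1 + 2 *\<^sub>R C2) $ a $ b" for a b
    by (simp add: Q_def pderiv_pCons scaleR_conv_of_real)
  define p where "p = (\<Sum>js | length js = ?d. smult (t js) (\<Prod>k<?d. Q (xs ! k) (js ! k)))
     - smult (t xs) (monom 1 ?d)"
  have "poly p s = 0" if s: "s \<noteq> 0" "tmap (M s) t = t" for s
  proof -
    have "poly p s = (\<Sum>js | length js = ?d. t js * (s ^ ?d * (\<Prod>k<?d. M s $ (xs ! k) $ (js ! k))))
       - t xs * s ^ ?d"
      by (simp add: p_def poly_sum poly_prod Qs[OF s(1)] prod.distrib poly_monom)
    also have "\<dots> = s ^ ?d * (tmap (M s) t xs - t xs)"
      by (simp add: tmap_def sum_distrib_left right_diff_distrib mult_ac)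
    finally show ?thesis using s by simp
  qed
  then have "{s. s \<noteq> 0 \<and> tmap (M s) t = t} \<subseteq> {s. poly p s = 0}" by blast
  then have "infinite {s. poly p s = 0}" using inf finite_subset by blast
  then have "p = 0" using poly_roots_finite by blast
  then have "0 = poly (pderiv p) 1" by simp
  also have "\<dots> = (\<Sum>js | length js = ?d. t js * (\<Sum>k<?d.
        (\<Prod>l\<in>{..<?d} - {k}. if xs ! l = js ! l then 1 else 0) * (C1 + 2 *\<^sub>R C2) $ (xs ! k) $ (js ! k)))
      - t xs * of_nat ?d"
    by (simp add: p_def higher_pderiv_sum[of 1, simplified] pderiv_smult pderiv_diff pderiv_prod pderiv_monom poly_sum
        poly_prod poly_monom Q1 Q' del: vector_add_component vector_scaleR_component)
  also have "(\<Sum>js | length js = ?d. t js * (\<Sum>k<?d.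
        (\<Prod>l\<in>{..<?d} - {k}. if xs ! l = js ! l then 1 else 0) * (C1 + 2 *\<^sub>R C2) $ (xs ! k) $ (js ! k)))
     = (\<Sum>k<?d. \<Sum>js | length js = ?d.
        (\<Prod>l\<in>{..<?d} - {k}. if xs ! l = js ! l then 1 else 0) *
        ((C1 + 2 *\<^sub>R C2) $ (xs ! k) $ (js ! k) * t js))"
    by (subst sum.swap) (simp only: sum_distrib_left mult_ac)
  also have "\<dots> = (\<Sum>k<?d. \<Sum>j\<in>UNIV. (C1 + 2 *\<^sub>R C2) $ (xs ! k) $ (xs[k := j] ! k) * t (xs[k := j]))"
    by (intro sum.cong refl sum_delta_off_position) auto
  also have "\<dots> = tderiv (C1 + 2 *\<^sub>R C2) t xs"
    unfolding tderiv_def by (intro sum.cong refl) auto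
  finally show ?thesis by simp
qed

text \<open>The rotation \<open>u \<and> v\<close> in \<open>so(L\<^sub>\<complex>)\<close>.\<close>

definition skew :: "int ^ 'm ^ 'm \<Rightarrow> complex ^ 'm \<Rightarrow> complex ^ 'm \<Rightarrow> complex ^ 'm ^ 'm" where
  "skew G u v = matrix (\<lambda>x. form G v x *s u - form G u x *s v)"

lemma skew_apply: "skew G u v *v x = form G v x *s u - form G u x *s v"
  unfolding skew_def
  by (rule matrix_works, rule linear_vecI) (simp_all add: form_linear vec_eq_iff algebra_simps)

lemma skew_entry:
  "skew G u v $ a $ b = form G v (axis b 1) * u $ a - form G u (axis b 1) * v $ a"
  by (simp add: skew_def matrix_def)

lemma tderiv_skew_linear:
  "tderiv (skew G (u + u') v) t = tderiv (skew G u v) t + tderiv (skew G u' v) t"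
  "tderiv (skew G u (v + v')) t = tderiv (skew G u v) t + tderiv (skew G u v') t"
  "tderiv (skew G (c *s u) v) t = tscale c (tderiv (skew G u v) t)"
  "tderiv (skew G u (c *s v)) t = tscale c (tderiv (skew G u v) t)"
  "tderiv (skew G u u) t = 0"
  by (rule ext, simp add: tderiv_def skew_entry form_linear algebra_simps sum.distrib
      sum_subtractf tscale_def sum_distrib_left)+

section \<open>Integral one-parameter groups\<close>

text \<open>
  A rotation \<open>J\<close> in an indefinite plane, normalized so that \<open>J\<^sup>3 = D J\<close>. On the image of \<open>J\<close> it has the
  eigenvalues \<open>\<plusminus>\<surd>D\<close>, and \<open>boost s\<close> acts on the eigenvectors by \<open>s\<close> and \<open>1/s\<close> and on the
  kernel of \<open>J\<close> by 1: it is \<open>exp(\<theta>J/\<surd>D)\<close> with \<open>s = exp \<theta>\<close>.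
\<close>

locale integral_skew =
  fixes G :: "int ^ 'm ^ 'm" and J :: "complex ^ 'm ^ 'm" and D :: int
  assumes J_skew: "form G (J *v x) y = - form G x (J *v y)"
    and J_cube: "J *v (J *v (J *v x)) = of_int D *s (J *v x)"
    and J_int: "x \<in> lat \<Longrightarrow> J *v x \<in> lat"
    and D_pos: "D > 0"
begin

definition q :: complex where "q = of_real (sqrt (of_int D))"

lemma q: "q * q = of_int D" "q \<noteq> 0"
proof -
  have "sqrt (of_int D) * sqrt (of_int D) = of_int D" using D_pos by simp
  then show "q * q = of_int D" unfolding q_def by (metis of_real_mult of_real_of_int_eq)
  show "q \<noteq> 0" using D_pos by (simp add: q_def)
qed

text \<open>The coefficients \<open>sinh \<theta> / \<surd>D\<close> and \<open>(cosh \<theta> - 1) / D\<close> of \<open>J\<close> and \<open>J\<^sup>2\<close> in the exponential series.\<close>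

definition sh :: "complex \<Rightarrow> complex" where "sh s = (s - 1 / s) / (2 * q)"
definition ch :: "complex \<Rightarrow> complex" where "ch s = ((s + 1 / s) / 2 - 1) / (q * q)"

definition boost :: "complex \<Rightarrow> complex ^ 'm ^ 'm" where
  "boost s = matrix (\<lambda>x. x + sh s *s (J *v x) + ch s *s (J *v (J *v x)))"

lemma boost_apply: "boost s *v x = x + sh s *s (J *v x) + ch s *s (J *v (J *v x))"
  unfolding boost_def
  by (rule matrix_works, rule linear_vecI)
    (simp_all add: matrix_vector_right_distrib vec.scale vec_eq_iff algebra_simps)

lemma boost_mult:
  assumes "s \<noteq> 0" "t \<noteq> 0"
  shows "boost (s * t) = boost s ** boost t"
proof -
  have sh: "sh (s * t) = sh s + sh t + q * q * (sh s * ch t + ch s * sh t)"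
    using assms q(2) by (simp add: sh_def ch_def field_simps)
  have ch: "ch (s * t) = ch s + ch t + sh s * sh t + q * q * (ch s * ch t)"
    using assms q(2) by (simp add: sh_def ch_def field_simps)
  have "boost (s * t) *v x = boost s *v (boost t *v x)" for x
    unfolding boost_apply sh ch
    by (simp add: matrix_vector_right_distrib vec.scale J_cube q(1)[symmetric] vec_eq_iff
        algebra_simps)
  then show ?thesis by (simp add: matrix_eq matrix_vector_mul_assoc[symmetric])
qed

lemma boost_one: "boost 1 = mat 1"
  by (simp add: matrix_eq boost_apply sh_def ch_def)

lemma boost_power: "s \<noteq> 0 \<Longrightarrow> boost (s ^ (i + j)) = boost (s ^ i) ** boost (s ^ j)"
  by (simp add: power_add boost_mult)

lemma boost_isometry:
  assumes "s \<noteq> 0"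
  shows "form G (boost s *v x) (boost s *v y) = form G x y"
proof -
  have "2 * ch s - sh s * sh s + q * q * (ch s * ch s) = 0"
    using assms q(2) by (simp add: sh_def ch_def field_simps)
  moreover have "form G (boost s *v x) (boost s *v y) = form G x y +
     (2 * ch s - sh s * sh s + q * q * (ch s * ch s)) * form G x (J *v (J *v y))"
    by (simp add: boost_apply form_linear J_skew J_cube q(1)[symmetric] algebra_simps)
  ultimately show ?thesis by simp
qed

lemma boost_fixes: "J *v x = 0 \<Longrightarrow> boost s *v x = x"
  by (simp add: boost_apply)

text \<open>The unit \<open>X + Y \<surd>D\<close> is squared in order to cancel the denominator \<open>D\<close> in \<open>ch\<close>: the boost
  becomes \<open>1 + 2XY J + 2Y\<^sup>2 J\<^sup>2\<close>.\<close>

lemma boost_unit_int: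
  assumes "X\<^sup>2 - D * Y\<^sup>2 = 1" "s = (of_int X + of_int Y * q)\<^sup>2" "x \<in> lat"
  shows "boost s *v x \<in> lat" "boost (1 / s) *v x \<in> lat" "s \<noteq> 0"
proof -
  have "of_int (X\<^sup>2 - D * Y\<^sup>2) = (1 :: complex)" using assms(1) by simp
  then have norm: "of_int X * of_int X - q * q * (of_int Y * of_int Y) = 1"
    by (simp add: q power2_eq_square)
  then have prod: "s * (of_int X - of_int Y * q)\<^sup>2 = 1"
    unfolding assms(2) by algebra
  then show s0: "s \<noteq> 0" by auto
  have inv: "1 / s = (of_int X - of_int Y * q)\<^sup>2"
    using prod s0 by (simp add: field_simps)
  have sh: "sh s = of_int (2 * X * Y)"
    unfolding sh_def inv unfolding assms(2) using q(2) by (simp add: field_simps power2_eq_square)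
  have "(s + 1 / s) / 2 - 1 = of_int (2 * Y\<^sup>2) * (q * q)"
    unfolding inv unfolding assms(2) using norm by (simp add: field_simps power2_eq_square)
  then have ch: "ch s = of_int (2 * Y\<^sup>2)" unfolding ch_def using q(2) by simp
  have "sh (1 / s) = - sh s" "ch (1 / s) = ch s"
    by (simp_all add: sh_def ch_def minus_divide_left add.commute)
  then show "boost s *v x \<in> lat" "boost (1 / s) *v x \<in> lat"
    unfolding boost_apply using assms(3) sh ch
    by (auto intro!: int_coords J_int simp del: of_int_mult of_int_power)
qed

lemma boost_orth_int:
  assumes "X\<^sup>2 - D * Y\<^sup>2 = 1" "s = (of_int X + of_int Y * q)\<^sup>2"
  shows "boost (s ^ k) \<in> orth G \<int>"
proof -
  have s0: "s \<noteq> 0" using boost_unit_int(3)[OF assms, of 0] int_coords by blast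
  have *: "boost (s ^ k) *v x \<in> lat \<and> boost (1 / s ^ k) *v x \<in> lat" if "x \<in> lat" for x
    using that
  proof (induction k arbitrary: x)
    case 0
    then show ?case by (simp add: boost_one)
  next
    case (Suc k)
    have "boost (1 / s ^ Suc k) = boost (1 / s) ** boost (1 / s ^ k)"
      using boost_mult[of "1 / s" "1 / s ^ k"] s0 by simp
    moreover have "boost (s ^ Suc k) = boost s ** boost (s ^ k)"
      using boost_mult[of s "s ^ k"] s0 by simp
    ultimately show ?case
      using Suc boost_unit_int[OF assms] by (simp add: matrix_vector_mul_assoc[symmetric] del: power_Suc)
  qed
  have "x \<in> (\<lambda>v. boost (s ^ k) *v v) ` lat" if "x \<in> lat" for x
  proof (rule image_eqI[of _ _ "boost (1 / s ^ k) *v x"])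
    have "boost (s ^ k) ** boost (1 / s ^ k) = mat 1"
      using boost_mult[of "s ^ k" "1 / s ^ k"] s0 by (simp add: boost_one)
    then show "x = boost (s ^ k) *v (boost (1 / s ^ k) *v x)"
      by (simp add: matrix_vector_mul_assoc)
  qed (use * that in blast)
  then show ?thesis using * s0 boost_isometry[of "s ^ k"] by (auto simp: orth_def)
qed

lemma J_entry_int: "J $ a $ b \<in> \<int>"
proof -
  have "J *v axis b 1 \<in> lat" by (intro J_int int_coords)
  moreover have "(J *v axis b 1) $ a = J $ a $ b"
    by (simp add: matrix_vector_mult_def axis_def if_distrib sum.delta cong: if_cong)
  ultimately show ?thesis by (metis (mono_tags, lifting) coords_def mem_Collect_eq)
qed

lemma boost_orth_real:
  assumes "r > 0"
  shows "boost (of_real r) \<in> orth G \<real>"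
proof -
  have "J $ a $ b \<in> \<real>" for a b
    using J_entry_int[of a b] by (auto elim: Ints_cases)
  then have J: "J *v x \<in> coords \<real>" if "x \<in> coords \<real>" for x
    using that by (auto simp: coords_def matrix_vector_mult_def intro!: sum_in_Reals Reals_mult)
  have *: "boost (of_real r) *v x \<in> coords \<real>" if "x \<in> coords \<real>" for r x
  proof -
    have "sh (of_real r) \<in> \<real>" "ch (of_real r) \<in> \<real>"
      by (simp_all add: sh_def ch_def q_def)
    then show ?thesis unfolding boost_apply using that J by (intro real_coords) auto
  qed
  have "x \<in> (\<lambda>v. boost (of_real r) *v v) ` coords \<real>" if "x \<in> coords \<real>" for x
  proof (rule image_eqI)
    have "boost (of_real r) ** boost (of_real (1 / r)) = mat 1"
      using boost_mult[of "of_real r" "of_real (1 / r)"] assms by (simp add: boost_one)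
    then show "x = boost (of_real r) *v (boost (of_real (1 / r)) *v x)"
      by (simp add: matrix_vector_mul_assoc)
  qed (rule *[OF that])
  then show ?thesis using * boost_isometry[of "of_real r"] assms by (auto simp: orth_def)
qed

lemma cnj_boost:
  assumes "r > 0"
  shows "cnj_vec (boost (of_real r) *v x) = boost (of_real r) *v cnj_vec x"
proof -
  have "cnj (J $ a $ b) = J $ a $ b" for a b
    using J_entry_int[of a b] by (auto elim: Ints_cases)
  then have J: "cnj_vec (J *v x) = J *v cnj_vec x" for x
    by (simp add: cnj_vec_def vec_eq_iff matrix_vector_mult_def)
  have "cnj (sh (of_real r)) = sh (of_real r)" "cnj (ch (of_real r)) = ch (of_real r)"
    by (simp_all add: sh_def ch_def q_def)
  then have "cnj_vec (boost (of_real r) *v x) = cnj_vec x + sh (of_real r) *s cnj_vec (J *v x)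
      + ch (of_real r) *s cnj_vec (J *v (J *v x))"
    by (simp add: boost_apply cnj_vec_def vec_eq_iff)
  then show ?thesis by (simp add: boost_apply J)
qed

text \<open>The positive real line joins \<open>r\<close> to 1, so \<open>boost r\<close> moves each point along a path inside the
  period cone.\<close>

lemma boost_preserves_component:
  assumes D: "\<D> \<in> components (period_cone G)" and r: "r > 0"
  shows "(\<lambda>v. boost (of_real r) *v v) ` \<D> = \<D>"
proof -
  have sub: "boost (of_real r) *v w \<in> \<D>" if r: "r > 0" and w: "w \<in> \<D>" for r w
  proof -
    let ?T = "(\<lambda>s::real. boost (of_real s) *v w) ` {0<..}"
    have "continuous_on {0::real<..} (\<lambda>s. boost (of_real s) *v w)"
      unfolding boost_apply sh_def ch_def vector_scalar_mult_def
      by (intro continuous_intros) (use q(2) in auto)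
    then have conn: "connected ?T" by (intro connected_continuous_image) auto
    have "w \<in> period_cone G" using in_components_subset[OF D] w by blast
    then have sub: "?T \<subseteq> period_cone G"
      by (auto simp: period_cone_def cnj_boost boost_isometry)
    have "w \<in> ?T" by (rule image_eqI[of _ _ 1]) (auto simp: boost_one)
    then have "?T \<subseteq> \<D>" using components_maximal[OF D conn sub] w by blast
    then show ?thesis using r by blast
  qed
  moreover have "w \<in> (\<lambda>v. boost (of_real r) *v v) ` \<D>" if "w \<in> \<D>" for w
  proof (rule image_eqI)
    have "boost (of_real r) ** boost (of_real (1 / r)) = mat 1"
      using boost_mult[of "of_real r" "of_real (1 / r)"] r by (simp add: boost_one)
    then show "w = boost (of_real r) *v (boost (of_real (1 / r)) *v w)"
      by (simp add: matrix_vector_mul_assoc)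
    show "boost (of_real (1 / r)) *v w \<in> \<D>" using sub[of "1 / r" w] r that by simp
  qed
  ultimately show ?thesis using r by blast
qed

text \<open>The powers of \<open>s\<close> are infinitely many parameters at which the one-parameter group fixes \<open>t\<close>.\<close>

lemma tderiv_eq_0_if_boost_invariant:
  assumes s: "s > 1" and t: "tmap (boost (of_real s)) t = t"
  shows "tderiv J t = 0"
proof
  fix xs :: "'m list"
  let ?I = "\<lambda>a b. if a = b then 1 else 0 :: complex"
  \<comment> \<open>the coefficients of the quadratic polynomial \<open>z boost z\<close>\<close>
  define C0 where "C0 = (\<chi> a b. - (J $ a $ b) / (2 * q) + (J ** J) $ a $ b / (2 * (q * q)))"
  define C1 where "C1 = (\<chi> a b. ?I a b - (J ** J) $ a $ b / (q * q))"
  define C2 where "C2 = (\<chi> a b. J $ a $ b / (2 * q) + (J ** J) $ a $ b / (2 * (q * q)))"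
  have entry: "boost z $ a $ b = ?I a b + sh z * J $ a $ b + ch z * (J ** J) $ a $ b" for z a b
  proof -
    have col: "(M *v axis b 1) $ a = M $ a $ b" for M :: "complex ^ 'm ^ 'm"
      by (simp add: matrix_vector_mult_def axis_def if_distrib sum.delta cong: if_cong)
    have "boost z $ a $ b = (boost z *v axis b 1) $ a" by (rule col[symmetric])
    also have "\<dots> = ?I a b + sh z * J $ a $ b + ch z * (J ** J) $ a $ b"
      unfolding boost_apply matrix_vector_mul_assoc by (simp add: col) (simp add: axis_def)
    finally show ?thesis .
  qed
  have pow: "tmap (boost (of_real s ^ k)) t = t" for k
  proof (induction k)
    case 0
    then show ?case by (simp add: boost_one tmap_one)
  next
    case (Suc k)
    have "boost (of_real s ^ Suc k) = boost (of_real s) ** boost (of_real s ^ k)"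
      using boost_mult[of "of_real s" "of_real s ^ k"] s by simp
    then show ?case using Suc t by (simp add: tmap_mult)
  qed
  have "inj (\<lambda>k. complex_of_real s ^ k)"
    using s by (intro injI) (metis of_real_eq_iff of_real_power power_inject_exp)
  then have "infinite (range (\<lambda>k. complex_of_real s ^ k))" by (simp add: range_inj_infinite)
  moreover have "range (\<lambda>k. complex_of_real s ^ k) \<subseteq> {z. z \<noteq> 0 \<and> tmap (boost z) t = t}"
    using pow s by auto
  ultimately have inf: "infinite {z. z \<noteq> 0 \<and> tmap (boost z) t = t}" using finite_subset by blast
  have "tderiv (C1 + 2 *\<^sub>R C2) t xs = of_nat (length xs) * t xs"
  proof (rule tderiv_of_laurent_family[OF _ _ inf, where ?C0.0 = C0])
    fix z :: complex and a b assume "z \<noteq> 0"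
    then show "z * boost z $ a $ b = C0 $ a $ b + z * C1 $ a $ b + z\<^sup>2 * C2 $ a $ b"
      using q(2) by (simp add: entry sh_def ch_def C0_def C1_def C2_def field_simps power2_eq_square)
  next
    fix a b
    show "C0 $ a $ b + C1 $ a $ b + C2 $ a $ b = ?I a b"
      using q(2) by (simp add: C0_def C1_def C2_def field_simps)
  qed
  moreover have "(C1 + 2 *\<^sub>R C2) $ a $ b = ?I a b + J $ a $ b / q" for a b
    using q(2) by (simp add: C1_def C2_def field_simps scaleR_conv_of_real)
  then have "tderiv (C1 + 2 *\<^sub>R C2) t xs =
      (\<Sum>k<length xs. \<Sum>j\<in>UNIV. ?I (xs ! k) j * t (xs[k := j])) + tderiv J t xs / q"
    unfolding tderiv_def by (simp add: distrib_right sum.distrib sum_divide_distrib)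
  moreover have "(\<Sum>k<length xs. \<Sum>j\<in>UNIV. ?I (xs ! k) j * t (xs[k := j])) = of_nat (length xs) * t xs"
  proof -
    have "(\<Sum>j\<in>UNIV. ?I (xs ! k) j * t (xs[k := j])) = t xs" for k
      by (simp add: if_distrib if_distribR sum.delta cong: if_cong)
    then show ?thesis by simp
  qed
  ultimately show "tderiv J t xs = 0 xs" using q(2) by simp
qed

end

text \<open>Two of the powers lie in the same coset.\<close>

lemma finite_index_power:
  assumes fin: "finite_index_subgroup G D \<Gamma>"
    and M: "\<And>i j. M (i + j) = M i ** M j" and car: "\<And>i. M i \<in> carrier (orth_plus G D)"
    and inv: "\<And>i. M i ** N i = mat 1"
  obtains k :: nat where "k > 0" "M k \<in> \<Gamma>"
proof -
  let ?c = "\<lambda>i. \<Gamma> #>\<^bsub>orth_plus G D\<^esub> M i"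
  have "range ?c \<subseteq> rcosets\<^bsub>orth_plus G D\<^esub> \<Gamma>"
    using car by (auto simp: RCOSETS_def)
  then have "finite (range ?c)"
    using fin finite_subset by (auto simp: finite_index_subgroup_def)
  then have "\<not> inj ?c" using finite_imageD infinite_UNIV_nat by blast
  then obtain i j where "?c i = ?c j" "i < j"
    by (metis (no_types, lifting) injI linorder_neqE_nat)
  have "mat 1 \<in> \<Gamma>"
    using fin subgroup.one_closed by (fastforce simp: finite_index_subgroup_def orth_plus_def)
  then have "M j \<in> ?c j" by (force simp: r_coset_def orth_plus_def)
  then obtain h where h: "h \<in> \<Gamma>" "M j = h ** M i"
    using \<open>?c i = ?c j\<close> by (auto simp: r_coset_def orth_plus_def)
  have "M (j - i) ** M i = h ** M i" using M[of "j - i" i] \<open>i < j\<close> h by simp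
  then have "M (j - i) = h"
    by (metis inv matrix_mul_assoc matrix_mul_rid)
  then show thesis using that[of "j - i"] h \<open>i < j\<close> by simp
qed

section \<open>Signature and rational vectors\<close>

lemma real_orthogonal_triple:
  fixes a c :: "real ^ 3"
  obtains x1 x2 x3 :: real where "(x1, x2, x3) \<noteq> (0, 0, 0)"
    "x1 * a $ 1 + x2 * a $ 2 + x3 * a $ 3 = 0" "x1 * c $ 1 + x2 * c $ 2 + x3 * c $ 3 = 0"
proof -
  have "dim {a, c} \<le> card {a, c}" by (rule dim_le_card') simp
  also have "\<dots> < DIM(real ^ 3)" by (cases "a = c") auto
  finally obtain x where x: "x \<noteq> 0" "\<And>y. y \<in> span {a, c} \<Longrightarrow> orthogonal x y"
    using orthogonal_to_subspace_exists by blast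
  have "orthogonal x a" "orthogonal x c" using x(2) by (simp_all add: span_base)
  moreover have "(x $ 1, x $ 2, x $ 3) \<noteq> (0, 0, 0)"
    using x(1) by (simp add: vec_eq_iff forall_3)
  ultimately show thesis
    using that by (simp add: orthogonal_def inner_vec_def sum_3)
qed

lemma orthogonal_family_complete:
  fixes b :: "'m::finite \<Rightarrow> complex ^ 'm"
  assumes gram: "gram_matrix G" and orth: "\<And>i j. i \<noteq> j \<Longrightarrow> form G (b i) (b j) = 0"
    and nz: "\<And>i. form G (b i) (b i) \<noteq> 0" and x: "\<And>i. form G x (b i) = 0"
  shows "x = 0"
proof -
  have inj: "inj b" using orth nz by (metis injI)
  have "vec.independent (range b)"
  proof (rule vec.independent_if_scalars_zero)
    fix f w assume sum: "(\<Sum>y\<in>range b. f y *s y) = 0" and w: "w \<in> range b"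
    then obtain j where j: "w = b j" by blast
    have "0 = form G (\<Sum>i\<in>UNIV. f (b i) *s b i) (b j)"
      using sum inj by (simp add: sum.reindex)
    also have "\<dots> = (\<Sum>i\<in>UNIV. if i = j then f (b j) * form G (b j) (b j) else 0)"
      unfolding form_sum_left by (intro sum.cong) (auto simp: form_linear orth)
    finally show "f w = 0" using nz j by simp
  qed simp
  moreover have "card (range b) = CARD('m)" using inj by (simp add: card_image)
  ultimately have "UNIV \<subseteq> vec.span (range b)"
    by (intro vec.card_ge_dim_independent) (auto simp: vec.dim_UNIV card_cart_basis)
  have "form G x y = 0" for y
  proof -
    have "y \<in> vec.span (range b)" using \<open>UNIV \<subseteq> vec.span (range b)\<close> by blast
    then show ?thesis
      by (induction rule: vec.span_induct_alt) (use x in \<open>auto simp: form_linear\<close>)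
  qed
  then show ?thesis by (rule form_nondegenerate[OF gram])
qed

text \<open>The two vectors are those of positive norm in an orthogonal basis; on their common orthogonal
  complement the form is a negative combination of the squares of the other coordinates.\<close>

lemma signature_two_bound:
  fixes G :: "int ^ 'm ^ 'm"
  assumes gram: "gram_matrix G" and sig: "signature G 2 n"
  obtains p1 p2 where "p1 \<in> coords \<real>" "p2 \<in> coords \<real>"
    "\<And>w. w \<in> coords \<real> \<Longrightarrow> form G w p1 = 0 \<Longrightarrow> form G w p2 = 0 \<Longrightarrow>
      Re (form G w w) \<ge> 0 \<Longrightarrow> w = 0"
proof -
  have card: "CARD('m) = 2 + n" using sig by (simp add: signature_def)
  obtain b :: "'m \<Rightarrow> complex ^ 'm" where bb: "(\<forall>i. b i \<in> coords \<real>) \<and> (\<forall>i j. i \<noteq> j \<longrightarrow> form G (b i) (b j) = 0) \<and>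
      card {i. Re (form G (b i) (b i)) > 0} = 2 \<and> card {i. Re (form G (b i) (b i)) < 0} = n"
    using sig[unfolded signature_def, THEN conjunct2] by blast
  then have b: "\<And>i. b i \<in> coords \<real>" "\<And>i j. i \<noteq> j \<Longrightarrow> form G (b i) (b j) = 0"
    and pos: "card {i. Re (form G (b i) (b i)) > 0} = 2"
    and neg: "card {i. Re (form G (b i) (b i)) < 0} = n" by blast+
  have "card ({i. Re (form G (b i) (b i)) > 0} \<union> {i. Re (form G (b i) (b i)) < 0}) = 2 + n"
    using pos neg by (subst card_Un_disjoint) auto
  then have "{i. Re (form G (b i) (b i)) > 0} \<union> {i. Re (form G (b i) (b i)) < 0} = UNIV"
    using card by (intro card_subset_eq) auto
  then have "i \<in> {i. Re (form G (b i) (b i)) > 0} \<union> {i. Re (form G (b i) (b i)) < 0}" for i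
    by (simp only: UNIV_I)
  then have nz: "Re (form G (b i) (b i)) \<noteq> 0" for i
    by (metis (mono_tags, lifting) UnE mem_Collect_eq less_irrefl)
  then have nz': "form G (b i) (b i) \<noteq> 0" for i by (metis zero_complex.simps(1))
  obtain i1 i2 where i: "{i. Re (form G (b i) (b i)) > 0} = {i1, i2}"
    using pos by (auto simp: card_2_iff)
  have rl: "of_real (Re (form G x y)) = form G x y" if "x \<in> coords \<real>" "y \<in> coords \<real>" for x y
    using real_coords(4)[OF that, of G] by simp
  show thesis
  proof (rule that[OF b(1)[of i1] b(1)[of i2]])
    fix w assume w: "w \<in> coords \<real>" "form G w (b i1) = 0" "form G w (b i2) = 0"
      "Re (form G w w) \<ge> 0"
    define r where "r i = Re (form G w (b i))" for i
    define \<beta> where "\<beta> i = Re (form G (b i) (b i))" for i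
    have r: "form G w (b i) = of_real (r i)" and \<beta>: "form G (b i) (b i) = of_real (\<beta> i)" for i
      using rl w(1) b(1) by (simp_all add: r_def \<beta>_def)
    have \<beta>0: "\<beta> i \<noteq> 0" for i using nz by (simp add: \<beta>_def)
    let ?s = "\<Sum>i\<in>UNIV. of_real (r i / \<beta> i) *s b i"
    have "form G (w - ?s) (b j) = 0" for j
    proof -
      have "form G ?s (b j) = (\<Sum>i\<in>UNIV. if i = j then of_real (r j) else 0)"
        unfolding form_sum_left
        by (intro sum.cong) (use \<beta>0 in \<open>auto simp: form_linear b(2) \<beta>\<close>)
      then show ?thesis by (simp add: form_linear r)
    qed
    then have "w - ?s = 0" by (intro orthogonal_family_complete[OF gram, of b] b(2) nz')
    then have ws: "w = ?s" by simp
    have "form G w w = (\<Sum>i\<in>UNIV. of_real (r i / \<beta> i) * of_real (r i))"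
      by (subst (2) ws) (simp add: form_sum_right form_linear r)
    then have "Re (form G w w) = (\<Sum>i\<in>UNIV. r i * r i / \<beta> i)"
      by (simp add: Re_divide_of_real)
    then have "(\<Sum>i\<in>UNIV. - (r i * r i / \<beta> i)) \<le> 0" using w(4) by (simp add: sum_negf)
    moreover have nonneg: "- (r i * r i / \<beta> i) \<ge> 0" for i
    proof (cases "\<beta> i > 0")
      case True
      then have "i \<in> {i1, i2}" using i by (auto simp: \<beta>_def)
      then have "r i = 0" using w by (auto simp: r_def)
      then show ?thesis by simp
    next
      case False
      then have "- (r i * r i / \<beta> i) = r i * r i / (- \<beta> i)" "\<beta> i < 0" using \<beta>0[of i] by auto
      then show ?thesis by (simp only:) (intro divide_nonneg_pos, auto)
    qed
    ultimately have "(\<Sum>i\<in>UNIV. - (r i * r i / \<beta> i)) = 0"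
      by (meson order_antisym sum_nonneg)
    then have "- (r i * r i / \<beta> i) = 0" for i
      using nonneg by (subst (asm) sum_nonneg_eq_0_iff) auto
    then have "r i = 0" for i using \<beta>0[of i] by (metis divide_eq_0_iff mult_eq_0_iff neg_equal_0_iff_equal)
    then show "w = 0" using ws by simp
  qed
qed

context rational_hyperbolic_pair
begin

text \<open>Otherwise \<open>e + e'\<close>, \<open>u\<close> and \<open>v\<close> would span a positive semidefinite real space of dimension 3, which
  meets the negative definite complement of two vectors.\<close>

lemma negative_on_complement:
  assumes sig: "signature G 2 n"
    and u: "u \<in> VI G e e'" "u \<in> coords \<real>" "Re (form G u u) > 0"
    and v: "v \<in> VI G e e'" "v \<in> coords \<real>" "v \<noteq> 0" "form G u v = 0"
  shows "Re (form G v v) < 0"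
proof (rule ccontr)
  assume v0: "\<not> Re (form G v v) < 0"
  let ?h = "e + e'"
  have h: "?h \<in> coords \<real>" by (rule real_coords(1)) (rule coords_Rats_real[OF e_rat] coords_Rats_real[OF e'_rat])+
  obtain p1 p2 where p: "p1 \<in> coords \<real>" "p2 \<in> coords \<real>"
    "\<And>w. w \<in> coords \<real> \<Longrightarrow> form G w p1 = 0 \<Longrightarrow> form G w p2 = 0 \<Longrightarrow>
      Re (form G w w) \<ge> 0 \<Longrightarrow> w = 0"
    using signature_two_bound[OF gram sig] by blast
  have rl: "of_real (Re (form G x y)) = form G x y" if "x \<in> coords \<real>" "y \<in> coords \<real>" for x y
    using real_coords(4)[OF that, of G] by simp
  obtain x1 x2 x3 where x: "(x1, x2, x3) \<noteq> (0, 0, 0)"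
    "x1 * Re (form G ?h p1) + x2 * Re (form G u p1) + x3 * Re (form G v p1) = 0"
    "x1 * Re (form G ?h p2) + x2 * Re (form G u p2) + x3 * Re (form G v p2) = 0"
    using real_orthogonal_triple[of
      "vector [Re (form G ?h p1), Re (form G u p1), Re (form G v p1)]"
      "vector [Re (form G ?h p2), Re (form G u p2), Re (form G v p2)]"] by auto
  define w where "w = of_real x1 *s ?h + of_real x2 *s u + of_real x3 *s v"
  have wreal: "w \<in> coords \<real>" unfolding w_def by (intro real_coords(1,3) h u v) simp_all
  have "Re (form G w p1) = 0" "Re (form G w p2) = 0"
    using x by (simp_all add: w_def form_linear algebra_simps)
  then have wp: "form G w p1 = 0" "form G w p2 = 0"
    using rl[OF wreal] p by (metis of_real_0)+
  have vu: "form G v u = 0" using v(4) form_sym[OF gram] by metis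
  note VI = u(1)[unfolded VI_iff] v(1)[unfolded VI_iff] u(1)[unfolded VI_iff'] v(1)[unfolded VI_iff']
  have pair: "form G w ?h = of_real (2 * x1)" "form G w u = of_real x2 * form G u u"
    using VI v(4) vu by (simp_all add: w_def form_linear)
  have "form G w w = of_real (2 * x1 * x1) + of_real (x2 * x2) * form G u u + of_real (x3 * x3) * form G v v"
    using VI v(4) vu by (simp add: w_def form_linear algebra_simps)
  then have "Re (form G w w) = 2 * (x1 * x1) + x2 * x2 * Re (form G u u) + x3 * x3 * Re (form G v v)"
    by simp
  moreover have "0 \<le> x2 * x2 * Re (form G u u)" "0 \<le> x3 * x3 * Re (form G v v)"
    using u v0 by simp_all
  ultimately have "Re (form G w w) \<ge> 0" by simp
  then have w0: "w = 0" using p wreal wp by blast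
  have "form G u u \<noteq> 0" using u(3) by auto
  then have "x1 = 0" "x2 = 0" using pair w0 by simp_all
  then have "of_real x3 *s v = 0" using w0 by (simp add: w_def)
  then have "x3 = 0" using v(3) by simp
  then show False using x \<open>x1 = 0\<close> \<open>x2 = 0\<close> by simp
qed

text \<open>Rational points are dense in the real points of \<open>V\<close>, because the projection to \<open>V\<close> is rational.\<close>

lemma exists_rational_positive:
  assumes y: "y \<in> VI G e e'" "y \<in> coords \<real>" "Re (form G y y) > 0"
  obtains u where "u \<in> VI G e e'" "u \<in> coords \<rat>" "Re (form G u u) > 0"
proof -
  have ex: "\<exists>r. r \<in> \<rat> \<and> Re (y $ i) - 1 / real (Suc n) < r \<and> r < Re (y $ i)" for i n
    using Rats_dense_in_real[of "Re (y $ i) - 1 / real (Suc n)" "Re (y $ i)"] by auto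
  define \<rho> where
    "\<rho> n i = (SOME r. r \<in> \<rat> \<and> Re (y $ i) - 1 / real (Suc n) < r \<and> r < Re (y $ i))" for n i
  have \<rho>: "\<rho> n i \<in> \<rat>" "Re (y $ i) - 1 / real (Suc n) < \<rho> n i" "\<rho> n i < Re (y $ i)" for n i
    using someI_ex[OF ex[of i n]] unfolding \<rho>_def by blast+
  define x where "x n = (\<chi> i. complex_of_real (\<rho> n i))" for n
  have xrat: "x n \<in> coords \<rat>" for n
    using \<rho>(1) unfolding coords_def x_def by (auto elim!: Rats_cases simp: of_real_of_rat_complex)
  have lim: "(\<lambda>n. x n $ i) \<longlonglongrightarrow> y $ i" for i
  proof -
    have "(\<lambda>n. \<rho> n i) \<longlonglongrightarrow> Re (y $ i)"
    proof (rule tendsto_sandwich[OF always_eventually always_eventually])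
      show "\<forall>n. Re (y $ i) - 1 / real (Suc n) \<le> \<rho> n i" using less_imp_le[OF \<rho>(2)] by blast
      show "\<forall>n. \<rho> n i \<le> Re (y $ i)" using less_imp_le[OF \<rho>(3)] by blast
      show "(\<lambda>n. Re (y $ i) - 1 / real (Suc n)) \<longlonglongrightarrow> Re (y $ i)"
        using tendsto_diff[OF tendsto_const LIMSEQ_inverse_real_of_nat, of "Re (y $ i)"]
        by (simp add: divide_inverse)
    qed simp
    then have "(\<lambda>n. complex_of_real (\<rho> n i)) \<longlonglongrightarrow> of_real (Re (y $ i))" by (rule tendsto_of_real)
    moreover have "of_real (Re (y $ i)) = y $ i" using y(2) by (simp add: coords_def)
    ultimately show ?thesis by (simp add: x_def)
  qed
  have limf: "(\<lambda>n. form G (x n) (w n)) \<longlonglongrightarrow> form G y w'"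
    if "\<And>i. (\<lambda>n. w n $ i) \<longlonglongrightarrow> w' $ i" for w w'
    unfolding form_def by (intro tendsto_sum tendsto_mult tendsto_const lim that)
  have "(\<lambda>n. proj (x n) $ i) \<longlonglongrightarrow> proj y $ i" for i
    unfolding proj_def vector_minus_component vector_smult_component
    by (intro tendsto_diff tendsto_mult tendsto_const limf lim)
  then have "(\<lambda>n. form G (x n) (proj (x n))) \<longlonglongrightarrow> form G y (proj y)" by (rule limf)
  then have "(\<lambda>n. Re (form G (x n) (proj (x n)))) \<longlonglongrightarrow> Re (form G y y)"
    using proj_VI[OF y(1)] by (auto intro: tendsto_Re)
  then have "\<forall>\<^sub>F n in sequentially. Re (form G (x n) (proj (x n))) > 0"
    using y(3) by (rule order_tendstoD)
  then obtain n where "Re (form G (x n) (proj (x n))) > 0"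
    using eventually_happens by fastforce
  then have "Re (form G (proj (x n)) (proj (x n))) > 0"
    using form_proj proj_VI[OF proj_in_VI] by metis
  then show thesis using that proj_in_VI proj_coords(1)[OF xrat] by blast
qed

text \<open>In a space of dimension at least 5, the four vectors \<open>e, e', u, v\<close> do not span, so some standard
  basis vector survives the rational projection to their orthogonal complement.\<close>

lemma exists_third_direction:
  fixes u v :: "complex ^ 'a"
  assumes card: "CARD('a) \<ge> 5"
    and u: "u \<in> VI G e e'" "u \<in> coords \<rat>" "form G u u \<noteq> 0"
    and v: "v \<in> VI G e e'" "v \<in> coords \<rat>" "form G v v \<noteq> 0" "form G u v = 0"
  obtains w where "w \<in> VI G e e'" "w \<in> coords \<rat>" "w \<noteq> 0" "form G u w = 0" "form G v w = 0"
proof -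
  define c where "c x z = form G x z / form G x x" for x z
  define r where "r x = proj x - c u (proj x) *s u - c v (proj x) *s v" for x
  have vu: "form G v u = 0" using v(4) form_sym[OF gram] by metis
  have rVI: "r x \<in> VI G e e'" for x
    unfolding r_def by (intro VI_closed proj_in_VI u v)
  have rrat: "r x \<in> coords \<rat>" if "x \<in> coords \<rat>" for x
    unfolding r_def c_def using proj_coords(1)[OF that] u v by (intro rat_coords Rats_divide)
  have rorth: "form G u (r x) = 0" "form G v (r x) = 0" for x
    using u(3) v(3,4) vu by (simp_all add: r_def form_linear c_def)
  have "\<exists>i. r (axis i 1) \<noteq> 0"
  proof (rule ccontr)
    assume "\<nexists>i. r (axis i 1) \<noteq> 0"
    then have "axis i 1 = c u (proj (axis i 1)) *s u + c v (proj (axis i 1)) *s v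
       + form G (axis i 1) e *s e' + form G (axis i 1) e' *s e" for i :: 'a
      by (simp add: r_def proj_def algebra_simps)
    then have "axis i 1 \<in> vec.span {u, v, e', e}" for i :: 'a
      by (metis vec.span_add vec.span_scale vec.span_base insertCI)
    then have "y \<in> vec.span {u, v, e', e}" for y :: "complex ^ 'a"
      by (subst vec_expand) (intro vec.span_sum vec.span_scale)
    then have "vec.dim (UNIV :: (complex ^ 'a) set) \<le> card {u, v, e', e}"
      by (intro vec.dim_le_card) auto
    moreover have "card {u, v, e', e} \<le> 4"
      by (auto simp: card_insert_if)
    ultimately show False using card by (simp add: vec.dim_UNIV card_cart_basis)
  qed
  then show thesis using that rVI rorth rrat[OF rat_coords(5)] by blast
qed

end

section \<open>From the discrete group to the Lie algebra\<close>

text \<open>The tensor \<open>t\<close> is an abstraction of the constant term.\<close>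

locale levi_invariant = rational_hyperbolic_pair G e e'
  for G :: "int ^ 'm ^ 'm" and e e' +
  fixes D \<Gamma> n t
  assumes sig: "signature G 2 n" and n3: "n \<ge> 3"
    and D: "D \<in> components (period_cone G)" and fin: "finite_index_subgroup G D \<Gamma>"
    and inv: "\<And>\<gamma>. \<gamma> \<in> \<Gamma> \<Longrightarrow> \<gamma> *v e = e \<Longrightarrow> \<gamma> *v e' = e' \<Longrightarrow> tmap \<gamma> t = t"
    and pos: "\<exists>y \<in> VI G e e' \<inter> coords \<real>. Re (form G y y) > 0"
begin

text \<open>On the plane of \<open>u\<close> and \<open>v\<close> the rotation squares to \<open>AB\<close>, so a Pell unit for \<open>AB\<close> defines an
  integral boost of infinite order that fixes \<open>e\<close> and \<open>e'\<close>.\<close>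

lemma rotation_kills_nonsquare:
  fixes A B :: int
  assumes u: "u \<in> VI G e e'" "u \<in> lat" "form G u u = of_int A" "A > 0"
    and v: "v \<in> VI G e e'" "v \<in> lat" "form G v v = - of_int B" "B > 0"
    and uv: "form G u v = 0" and nonsq: "\<And>s::int. s\<^sup>2 \<noteq> A * B"
  shows "tderiv (skew G u v) t = 0"
proof -
  have vu: "form G v u = 0" using uv form_sym[OF gram] by metis
  interpret integral_skew G "skew G u v" "A * B"
  proof
    show "form G (skew G u v *v x) y = - form G x (skew G u v *v y)" for x y
      using form_sym[OF gram, of x u] form_sym[OF gram, of x v] 
      by (simp add: skew_apply form_linear)
    show "skew G u v *v (skew G u v *v (skew G u v *v x)) = of_int (A * B) *s (skew G u v *v x)" for x
      by (simp add: skew_apply form_linear u v uv vu vec_eq_iff algebra_simps)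
    show "skew G u v *v x \<in> lat" if "x \<in> lat" for x
      unfolding skew_apply using that u v by (intro int_coords)
    show "A * B > 0" using u v by simp
  qed
  obtain X Y :: int where XY: "X\<^sup>2 - A * B * Y\<^sup>2 = 1" "X > 0" "Y > 0"
    using pell_solution[OF D_pos nonsq] by blast
  define s where "s = (of_int X + of_int Y * sqrt (of_int (A * B)))\<^sup>2"
  have "of_int X + of_int Y * sqrt (of_int (A * B)) > 1"
  proof -
    have "real_of_int X \<ge> 1" using XY by linarith
    moreover have "of_int Y * sqrt (of_int (A * B)) > 0" using XY D_pos by (simp del: of_int_mult)
    ultimately show ?thesis by linarith
  qed
  then have s1: "s > 1" unfolding s_def by (metis one_less_power pos2)
  have sq: "complex_of_real s = (of_int X + of_int Y * q)\<^sup>2"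
    unfolding s_def q_def by (simp del: of_int_mult)
  let ?M = "\<lambda>k::nat. boost (of_real s ^ k)"
  obtain k :: nat where k: "k > 0" "?M k \<in> \<Gamma>"
  proof (rule finite_index_power[OF fin, of ?M "\<lambda>k. boost (of_real (1 / s ^ k))"])
    show "?M (i + j) = ?M i ** ?M j" for i j using s1 by (intro boost_power) auto
    show "?M i \<in> carrier (orth_plus G D)" for i
      using boost_orth_int[OF XY(1) sq, of i] boost_orth_real[of "s ^ i"]
        boost_preserves_component[OF D, of "s ^ i"] s1
      by (simp add: orth_plus_def orth_plus_real_def)
    show "?M i ** boost (of_real (1 / s ^ i)) = mat 1" for i
      using boost_mult[of "of_real s ^ i" "of_real (1 / s ^ i)"] s1 by (simp add: boost_one)
  qed
  have "skew G u v *v e = 0" "skew G u v *v e' = 0"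
    using u(1) v(1) by (simp_all add: skew_apply VI_iff)
  then have "tmap (?M k) t = t" using inv k(2) boost_fixes by blast
  then show ?thesis using tderiv_eq_0_if_boost_invariant[of "s ^ k"] s1 k(1) by (simp add: one_less_power)
qed

lemma lattice_norm_int:
  assumes "x \<in> lat"
  obtains a :: int where "form G x x = of_int a"
  using int_coords(4)[OF assms assms] by (auto elim: Ints_cases)

text \<open>If \<open>AB\<close> is a square, the vectors \<open>x v \<plusminus> w\<close> replace \<open>v\<close>: for large \<open>x\<close> the number
  \<open>A (B x\<^sup>2 + C)\<close> lies strictly between two consecutive squares, and the sum of the two resulting
  relations is a multiple of the relation for \<open>v\<close>.\<close>

lemma rotation_kills_orthogonal:
  assumes u: "u \<in> VI G e e'" "u \<in> coords \<rat>" "Re (form G u u) > 0"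
    and v: "v \<in> VI G e e'" "v \<in> coords \<rat>" "form G u v = 0"
  shows "tderiv (skew G u v) t = 0"
proof (cases "v = 0")
  case True
  then show ?thesis using tderiv_skew_linear(4)[of G u 0 0 t] by (simp add: tscale_def zero_fun_def)
next
  case v0: False
  have neg: "Re (form G x x) < 0" if "x \<in> VI G e e'" "x \<in> coords \<rat>" "x \<noteq> 0" "form G u x = 0" for x
    using negative_on_complement[OF sig] u that coords_Rats_real by blast
  have "CARD('m) \<ge> 5" using sig n3 by (simp add: signature_def)
  then obtain w where w: "w \<in> VI G e e'" "w \<in> coords \<rat>" "w \<noteq> 0" "form G u w = 0" "form G v w = 0"
  proof (rule exists_third_direction[OF _ u(1,2) _ v(1,2) _ v(3)])
    show "form G u u \<noteq> 0" using u(3) by auto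
    show "form G v v \<noteq> 0" using neg[OF v(1,2) v0 v(3)] by auto
  qed
  obtain a b c :: nat where scale: "a > 0" "of_nat a *s u \<in> lat" "b > 0" "of_nat b *s v \<in> lat"
    "c > 0" "of_nat c *s w \<in> lat"
    using u(2) v(2) w(2) rational_multiple_in_lattice by metis
  define u' where "u' = of_nat a *s u"
  define v' where "v' = of_nat b *s v"
  define w' where "w' = of_nat c *s w"
  have VI: "u' \<in> VI G e e'" "v' \<in> VI G e e'" "w' \<in> VI G e e'"
    and lat: "u' \<in> lat" "v' \<in> lat" "w' \<in> lat"
    using u v w scale by (simp_all add: u'_def v'_def w'_def VI_closed)
  have orth: "form G u' v' = 0" "form G u' w' = 0" "form G v' w' = 0" "form G w' v' = 0"
    using v w form_sym[OF gram, of w v] by (simp_all add: u'_def v'_def w'_def form_linear)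
  obtain A B1 B2 :: int where norms: "form G u' u' = of_int A" "form G v' v' = of_int B1"
    "form G w' w' = of_int B2"
    using lattice_norm_int[OF lat(1)] lattice_norm_int[OF lat(2)] lattice_norm_int[OF lat(3)]
    by metis
  have A: "A > 0"
  proof -
    have "Re (form G u' u') = (real a * real a) * Re (form G u u)" by (simp add: u'_def form_linear)
    then have "real_of_int A > 0" using u(3) scale norms by simp
    then show ?thesis by simp
  qed
  define B C where "B = - B1" and "C = - B2"
  have B: "form G v' v' = - of_int B" "B > 0"
  proof -
    have "Re (form G v' v') = (real b * real b) * Re (form G v v)" by (simp add: v'_def form_linear)
    then have "real_of_int B1 < 0"
      using neg[OF v(1,2) v0 v(3)] scale norms by (simp add: mult_pos_neg)
    then show "B > 0" by (simp add: B_def)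
    show "form G v' v' = - of_int B" by (simp add: B_def norms)
  qed
  have C: "form G w' w' = - of_int C" "C > 0"
  proof -
    have "Re (form G w' w') = (real c * real c) * Re (form G w w)" by (simp add: w'_def form_linear)
    then have "real_of_int B2 < 0"
      using neg[OF w(1-4)] scale norms by (simp add: mult_pos_neg)
    then show "C > 0" by (simp add: C_def)
    show "form G w' w' = - of_int C" by (simp add: C_def norms)
  qed
  have "tderiv (skew G u' v') t = 0"
  proof (cases "\<exists>s::int. s\<^sup>2 = A * B")
    case False
    then show ?thesis
      by (intro rotation_kills_nonsquare[OF VI(1) lat(1) norms(1) A VI(2) lat(2) B orth(1)]) auto
  next
    case True
    then obtain s0 :: int where "s0\<^sup>2 = A * B" by blast
    define s where "s = \<bar>s0\<bar>"
    have s: "s\<^sup>2 = A * B" "s > 0"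
      using \<open>s0\<^sup>2 = A * B\<close> A B by (auto simp: s_def)
    \<comment> \<open>with this choice \<open>A (B x\<^sup>2 + C) = (s x)\<^sup>2 + x\<close>, which is below \<open>(s x + 1)\<^sup>2\<close>\<close>
    define x where "x = A * C"
    have x: "x > 0" using A C by (simp add: x_def)
    have nonsq: "r\<^sup>2 \<noteq> A * (B * x\<^sup>2 + C)" for r :: int
    proof
      assume "r\<^sup>2 = A * (B * x\<^sup>2 + C)"
      then have r: "\<bar>r\<bar>\<^sup>2 = (s * x)\<^sup>2 + x"
        by (simp add: s(1)[symmetric] power_mult_distrib x_def algebra_simps)
      have "s * x < \<bar>r\<bar>" by (rule power2_less_imp_less) (use r x in auto)
      then have "(s * x + 1)\<^sup>2 \<le> \<bar>r\<bar>\<^sup>2" using s x by (intro power_mono) auto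
      then have "2 * (s * x) + 1 \<le> x" unfolding r by (simp add: power2_eq_square algebra_simps)
      moreover have "x \<le> s * x" using s x by simp
      ultimately show False using x by linarith
    qed
    have kill: "tderiv (skew G u' (of_int x *s v' + z)) t = 0"
      if z: "z \<in> VI G e e'" "z \<in> lat" "form G u' z = 0" "form G v' z = 0" "form G z v' = 0"
        "form G z z = - of_int C" for z
    proof (rule rotation_kills_nonsquare[OF VI(1) lat(1) norms(1) A _ _ _ _ _ nonsq])
      show "of_int x *s v' + z \<in> VI G e e'" using VI z by (intro VI_closed)
      show "of_int x *s v' + z \<in> lat" using lat z by (intro int_coords) auto
      show "form G (of_int x *s v' + z) (of_int x *s v' + z) = - of_int (B * x\<^sup>2 + C)"
        using z B by (simp add: form_linear power2_eq_square algebra_simps)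
      show "B * x\<^sup>2 + C > 0" using B(2) C(2) by (simp add: add_nonneg_pos)
      show "form G u' (of_int x *s v' + z) = 0" using orth z by (simp add: form_linear)
    qed
    have "tscale (of_int x) (tderiv (skew G u' v') t) + tderiv (skew G u' w') t = 0"
      using kill[of w'] VI lat orth C by (simp only: tderiv_skew_linear)
    moreover have "tscale (of_int x) (tderiv (skew G u' v') t) + tscale (- 1) (tderiv (skew G u' w') t) = 0"
    proof -
      have "tderiv (skew G u' (of_int x *s v' + (- 1) *s w')) t = 0"
      proof (rule kill)
        show "(- 1) *s w' \<in> lat" by (rule int_coords(3)) (use lat in auto)
        show "form G ((- 1) *s w') ((- 1) *s w') = - of_int C"
          unfolding form_scale_left form_scale_right C(1) by simp
      qed (simp_all only: form_scale_left form_scale_right orth mult_zero_right VI_closed(3)[OF VI(3)])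
      then show ?thesis by (simp only: tderiv_skew_linear)
    qed
    ultimately show ?thesis
      using x by (simp add: fun_eq_iff tscale_def eq_neg_iff_add_eq_0)
  qed
  then show ?thesis using scale
    by (simp add: u'_def v'_def tderiv_skew_linear fun_eq_iff tscale_def)
qed

text \<open>The rotation \<open>u \<and> v\<close> depends only on \<open>v\<close> modulo \<open>u\<close>.\<close>

lemma rotation_kills_positive:
  assumes u: "u \<in> VI G e e'" "u \<in> coords \<rat>" "Re (form G u u) > 0"
    and v: "v \<in> VI G e e'" "v \<in> coords \<rat>"
  shows "tderiv (skew G u v) t = 0"
proof -
  let ?c = "form G u v / form G u u"
  have u0: "form G u u \<noteq> 0" using u by auto
  have "tderiv (skew G u (v - ?c *s u)) t = 0"
  proof (rule rotation_kills_orthogonal[OF u])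
    show "v - ?c *s u \<in> VI G e e'" using u v by (intro VI_closed)
    show "v - ?c *s u \<in> coords \<rat>" using u v by (intro rat_coords Rats_divide)
    show "form G u (v - ?c *s u) = 0" using u0 by (simp add: form_linear)
  qed
  moreover have "tderiv (skew G u v) t =
      tderiv (skew G u (v - ?c *s u)) t + tscale ?c (tderiv (skew G u u) t)"
    by (simp only: tderiv_skew_linear(2,4)[symmetric] diff_add_cancel)
  ultimately show ?thesis by (simp only: tderiv_skew_linear tens.scale_zero_right add_0)
qed

text \<open>Every \<open>u\<close> is a difference of two vectors of positive norm, \<open>u + N p\<close> and \<open>N p\<close>.\<close>

theorem rotation_kills:
  assumes u: "u \<in> VI G e e'" "u \<in> coords \<rat>" and v: "v \<in> VI G e e'" "v \<in> coords \<rat>"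
  shows "tderiv (skew G u v) t = 0"
proof -
  obtain p where p: "p \<in> VI G e e'" "p \<in> coords \<rat>" "Re (form G p p) > 0"
    using pos exists_rational_positive by blast
  let ?a = "Re (form G u u)" and ?b = "Re (form G u p) + Re (form G p u)" and ?c = "Re (form G p p)"
  obtain N :: nat where N: "real N * ?c > \<bar>?a\<bar> + \<bar>?b\<bar>"
    using reals_Archimedean3[OF p(3)] by blast
  have N1: "real N \<ge> 1" using N by (cases N) auto
  let ?w = "u + of_nat N *s p"
  have "Re (form G ?w ?w) = ?a + real N * (?b + real N * ?c)"
    by (simp add: form_linear algebra_simps)
  moreover have "\<bar>?a\<bar> < ?b + real N * ?c" using N by linarith
  then have "\<bar>?a\<bar> < real N * (?b + real N * ?c)"
    using mult_right_mono[OF N1, of "?b + real N * ?c"] by (simp only: mult_1) linarith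
  ultimately have "Re (form G ?w ?w) > 0" by linarith
  moreover have "?w \<in> VI G e e'" "?w \<in> coords \<rat>" using u p by (auto intro!: VI_closed rat_coords)
  ultimately have "tderiv (skew G ?w v) t = 0" using rotation_kills_positive v by blast
  moreover have "tderiv (skew G p v) t = 0" using rotation_kills_positive p v by blast
  ultimately show ?thesis
    by (simp only: tderiv_skew_linear tens.scale_zero_right add_0_right)
qed

end

section \<open>Traceless tensors killed by all rotations\<close>

text \<open>A linear relation among the coordinates of the vectors of \<open>W\<close> holds in each tensor factor.\<close>

lemma tpow_slot:
  assumes "t \<in> tpow d W" and p: "p < d" "length xs = d"
    and \<alpha>: "\<And>v. v \<in> W \<Longrightarrow> (\<Sum>j\<in>UNIV. \<alpha> j * v $ j) = 0"
  shows "(\<Sum>j\<in>UNIV. \<alpha> j * t (xs[p := j])) = 0"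
  using assms(1)
proof (induction rule: tpow_induct)
  case (pure vs)
  let ?R = "\<Prod>k\<in>{..<d} - {p}. (vs ! k) $ (xs ! k)"
  have "pure_tensor vs (xs[p := j]) = (vs ! p) $ j * ?R" for j
  proof -
    have "pure_tensor vs (xs[p := j]) = (\<Prod>k<d. (vs ! k) $ (xs[p := j] ! k))"
      using pure p by (simp add: pure_tensor_def)
    also have "\<dots> = (vs ! p) $ j * (\<Prod>k\<in>{..<d} - {p}. (vs ! k) $ (xs[p := j] ! k))"
      using p by (subst prod.remove[of _ p]) auto
    also have "(\<Prod>k\<in>{..<d} - {p}. (vs ! k) $ (xs[p := j] ! k)) = ?R"
      by (intro prod.cong) auto
    finally show ?thesis .
  qed
  then have "(\<Sum>j\<in>UNIV. \<alpha> j * pure_tensor vs (xs[p := j])) = (\<Sum>j\<in>UNIV. \<alpha> j * (vs ! p) $ j) * ?R"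
    by (simp add: sum_distrib_right mult.assoc)
  moreover have "vs ! p \<in> W" using pure p by auto
  ultimately show ?case using \<alpha> by simp
next
  case (scale c t)
  have "(\<Sum>j\<in>UNIV. \<alpha> j * tscale c t (xs[p := j])) = c * (\<Sum>j\<in>UNIV. \<alpha> j * t (xs[p := j]))"
    by (simp add: tscale_def sum_distrib_left mult_ac)
  then show ?case using scale by simp
qed (simp_all add: distrib_left sum.distrib)

text \<open>Tracelessness with the contracted indices written in place: unlike the contractions, whose result
  has lost two positions, this form is visibly stable under permutations of the factors.\<close>

definition tracefree :: "int ^ 'm ^ 'm \<Rightarrow> nat \<Rightarrow> 'm tensor \<Rightarrow> bool" where
  "tracefree G d t \<longleftrightarrow> (\<forall>p q xs. p < d \<longrightarrow> q < d \<longrightarrow> p \<noteq> q \<longrightarrow> length xs = d \<longrightarrow>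
     (\<Sum>x\<in>UNIV. \<Sum>y\<in>UNIV. of_int (G $ x $ y) * t (xs[p := x, q := y])) = 0)"

lemma tracefree_scale: "tracefree G d t \<Longrightarrow> tracefree G d (tscale c t)"
  unfolding tracefree_def tscale_def
  by (simp add: mult.left_commute[of _ c] sum_distrib_left[symmetric])

lemma tracefree_sum:
  assumes "\<And>i. i \<in> A \<Longrightarrow> tracefree G d (f i)"
  shows "tracefree G d (sum f A)"
  using assms
  by (induction A rule: infinite_finite_induct)
    (simp_all add: tracefree_def distrib_left sum.distrib)

lemma tracefree_tperm:
  assumes "tracefree G d t" "\<sigma> permutes {..<d}"
  shows "tracefree G d (tperm \<sigma> t)"
  unfolding tracefree_def
proof (intro allI impI)
  fix p q and xs :: "'a list" assume a: "p < d" "q < d" "p \<noteq> q" "length xs = d"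
  let ?i = "inv_into UNIV \<sigma>" and ?zs = "map (\<lambda>k. xs ! \<sigma> k) [0..<d]"
  have lt: "\<sigma> k < d" if "k < d" for k
    using permutes_in_image[OF assms(2)] that by auto
  have i: "?i p < d" "?i q < d" "?i p \<noteq> ?i q"
    using permutes_in_image[OF permutes_inv[OF assms(2)]] a
      inj_eq[OF permutes_inj[OF permutes_inv[OF assms(2)]]] by auto
  have eq: "\<sigma> k = r \<longleftrightarrow> k = ?i r" for k r using permutes_inverses[OF assms(2)] by metis
  have "tperm \<sigma> t (xs[p := x, q := y]) = t (?zs[?i p := x, ?i q := y])" for x y
  proof -
    have "map (\<lambda>k. xs[p := x, q := y] ! \<sigma> k) [0..<d] = ?zs[?i p := x, ?i q := y]"
    proof (rule nth_equalityI)
      fix k assume "k < length (map (\<lambda>k. xs[p := x, q := y] ! \<sigma> k) [0..<d])"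
      then have k: "k < d" "\<sigma> k < length xs" using lt a by auto
      have "map (\<lambda>k. xs[p := x, q := y] ! \<sigma> k) [0..<d] ! k =
          (if q = \<sigma> k then y else if p = \<sigma> k then x else xs ! \<sigma> k)"
        using k by (simp add: nth_list_update)
      also have "\<dots> = ?zs[?i p := x, ?i q := y] ! k"
        using k(1) eq[of k p] eq[of k q] by (auto simp: nth_list_update)
      finally show "map (\<lambda>k. xs[p := x, q := y] ! \<sigma> k) [0..<d] ! k =
          ?zs[?i p := x, ?i q := y] ! k" .
    qed simp
    then show ?thesis using a by (simp add: tperm_def)
  qed
  then show "(\<Sum>x\<in>UNIV. \<Sum>y\<in>UNIV. of_int (G $ x $ y) * tperm \<sigma> t (xs[p := x, q := y])) = 0"
    using assms(1) i unfolding tracefree_def by simp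
qed

lemma tracefree_young_symmetrizer:
  assumes "tracefree G (sum_list lam) t"
  shows "tracefree G (sum_list lam) (young_symmetrizer lam t)"
  unfolding young_symmetrizer_def col_antisym_def row_sym_def
  by (intro tracefree_sum tracefree_scale tracefree_tperm assms)
    (auto simp: row_group_def col_group_def)

lemma tracefree_of_traceless:
  assumes gram: "gram_matrix G" and t: "t \<in> traceless G d W {0}"
  shows "tracefree G d t"
  unfolding tracefree_def
proof (intro allI impI)
  fix p q and xs :: "'a list" assume a: "p < d" "q < d" "p \<noteq> q" "length xs = d"
  have less: "(\<Sum>x\<in>UNIV. \<Sum>y\<in>UNIV. of_int (G $ x $ y) * t (xs[p := x, q := y])) = 0"
    if pq: "p < q" "q < d" for p q
  proof -
    define A B C where "A = take p xs" and "B = drop (Suc p) (take q xs)" and "C = drop (Suc q) xs"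
    have xs: "xs = A @ [xs ! p] @ B @ [xs ! q] @ C"
    proof -
      have "drop (Suc p) xs = B @ xs ! q # C"
        using id_take_nth_drop[of "q - Suc p" "drop (Suc p) xs"] pq a
        by (simp add: B_def C_def drop_take)
      then show ?thesis
        using id_take_nth_drop[of p xs] pq a by (simp add: A_def)
    qed
    have len: "length A = p" "length B = q - Suc p"
      using pq a by (simp_all add: A_def B_def)
    have "t (take p (A @ B @ C) @ [x] @ drop p (take (q - 1) (A @ B @ C)) @ [y] @ drop (q - 1) (A @ B @ C))
        = t (xs[p := x, q := y])" for x y
      using len pq Suc_diff_Suc[OF pq(1), symmetric]
      by (subst xs) (simp add: list_update_append)
    moreover have "contraction G p q t = 0"
    proof -
      have "contraction G p q t \<in> tpow_rel (d - 2) W {0}"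
        using t pq unfolding traceless_def by blast
      then show ?thesis
        by (induction rule: tpow_rel_induct) (auto simp: pure_tensor_zero tscale_def fun_eq_iff)
    qed
    ultimately show ?thesis
      unfolding contraction_def fun_eq_iff by (metis (no_types, lifting) sum.cong zero_fun_apply)
  qed
  show "(\<Sum>x\<in>UNIV. \<Sum>y\<in>UNIV. of_int (G $ x $ y) * t (xs[p := x, q := y])) = 0"
  proof (cases "p < q")
    case True
    then show ?thesis using less a by blast
  next
    case False
    then have "(\<Sum>x\<in>UNIV. \<Sum>y\<in>UNIV. of_int (G $ x $ y) * t (xs[q := x, p := y])) = 0"
      using less a by simp
    then show ?thesis
      using a(3) by (subst sum.swap) (simp add: gram_matrix_sym[OF gram] list_update_swap[of p q])
  qed
qed

lemma tperm_transpose_apply: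
  assumes "p < length xs" "k < length xs"
  shows "tperm (Transposition.transpose p k) t xs = t (xs[p := xs ! k, k := xs ! p])"
proof -
  have "map (\<lambda>i. xs ! Transposition.transpose p k i) [0..<length xs] = xs[p := xs ! k, k := xs ! p]"
    using assms by (intro nth_equalityI) (auto simp: nth_list_update Transposition.transpose_def)
  then show ?thesis by (simp add: tperm_def)
qed

context rational_hyperbolic_pair
begin

lemma proj_expand: "proj v = (\<Sum>c\<in>UNIV. v $ c *s proj (axis c 1))"
proof -
  have "(\<Sum>c\<in>UNIV. v $ c *s proj (axis c 1)) $ x = proj v $ x" for x
  proof -
    have "(\<Sum>c\<in>UNIV. v $ c *s proj (axis c 1)) $ x = (\<Sum>c\<in>UNIV. v $ c *s axis c 1) $ x
        - (\<Sum>c\<in>UNIV. v $ c * form G (axis c 1) e) * e' $ x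
        - (\<Sum>c\<in>UNIV. v $ c * form G (axis c 1) e') * e $ x"
      by (simp add: proj_def right_diff_distrib sum_subtractf sum_distrib_right mult.assoc)
    also have "\<dots> = proj v $ x"
      unfolding basis_expansion form_expand_left[symmetric] by (simp add: proj_def)
    finally show ?thesis .
  qed
  then show ?thesis by (simp add: vec_eq_iff)
qed

lemma trace_proj: "(\<Sum>c\<in>UNIV. proj (axis c 1) $ c) = of_nat (CARD('a)) - 2"
proof -
  have "(\<Sum>c\<in>UNIV. form G (axis c 1) w * x $ c) = form G x w" for w x
    by (subst (2) form_expand_left) (simp add: mult.commute)
  then show ?thesis by (simp add: proj_def sum_subtractf axis_def)
qed

text \<open>
  The relations \<open>(u \<and> v) t = 0\<close> are contracted at the position \<open>p\<close>: \<open>u\<close> runs over the projections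
  \<open>P\<^sub>c\<close> of the standard basis vectors, and the index at \<open>p\<close> is set to \<open>c\<close>. The action at \<open>p\<close> itself
  produces the trace of the projection, which is the dimension of \<open>V\<close>, minus 1. The action at \<open>k \<noteq> p\<close>
  produces the transposition of \<open>p\<close> and \<open>k\<close> and a trace of \<open>t\<close>, which vanishes. Only a pairing with
  \<open>v\<close> at \<open>p\<close> is left, and it is removed because the form is nondegenerate on \<open>V\<close>.
\<close>

lemma transposition_sum_of_invariant:
  assumes T: "t \<in> tpow d (VI G e e')" "tracefree G d t"
    and rot: "\<And>u v. u \<in> VI G e e' \<Longrightarrow> u \<in> coords \<rat> \<Longrightarrow> v \<in> VI G e e' \<Longrightarrow> v \<in> coords \<rat> \<Longrightarrow>
      tderiv (skew G u v) t = 0"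
    and p: "p < d"
  shows "tscale (of_nat (CARD('a)) - 3) t + (\<Sum>k\<in>{..<d} - {p}. tperm (Transposition.transpose p k) t) = 0"
    (is "?U = 0")
proof -
  let ?P = "\<lambda>c. proj (axis c 1)" and ?n = "of_nat (CARD('a)) - 2 :: complex"
  have slot_e: "(\<Sum>j\<in>UNIV. form G w (axis j 1) * s (ys[k := j])) = 0"
    if "s \<in> tpow d (VI G e e')" "k < d" "length ys = d" "w \<in> {e, e'}" for s k ys w
  proof (rule tpow_slot[OF that(1-3)])
    fix v assume "v \<in> VI G e e'"
    then have "form G w v = 0" using VI_iff' that(4) by auto
    then show "(\<Sum>j\<in>UNIV. form G w (axis j 1) * v $ j) = 0"
      using form_expand_right[of G w v] by (simp add: mult.commute)
  qed
  have slot_P: "(\<Sum>c\<in>UNIV. ?P c $ x * t (ys[k := c])) = t (ys[k := x])"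
    if "k < d" "length ys = d" for x k ys
  proof -
    have "(\<Sum>j\<in>UNIV. (?P j $ x - (if j = x then 1 else 0)) * t (ys[k := j])) = 0"
    proof (rule tpow_slot[OF T(1) that])
      fix v assume "v \<in> VI G e e'"
      then have "(\<Sum>c\<in>UNIV. v $ c *s ?P c) $ x = v $ x" using proj_VI proj_expand by metis
      then have "(\<Sum>j\<in>UNIV. ?P j $ x * v $ j) = v $ x" by (simp add: mult.commute)
      moreover have "(\<Sum>j\<in>UNIV. (if j = x then 1 else 0) * v $ j) = v $ x"
        by (simp add: if_distrib if_distribR cong: if_cong)
      ultimately show "(\<Sum>j\<in>UNIV. (?P j $ x - (if j = x then 1 else 0)) * v $ j) = 0"
        by (simp only: left_diff_distrib sum_subtractf diff_self)
    qed
    moreover have "(\<Sum>j\<in>UNIV. (if j = x then 1 else 0) * t (ys[k := j])) = t (ys[k := x])"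
      by (simp add: if_distrib if_distribR cong: if_cong)
    ultimately show ?thesis by (simp only: left_diff_distrib sum_subtractf eq_iff_diff_eq_0[symmetric])
  qed
  have slot_proj: "(\<Sum>j\<in>UNIV. form G (proj w) (axis j 1) * s (ys[k := j])) =
      (\<Sum>j\<in>UNIV. form G w (axis j 1) * s (ys[k := j]))"
    if "s \<in> tpow d (VI G e e')" "k < d" "length ys = d" for s k ys w
  proof -
    have "(\<Sum>j\<in>UNIV. form G (proj w) (axis j 1) * s (ys[k := j])) =
      (\<Sum>j\<in>UNIV. form G w (axis j 1) * s (ys[k := j]))
      - form G w e * (\<Sum>j\<in>UNIV. form G e' (axis j 1) * s (ys[k := j]))
      - form G w e' * (\<Sum>j\<in>UNIV. form G e (axis j 1) * s (ys[k := j]))"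
      by (simp add: proj_def form_linear left_diff_distrib sum_subtractf sum_distrib_left mult.assoc)
    then show ?thesis using slot_e[OF that] by simp
  qed
  define S where "S k w ys = (\<Sum>j\<in>UNIV. form G w (axis j 1) * t (ys[k := j]))" for k w ys
  have Ut: "?U \<in> tpow d (VI G e e')"
    using p by (intro tpow_closed tperm_in_tpow T permutes_swap_id) auto
  have relation: "(\<Sum>j\<in>UNIV. form G (?P i) (axis j 1) * ?U (xs[p := j])) = 0"
    if xs: "length xs = d" for i xs
  proof -
    let ?v = "?P i"
    have "0 = (\<Sum>c\<in>UNIV. tderiv (skew G (?P c) ?v) t (xs[p := c]))"
      using rot proj_in_VI proj_coords(1)[OF rat_coords(5)] by simp
    also have "\<dots> = (\<Sum>c\<in>UNIV. \<Sum>k<d. ?P c $ (xs[p := c] ! k) * S k ?v (xs[p := c])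
        - ?v $ (xs[p := c] ! k) * S k (?P c) (xs[p := c]))"
      unfolding tderiv_def skew_entry S_def length_list_update xs
      by (intro sum.cong refl)
        (simp only: left_diff_distrib sum_subtractf sum_distrib_left mult.assoc mult.left_commute)
    also have "\<dots> = (\<Sum>k<d. \<Sum>c\<in>UNIV. ?P c $ (xs[p := c] ! k) * S k ?v (xs[p := c])
        - ?v $ (xs[p := c] ! k) * S k (?P c) (xs[p := c]))"
      by (rule sum.swap)
    also have "\<dots> = (\<Sum>c\<in>UNIV. ?P c $ (xs[p := c] ! p) * S p ?v (xs[p := c])
        - ?v $ (xs[p := c] ! p) * S p (?P c) (xs[p := c]))
      + (\<Sum>k\<in>{..<d} - {p}. \<Sum>c\<in>UNIV. ?P c $ (xs[p := c] ! k) * S k ?v (xs[p := c])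
        - ?v $ (xs[p := c] ! k) * S k (?P c) (xs[p := c]))"
      using p by (subst sum.remove[of _ p]) auto
    also have "(\<Sum>c\<in>UNIV. ?P c $ (xs[p := c] ! p) * S p ?v (xs[p := c])
        - ?v $ (xs[p := c] ! p) * S p (?P c) (xs[p := c])) = (?n - 1) * S p ?v xs"
    proof -
      have Sp: "S p w (xs[p := c]) = S p w xs" for w c by (simp add: S_def)
      have "(\<Sum>c\<in>UNIV. ?v $ c * S p (?P c) xs) = S p (\<Sum>c\<in>UNIV. ?v $ c *s ?P c) xs"
        unfolding S_def form_sum_left form_scale_left sum_distrib_left sum_distrib_right
        by (subst sum.swap) (simp add: mult.assoc)
      also have "\<dots> = S p ?v xs"
        unfolding proj_expand[symmetric] by (simp add: proj_VI[OF proj_in_VI])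
      finally show ?thesis
        using p xs by (simp add: Sp sum_subtractf sum_distrib_right[symmetric] trace_proj
            left_diff_distrib)
    qed
    also have "(\<Sum>k\<in>{..<d} - {p}. \<Sum>c\<in>UNIV. ?P c $ (xs[p := c] ! k) * S k ?v (xs[p := c])
        - ?v $ (xs[p := c] ! k) * S k (?P c) (xs[p := c]))
      = (\<Sum>k\<in>{..<d} - {p}. \<Sum>j\<in>UNIV. form G ?v (axis j 1) * t (xs[p := xs ! k, k := j]))"
    proof (rule sum.cong[OF refl])
      fix k assume k: "k \<in> {..<d} - {p}"
      have "(\<Sum>c\<in>UNIV. S k (?P c) (xs[p := c])) =
          (\<Sum>c\<in>UNIV. \<Sum>j\<in>UNIV. form G (axis c 1) (axis j 1) * t (xs[p := c, k := j]))"
        unfolding S_def using k xs by (intro sum.cong refl slot_proj T) auto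
      also have "\<dots> = (\<Sum>c\<in>UNIV. \<Sum>j\<in>UNIV. of_int (G $ c $ j) * t (xs[p := c, k := j]))"
        by (simp add: form_axis_right) (simp add: axis_def if_distrib if_distribR cong: if_cong)
      also have "\<dots> = 0" using T(2) k p xs unfolding tracefree_def by auto
      finally have trace: "(\<Sum>c\<in>UNIV. S k (?P c) (xs[p := c])) = 0" .
      have "(\<Sum>c\<in>UNIV. ?P c $ (xs ! k) * S k ?v (xs[p := c])) =
          (\<Sum>j\<in>UNIV. form G ?v (axis j 1) * (\<Sum>c\<in>UNIV. ?P c $ (xs ! k) * t (xs[k := j, p := c])))"
        unfolding S_def sum_distrib_left using k
        by (subst sum.swap) (simp add: mult.left_commute list_update_swap[of p k])
      also have "\<dots> = (\<Sum>j\<in>UNIV. form G ?v (axis j 1) * t (xs[p := xs ! k, k := j]))"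
        using k p xs by (simp add: slot_P list_update_swap[of p k])
      finally show "(\<Sum>c\<in>UNIV. ?P c $ (xs[p := c] ! k) * S k ?v (xs[p := c])
          - ?v $ (xs[p := c] ! k) * S k (?P c) (xs[p := c])) =
          (\<Sum>j\<in>UNIV. form G ?v (axis j 1) * t (xs[p := xs ! k, k := j]))"
        using k trace by (simp add: sum_subtractf sum_distrib_left[symmetric])
    qed
    also have "\<dots> = (\<Sum>k\<in>{..<d} - {p}. \<Sum>j\<in>UNIV. form G ?v (axis j 1) *
        tperm (Transposition.transpose p k) t (xs[p := j]))"
      using p xs by (intro sum.cong refl) (auto simp: tperm_transpose_apply)
    also have "\<dots> = (\<Sum>j\<in>UNIV. form G ?v (axis j 1) *
        (\<Sum>k\<in>{..<d} - {p}. tperm (Transposition.transpose p k) t (xs[p := j])))"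
      by (subst sum.swap) (simp add: sum_distrib_left)
    finally have "(?n - 1) * S p ?v xs + (\<Sum>j\<in>UNIV. form G ?v (axis j 1) *
        (\<Sum>k\<in>{..<d} - {p}. tperm (Transposition.transpose p k) t (xs[p := j]))) = 0" by simp
    then show ?thesis
      by (simp add: sum_tensor_apply S_def tscale_def distrib_left sum.distrib sum_distrib_left mult_ac)
  qed
  show ?thesis
  proof
    fix xs :: "'a list"
    show "?U xs = 0 xs"
    proof (cases "length xs = d")
      case True
      define w :: "complex ^ 'a" where "w = (\<chi> j. ?U (xs[p := j]))"
      have "form G (axis i 1) w = 0" for i
        using relation[OF True, of i] slot_proj[OF Ut p True, of "axis i 1"]
        by (subst form_expand_right) (simp add: w_def mult.commute)
      then have "form G w x = 0" for x
        by (subst form_sym[OF gram], subst form_expand_left) simp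
      then have "w = 0" by (rule form_nondegenerate[OF gram])
      then have "w $ (xs ! p) = 0" by simp
      then show ?thesis by (simp add: w_def)
    next
      case False
      then show ?thesis using tpow_support[OF Ut] by simp
    qed
  qed
qed

end

section \<open>Transposition sums on the image of the Young symmetrizer\<close>

lemma tperm_comp:
  assumes "\<sigma> permutes {..<d}" "\<tau> permutes {..<d}" and t: "\<And>xs. length xs \<noteq> d \<Longrightarrow> t xs = 0"
  shows "tperm (\<sigma> \<circ> \<tau>) t = tperm \<sigma> (tperm \<tau> t)"
proof
  fix xs :: "'a list"
  have "\<tau> k < d" if "k < d" for k using permutes_in_image[OF assms(2)] that by auto
  then show "tperm (\<sigma> \<circ> \<tau>) t xs = tperm \<sigma> (tperm \<tau> t) xs"
    using t by (cases "length xs = d") (auto simp: tperm_def intro!: arg_cong[of _ _ t])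
qed

lemma down_closed_eq_lessThan:
  fixes A :: "nat set"
  assumes "finite A" "\<And>a b. a \<in> A \<Longrightarrow> b < a \<Longrightarrow> b \<in> A"
  shows "A = {..<card A}"
proof (cases "A = {}")
  case False
  have "A = {..Max A}"
  proof (intro subset_antisym subsetI)
    show "x \<in> A" if "x \<in> {..Max A}" for x using that assms Max_in[OF assms(1) False] by (cases "x = Max A") auto
  qed (use assms in simp)
  then show ?thesis by (metis card_atMost lessThan_Suc_atMost)
qed simp

locale partition =
  fixes lam :: "nat list" and n d :: nat
  assumes part: "is_partition n lam" and d: "d = sum_list lam"
begin

definition col_start :: "nat \<Rightarrow> nat" where "col_start j = (\<Sum>j'<j. col_len lam j')"

lemma col_start_Suc: "col_start (Suc j) = col_start j + col_len lam j"
  by (simp add: col_start_def)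

lemma tableau_eq: "tableau lam i j = col_start j + i"
  by (simp add: tableau_def col_start_def)

lemma is_box_iff: "is_box lam i j \<longleftrightarrow> i < col_len lam j"
proof -
  let ?A = "{i. i < length lam \<and> j < lam ! i}"
  have "b \<in> ?A" if "a \<in> ?A" "b < a" for a b
    using that part sorted_wrt_nth_less[of "(\<ge>)" lam b a] by (auto simp: is_partition_def)
  then have "?A = {..<card ?A}" by (intro down_closed_eq_lessThan) auto
  then have "i \<in> ?A \<longleftrightarrow> i < card ?A" by blast
  then show ?thesis by (simp add: is_box_def col_len_def)
qed

lemma col_len_antimono: "j \<le> j' \<Longrightarrow> col_len lam j' \<le> col_len lam j"
  unfolding col_len_def by (intro card_mono) auto

lemma col_len_le: "col_len lam j \<le> n"
proof -
  have "col_len lam j \<le> card {..<n}"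
    unfolding col_len_def using part by (intro card_mono) (auto simp: is_partition_def)
  then show ?thesis by simp
qed

lemma part_le_first: "i < n \<Longrightarrow> lam ! i \<le> lam ! 0"
  using part sorted_wrt_nth_less[of "(\<ge>)" lam 0 i] by (cases i) (auto simp: is_partition_def)

text \<open>Both sides count the boxes, by columns and by rows.\<close>

lemma col_start_end: "col_start (lam ! 0) = d"
proof -
  have "col_start (lam ! 0) = (\<Sum>j<lam ! 0. \<Sum>i<n. if j < lam ! i then 1 else 0)"
    unfolding col_start_def col_len_def
    using part by (intro sum.cong refl) (simp add: is_partition_def sum.If_cases Int_def)
  also have "\<dots> = (\<Sum>i<n. \<Sum>j<lam ! 0. if j < lam ! i then 1 else 0)" by (rule sum.swap)
  also have "\<dots> = (\<Sum>i<n. lam ! i)"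
  proof (rule sum.cong)
    fix i assume "i \<in> {..<n}"
    then have "{j. j < lam ! 0 \<and> j < lam ! i} = {..<lam ! i}" using part_le_first[of i] by auto
    then show "(\<Sum>j<lam ! 0. if j < lam ! i then 1 else 0) = lam ! i"
      by (simp add: sum.If_cases Int_def)
  qed simp
  also have "\<dots> = d" using part by (simp add: d sum_list_sum_nth atLeast0LessThan is_partition_def)
  finally show ?thesis .
qed

definition column :: "nat \<Rightarrow> nat set" where "column j = {col_start j..<col_start (Suc j)}"

lemma col_start_mono: "j \<le> j' \<Longrightarrow> col_start j \<le> col_start j'"
  unfolding col_start_def by (intro sum_mono2) auto

lemma col_disjoint: "a \<in> column j \<Longrightarrow> a \<in> column j' \<Longrightarrow> j = j'"
  using col_start_mono[of "Suc j" j'] col_start_mono[of "Suc j'" j]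
  by (cases j j' rule: linorder_cases) (auto simp: column_def)

lemma col_bound: "j < lam ! 0 \<Longrightarrow> a \<in> column j \<Longrightarrow> a < d"
  using col_start_mono[of "Suc j" "lam ! 0"] col_start_end by (auto simp: column_def)

lemma tableau_in_col: "is_box lam i j \<Longrightarrow> tableau lam i j \<in> column j"
  by (simp add: tableau_eq is_box_iff column_def col_start_Suc)

lemma col_tableau: "a \<in> column j \<Longrightarrow> is_box lam (a - col_start j) j \<and> tableau lam (a - col_start j) j = a"
  by (auto simp: tableau_eq is_box_iff column_def col_start_Suc)

lemma box_bound: "is_box lam i j \<Longrightarrow> j < lam ! 0"
  using part_le_first[of i] part by (auto simp: is_box_def is_partition_def)

lemma tableau_inj:
  "is_box lam i j \<Longrightarrow> is_box lam i' j' \<Longrightarrow> tableau lam i j = tableau lam i' j' \<Longrightarrow> i = i' \<and> j = j'"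
  using tableau_in_col col_disjoint by (metis add_left_cancel tableau_eq)

lemma row_transposition:
  assumes "is_box lam i j" "is_box lam i j'"
  shows "Transposition.transpose (tableau lam i j) (tableau lam i j') \<in> row_group lam"
  unfolding row_group_def
proof (intro CollectI conjI allI impI)
  show "Transposition.transpose (tableau lam i j) (tableau lam i j') permutes {..<sum_list lam}"
    using assms col_bound[OF box_bound tableau_in_col] d by (intro permutes_swap_id) auto
  fix x y assume "is_box lam x y"
  then show "\<exists>y'. is_box lam x y' \<and>
      Transposition.transpose (tableau lam i j) (tableau lam i j') (tableau lam x y) = tableau lam x y'"
    using assms tableau_inj unfolding Transposition.transpose_def by metis
qed

lemma col_transposition:
  assumes "a \<in> column j" "b \<in> column j" "j < lam ! 0"
  shows "Transposition.transpose a b \<in> col_group lam"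
  unfolding col_group_def
proof (intro CollectI conjI allI impI)
  show "Transposition.transpose a b permutes {..<sum_list lam}"
    using assms col_bound d by (intro permutes_swap_id) auto
  fix x y assume xy: "is_box lam x y"
  then show "\<exists>x'. is_box lam x' y \<and> Transposition.transpose a b (tableau lam x y) = tableau lam x' y"
    using assms col_tableau col_disjoint tableau_in_col unfolding Transposition.transpose_def by metis
qed

lemma row_group_comp: "\<sigma> \<in> row_group lam \<Longrightarrow> \<tau> \<in> row_group lam \<Longrightarrow> \<sigma> \<circ> \<tau> \<in> row_group lam"
  unfolding row_group_def by (auto intro: permutes_compose) metis

lemma col_group_comp: "\<sigma> \<in> col_group lam \<Longrightarrow> \<tau> \<in> col_group lam \<Longrightarrow> \<sigma> \<circ> \<tau> \<in> col_group lam"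
  unfolding col_group_def by (auto intro: permutes_compose) metis

lemma col_group_image:
  assumes "\<tau> \<in> col_group lam" "j < lam ! 0"
  shows "\<tau> ` column j = column j"
proof (rule card_subset_eq)
  show "\<tau> ` column j \<subseteq> column j"
    using assms(1) col_tableau tableau_in_col unfolding col_group_def by force
  have "inj \<tau>" using assms(1) by (auto simp: col_group_def intro: permutes_inj)
  then show "card (\<tau> ` column j) = card (column j)" by (intro card_image) (auto intro: inj_on_subset)
qed (simp add: column_def)

lemma finite_groups: "finite (row_group lam)" "finite (col_group lam)"
  by (rule finite_subset[OF _ finite_permutations[of "{..<sum_list lam}"]];
      auto simp: row_group_def col_group_def)+

lemma col_group_permutes: "\<tau> \<in> col_group lam \<Longrightarrow> \<tau> permutes {..<d}"
  by (simp add: col_group_def d)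

lemma row_group_permutes: "\<tau> \<in> row_group lam \<Longrightarrow> \<tau> permutes {..<d}"
  by (simp add: row_group_def d)

lemma row_sym_invariant:
  assumes t: "\<And>xs. length xs \<noteq> d \<Longrightarrow> t xs = 0"
    and ab: "Transposition.transpose a b \<in> row_group lam"
  shows "tperm (Transposition.transpose a b) (row_sym lam t) = row_sym lam t"
proof -
  let ?\<rho> = "Transposition.transpose a b"
  have "tperm ?\<rho> (row_sym lam t) = (\<Sum>\<sigma>\<in>row_group lam. tperm (?\<rho> \<circ> \<sigma>) t)"
    unfolding row_sym_def tperm_sum
    by (intro sum.cong refl tperm_comp[OF row_group_permutes[OF ab] row_group_permutes t, symmetric])
  also have "\<dots> = (\<Sum>\<sigma>\<in>row_group lam. tperm \<sigma> t)"
    by (rule sum.reindex_bij_witness[of _ "\<lambda>\<sigma>. ?\<rho> \<circ> \<sigma>" "\<lambda>\<sigma>. ?\<rho> \<circ> \<sigma>"])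
      (auto simp: row_group_comp ab o_assoc transpose_comp_involutory)
  finally show ?thesis by (simp add: row_sym_def)
qed

lemma sign_transpose_comp:
  assumes "\<tau> \<in> col_group lam" "a \<noteq> b"
  shows "sign (Transposition.transpose a b \<circ> \<tau>) = - sign \<tau>"
proof -
  have "permutation \<tau>"
    using col_group_permutes[OF assms(1)] by (auto simp: permutation_permutes)
  then show ?thesis
    using assms(2) by (simp add: sign_compose permutation_swap_id sign_swap_id)
qed

lemma col_antisym_alternating:
  assumes s: "\<And>xs. length xs \<noteq> d \<Longrightarrow> s xs = 0"
    and ab: "a \<in> column j" "b \<in> column j" "j < lam ! 0" "a \<noteq> b"
  shows "tperm (Transposition.transpose a b) (col_antisym lam s) = - col_antisym lam s"
proof
  fix ys
  let ?\<rho> = "Transposition.transpose a b"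
  have \<rho>: "?\<rho> \<in> col_group lam" using col_transposition ab by blast
  have "tperm ?\<rho> (col_antisym lam s) ys = (\<Sum>\<tau>\<in>col_group lam. of_int (sign \<tau>) * tperm (?\<rho> \<circ> \<tau>) s ys)"
    unfolding col_antisym_def tperm_sum tperm_scale sum_tensor_apply
    by (intro sum.cong refl)
      (simp add: tscale_def tperm_comp[OF col_group_permutes[OF \<rho>] col_group_permutes s])
  also have "\<dots> = (\<Sum>\<tau>\<in>col_group lam. - (of_int (sign \<tau>) * tperm \<tau> s ys))"
    by (rule sum.reindex_bij_witness[of _ "\<lambda>\<sigma>. ?\<rho> \<circ> \<sigma>" "\<lambda>\<sigma>. ?\<rho> \<circ> \<sigma>"])
      (auto simp: col_group_comp \<rho> o_assoc transpose_comp_involutory sign_transpose_comp ab)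
  also have "\<dots> = (- col_antisym lam s) ys"
    unfolding col_antisym_def by (simp add: sum_tensor_apply tscale_def sum_negf)
  finally show "tperm ?\<rho> (col_antisym lam s) ys = (- col_antisym lam s) ys" .
qed

text \<open>
  Let \<open>s\<close> be the row symmetrized tensor, so that the Young symmetrizer gives the alternating sum of
  \<open>\<tau> s\<close> over the column group. For each \<open>\<tau>\<close>, exactly one \<open>q = Q \<tau>\<close> in the column \<open>j\<close> comes from the
  same row as \<open>p\<close>, and the transposition \<open>(p q)\<close> fixes \<open>\<tau> s\<close>; these terms add up to the right-hand
  side. The row reaches the column \<open>j\<close> because earlier columns are at least as long. The remaining
  terms cancel in pairs: \<open>(p q) \<tau> s = (p Q\<tau>) \<tau>' s\<close> for \<open>\<tau>' = (q Q\<tau>) \<tau>\<close>, which has the opposite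
  sign, and \<open>Q \<tau>' = q\<close>.
\<close>

theorem garnir_relation:
  assumes t: "\<And>xs. length xs \<noteq> d \<Longrightarrow> t xs = 0"
    and j: "j < j'" "j' < lam ! 0" and p: "p \<in> column j'"
  shows "(\<Sum>q\<in>column j. tperm (Transposition.transpose p q) (young_symmetrizer lam t))
    = young_symmetrizer lam t"
proof
  fix ys
  define s where "s = row_sym lam t"
  let ?CG = "col_group lam" and ?tr = "Transposition.transpose"
  have s: "s xs = 0" if "length xs \<noteq> d" for xs
    unfolding s_def row_sym_def sum_tensor_apply
    using t that by (intro sum.neutral) (simp add: tperm_def)
  \<comment> \<open>the row that \<open>p\<close> comes from under \<open>\<tau>\<close>\<close>
  define i where "i \<tau> = inv_into UNIV \<tau> p - col_start j'" for \<tau> :: "nat \<Rightarrow> nat"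
  define Q where "Q \<tau> = \<tau> (tableau lam (i \<tau>) j)" for \<tau>
  define F where "F = (\<lambda>(q, \<tau>). of_int (sign \<tau>) * tperm (?tr p q) (tperm \<tau> s) ys)"
  have perm: "\<tau> permutes {..<d}" if "\<tau> \<in> ?CG" for \<tau> using col_group_permutes that .
  have p_notin: "p \<notin> column j" using p j col_disjoint by blast
  have pre: "inv_into UNIV \<tau> p \<in> column j'" if \<tau>: "\<tau> \<in> ?CG" for \<tau>
  proof -
    obtain a where "a \<in> column j'" "p = \<tau> a" using col_group_image[OF \<tau> j(2)] p by blast
    then show ?thesis using permutes_inverses[OF perm[OF \<tau>]] by simp
  qed
  have box': "is_box lam (i \<tau>) j'" "tableau lam (i \<tau>) j' = inv_into UNIV \<tau> p" if "\<tau> \<in> ?CG" for \<tau>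
    using col_tableau[OF pre[OF that]] by (simp_all add: i_def)
  have box: "is_box lam (i \<tau>) j" if "\<tau> \<in> ?CG" for \<tau>
    using box'(1)[OF that] col_len_antimono[of j j'] j by (simp add: is_box_iff)
  have Qcol: "Q \<tau> \<in> column j" if "\<tau> \<in> ?CG" for \<tau>
    using col_group_image[OF that, of j] tableau_in_col[OF box[OF that]] j
    unfolding Q_def by force
  have fixed: "tperm (?tr p (Q \<tau>)) (tperm \<tau> s) = tperm \<tau> s" if \<tau>: "\<tau> \<in> ?CG" for \<tau>
  proof -
    let ?r = "?tr (inv_into UNIV \<tau> p) (tableau lam (i \<tau>) j)"
    have r: "?r \<in> row_group lam"
      using row_transposition[OF box'(1)[OF \<tau>] box[OF \<tau>]] box'(2)[OF \<tau>] by simp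
    have "?tr p (Q \<tau>) \<in> {\<sigma>. \<sigma> permutes {..<d}}"
      using col_bound[OF j(2) p] col_bound[OF _ Qcol[OF \<tau>]] j by (auto intro: permutes_swap_id)
    then have "tperm (?tr p (Q \<tau>)) (tperm \<tau> s) = tperm (?tr p (Q \<tau>) \<circ> \<tau>) s"
      using tperm_comp[where t = s, OF _ perm[OF \<tau>] s] by simp
    also have "?tr p (Q \<tau>) \<circ> \<tau> = \<tau> \<circ> ?r"
    proof
      fix x
      have "inj \<tau>" using perm[OF \<tau>] permutes_inj by blast
      then show "(?tr p (Q \<tau>) \<circ> \<tau>) x = (\<tau> \<circ> ?r) x"
        using permutes_inverses[OF perm[OF \<tau>]]
        by (auto simp: Transposition.transpose_def Q_def dest: injD)
    qed
    also have "tperm (\<tau> \<circ> ?r) s = tperm \<tau> s"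
      using tperm_comp[where t = s, OF perm[OF \<tau>] row_group_permutes[OF r] s]
        row_sym_invariant[where t = t, OF t r]
      by (simp add: s_def)
    finally show ?thesis .
  qed
  define \<phi> where "\<phi> = (\<lambda>(q, \<tau>). (Q \<tau>, ?tr q (Q \<tau>) \<circ> \<tau>))"
  define X where "X = {(q, \<tau>). q \<in> column j \<and> \<tau> \<in> ?CG \<and> q \<noteq> Q \<tau>}"
  have \<phi>: "\<phi> x \<in> X \<and> \<phi> (\<phi> x) = x \<and> F (\<phi> x) = - F x" if xX: "x \<in> X" for x
  proof -
    obtain q \<tau> where x: "x = (q, \<tau>)" "q \<in> column j" "\<tau> \<in> ?CG" "q \<noteq> Q \<tau>"
      using xX by (auto simp: X_def)
    let ?\<tau>' = "?tr q (Q \<tau>) \<circ> \<tau>"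
    have tr: "?tr q (Q \<tau>) \<in> ?CG" using col_transposition x Qcol j by (metis less_trans)
    have \<tau>': "?\<tau>' \<in> ?CG" using col_group_comp[OF tr] x by blast
    have "?\<tau>' (inv_into UNIV \<tau> p) = p"
      using permutes_inverses[OF perm[OF x(3)]] p_notin x Qcol by (auto simp: Transposition.transpose_def)
    then have inv_eq: "inv_into UNIV ?\<tau>' p = inv_into UNIV \<tau> p"
      using permutes_inverses(2)[OF perm[OF \<tau>']] by metis
    then have Q': "Q ?\<tau>' = q" by (simp add: Q_def i_def)
    have undo: "?tr (Q \<tau>) q \<circ> ?\<tau>' = \<tau>"
      by (simp add: o_assoc transpose_commute[of "Q \<tau>"] transpose_comp_involutory)
    have trp: "?tr a b permutes {..<d}" if "a \<in> {p, q, Q \<tau>}" "b \<in> {p, q, Q \<tau>}" for a b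
    proof -
      have "c < d" if "c \<in> {p, q, Q \<tau>}" for c
        using that col_bound[of j' p] col_bound[of j q] col_bound[of j "Q \<tau>"] p x Qcol j by auto
      then show ?thesis using that by (intro permutes_swap_id) auto
    qed
    have s\<tau>: "tperm \<tau> s xs = 0" if "length xs \<noteq> d" for xs using s that by (simp add: tperm_def)
    have "tperm (?tr p (Q \<tau>)) (tperm ?\<tau>' s) = tperm (?tr p (Q \<tau>)) (tperm (?tr q (Q \<tau>)) (tperm \<tau> s))"
      using tperm_comp[where t = s, OF trp perm[OF x(3)] s] by simp
    also have "\<dots> = tperm (?tr p (Q \<tau>) \<circ> ?tr q (Q \<tau>)) (tperm \<tau> s)"
      using tperm_comp[where t = "tperm \<tau> s", OF trp trp s\<tau>] by simp
    also have "?tr p (Q \<tau>) \<circ> ?tr q (Q \<tau>) = ?tr p q \<circ> ?tr p (Q \<tau>)"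
      using x(2,4) p_notin Qcol[OF x(3)] by (auto simp: Transposition.transpose_def fun_eq_iff)
    also have "tperm (?tr p q \<circ> ?tr p (Q \<tau>)) (tperm \<tau> s) = tperm (?tr p q) (tperm \<tau> s)"
      using tperm_comp[where t = "tperm \<tau> s", OF trp trp s\<tau>, of p q p "Q \<tau>"] fixed[OF x(3)] by simp
    finally have eq: "tperm (?tr p (Q \<tau>)) (tperm ?\<tau>' s) = tperm (?tr p q) (tperm \<tau> s)" .
    have "F (Q \<tau>, ?\<tau>') = - F (q, \<tau>)"
      unfolding F_def prod.case eq sign_transpose_comp[OF x(3) x(4)] by simp
    then show ?thesis
      using x \<tau>' Q' undo Qcol by (auto simp: X_def \<phi>_def)
  qed
  have fin: "finite (column j \<times> ?CG)" using finite_groups by (simp add: column_def)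
  have "sum F X = sum (\<lambda>x. - F x) X"
    by (rule sum.reindex_bij_witness[of _ \<phi> \<phi>]) (use \<phi> in auto)
  then have X0: "sum F X = 0" by (simp add: sum_negf)
  have "(\<Sum>q\<in>column j. tperm (?tr p q) (young_symmetrizer lam t)) ys = (\<Sum>q\<in>column j. \<Sum>\<tau>\<in>?CG. F (q, \<tau>))"
    unfolding young_symmetrizer_def s_def[symmetric] col_antisym_def tperm_sum sum_tensor_apply
      tperm_scale by (simp add: tscale_def F_def)
  also have "\<dots> = sum F (column j \<times> ?CG)" by (simp add: sum.cartesian_product)
  also have "\<dots> = sum F X + sum F (column j \<times> ?CG - X)"
    using fin by (subst sum.subset_diff[of X]) (auto simp: X_def)
  also have "sum F (column j \<times> ?CG - X) = (\<Sum>\<tau>\<in>?CG. of_int (sign \<tau>) * tperm \<tau> s ys)"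
    by (rule sum.reindex_bij_witness[of _ "\<lambda>\<tau>. (Q \<tau>, \<tau>)" snd])
      (auto simp: X_def Qcol F_def fixed)
  also have "sum F X + (\<Sum>\<tau>\<in>?CG. of_int (sign \<tau>) * tperm \<tau> s ys) = young_symmetrizer lam t ys"
    unfolding young_symmetrizer_def s_def[symmetric] col_antisym_def sum_tensor_apply
    by (simp add: X0 tscale_def)
  finally show "(\<Sum>q\<in>column j. tperm (?tr p q) (young_symmetrizer lam t)) ys = young_symmetrizer lam t ys" .
qed

theorem transposition_sum_last_column:
  assumes t: "\<And>xs. length xs \<noteq> d \<Longrightarrow> t xs = 0" and l0: "lam ! 0 > 0" "n > 0"
  defines "J \<equiv> lam ! 0 - 1"
  defines "T \<equiv> young_symmetrizer lam t"
  shows "(\<Sum>q\<in>{..<d} - {col_start J}. tperm (Transposition.transpose (col_start J) q) T) =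
    tscale (of_nat J - of_nat (col_len lam J) + 1) T" and "col_start J < d"
proof -
  let ?p = "col_start J" and ?f = "\<lambda>q. tperm (Transposition.transpose (col_start J) q) T"
  have SJ: "Suc J = lam ! 0" using l0 by (simp add: J_def)
  have "is_box lam 0 J" using l0 part by (simp add: is_box_def J_def is_partition_def)
  then have c: "col_len lam J > 0" by (simp add: is_box_iff)
  have dJ: "d = col_start J + col_len lam J" using col_start_end col_start_Suc[of J] SJ by simp
  then show "col_start J < d" using c by simp
  have p: "?p \<in> column J" using c by (simp add: column_def col_start_Suc)
  have before: "(\<Sum>q<col_start j. ?f q) ys = of_nat j * T ys" if "j \<le> J" for j ys
    using that
  proof (induction j)
    case 0
    then show ?case by (simp add: col_start_def)
  next
    case (Suc j)
    have split: "{..<col_start (Suc j)} = {..<col_start j} \<union> column j"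
      using col_start_Suc[of j] by (auto simp: column_def)
    have "(\<Sum>q<col_start (Suc j). ?f q) = (\<Sum>q<col_start j. ?f q) + (\<Sum>q\<in>column j. ?f q)"
      unfolding split by (rule sum.union_disjoint) (auto simp: column_def)
    moreover have "(\<Sum>q\<in>column j. ?f q) = T"
      unfolding T_def using Suc.prems l0 p by (intro garnir_relation[OF t]) (auto simp: J_def)
    ultimately show ?case using Suc by (simp add: algebra_simps)
  qed
  show "(\<Sum>q\<in>{..<d} - {?p}. ?f q) = tscale (of_nat J - of_nat (col_len lam J) + 1) T"
  proof
    fix ys
    have s: "row_sym lam t xs = 0" if "length xs \<noteq> d" for xs
      unfolding row_sym_def sum_tensor_apply
      using t that by (intro sum.neutral) (simp add: tperm_def)
    have "?f q ys = - T ys" if "q \<in> column J - {?p}" for q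
      using col_antisym_alternating[where s = "row_sym lam t" and b = q, OF s p] that l0
      by (simp add: T_def young_symmetrizer_def J_def)
    then have "(\<Sum>q\<in>column J - {?p}. ?f q ys) = of_nat (card (column J - {?p})) * - T ys"
      by simp
    also have "card (column J - {?p}) = col_len lam J - 1"
      using p by (simp add: column_def col_start_Suc)
    finally have same: "(\<Sum>q\<in>column J - {?p}. ?f q ys) = (of_nat (col_len lam J) - 1) * - T ys"
      using c by (simp add: of_nat_diff Suc_le_eq)
    have split: "{..<d} - {?p} = {..<col_start J} \<union> (column J - {?p})"
      using dJ by (auto simp: column_def col_start_Suc)
    have "(\<Sum>q\<in>{..<d} - {?p}. ?f q ys) = (\<Sum>q<col_start J. ?f q ys) + (\<Sum>q\<in>column J - {?p}. ?f q ys)"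
      unfolding split by (rule sum.union_disjoint) (auto simp: column_def)
    then show "(\<Sum>q\<in>{..<d} - {?p}. ?f q) ys = tscale (of_nat J - of_nat (col_len lam J) + 1) T ys"
      using before[of J ys] same by (simp add: sum_tensor_apply tscale_def algebra_simps)
  qed
qed

end

section \<open>Vanishing of the constant term\<close>

lemma int_span_lattice:
  assumes "isotropic_rank_one G I" "x \<in> I"
  shows "x \<in> lat" "form G x x = 0"
proof -
  obtain e0 where "e0 \<in> lat" "I = int_span e0"
    using assms(1) by (auto simp: isotropic_rank_one_def)
  then show "x \<in> lat" using assms(2) by (auto simp: int_span_def intro!: int_coords)
  show "form G x x = 0" using assms by (simp add: isotropic_rank_one_def)
qed

lemma cusp_data_rational_hyperbolic_pair:
  assumes "gram_matrix G" "isotropic_rank_one G I" "cusp_data G I e I' e'"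
  shows "rational_hyperbolic_pair G e e'"
proof -
  have "e = of_int 1 *s e" by simp
  then have "e \<in> int_span e" unfolding int_span_def by (rule range_eqI)
  then have e: "e \<in> lat" "form G e e = 0"
    using int_span_lattice[OF assms(2)] assms(3) by (auto simp: cusp_data_def)
  obtain r y where y: "r \<in> \<rat>" "y \<in> I'" "e' = r *s y" "isotropic_rank_one G I'"
    using assms(3) by (auto simp: cusp_data_def)
  have sub: "v \<in> lat \<Longrightarrow> v \<in> coords \<rat>" for v :: "complex ^ 'a"
    using Ints_subset_Rats by (auto simp: coords_def)
  show ?thesis
  proof
    show "form G e' e' = 0" using int_span_lattice(2)[OF y(4,2)] y(3) by (simp add: form_linear)
    show "e' \<in> coords \<rat>" unfolding y(3) using int_span_lattice(1)[OF y(4,2)] y(1) sub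
      by (intro rat_coords)
  qed (use assms e sub in \<open>auto simp: cusp_data_def\<close>)
qed

text \<open>The two evaluations of the transposition sum at the top box of the last column are compared.\<close>

theorem traceless_schur_rotation_invariant_zero:
  fixes G :: "int ^ 'm ^ 'm"
  assumes pair: "rational_hyperbolic_pair G e e'" and card: "CARD('m) = n + 2" "n > 0"
    and part: "is_partition n lam" and lam: "lam \<noteq> replicate n 0" "lam \<noteq> replicate n 1"
    and t: "t \<in> schur_sub G lam (VI G e e')"
    and rot: "\<And>u v. u \<in> VI G e e' \<Longrightarrow> u \<in> coords \<rat> \<Longrightarrow> v \<in> VI G e e' \<Longrightarrow> v \<in> coords \<rat> \<Longrightarrow>
      tderiv (skew G u v) t = 0"
  shows "t = 0"
proof -
  interpret rational_hyperbolic_pair G e e' by (rule pair)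
  interpret partition lam n "sum_list lam" by unfold_locales (simp_all add: part)
  obtain t0 where t0: "t0 \<in> traceless G (sum_list lam) (VI G e e') {0}" "t = young_symmetrizer lam t0"
    using t by (auto simp: schur_sub_def)
  have t0': "t0 \<in> tpow (sum_list lam) (VI G e e')" using t0 by (simp add: traceless_def)
  define J where "J = lam ! 0 - 1"
  have len: "length lam = n" using part by (simp add: is_partition_def)
  have l0: "lam ! 0 > 0"
  proof (rule ccontr)
    assume "\<not> lam ! 0 > 0"
    then have "lam = replicate n 0" using part_le_first len by (intro nth_equalityI) auto
    then show False using lam by simp
  qed
  have supp: "length xs \<noteq> sum_list lam \<Longrightarrow> t0 xs = 0" for xs using tpow_support[OF t0'] .
  have "tscale (of_nat (CARD('m)) - 3) t +
      (\<Sum>k\<in>{..<sum_list lam} - {col_start J}. tperm (Transposition.transpose (col_start J) k) t) = 0"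
  proof (rule transposition_sum_of_invariant[OF _ _ rot])
    show "t \<in> tpow (sum_list lam) (VI G e e')"
      unfolding t0(2) by (rule young_symmetrizer_in_tpow[OF t0'])
    show "tracefree G (sum_list lam) t"
      unfolding t0(2) by (rule tracefree_young_symmetrizer[OF tracefree_of_traceless[OF gram t0(1)]])
    show "col_start J < sum_list lam"
      unfolding J_def by (rule transposition_sum_last_column(2)[OF supp l0 card(2)])
  qed
  also have "(\<Sum>k\<in>{..<sum_list lam} - {col_start J}. tperm (Transposition.transpose (col_start J) k) t) =
      tscale (of_nat J - of_nat (col_len lam J) + 1) t"
    unfolding t0(2) J_def by (rule transposition_sum_last_column(1)[OF supp l0 card(2)])
  finally have "tscale (of_nat (n + J) - of_nat (col_len lam J)) t = 0"
    by (simp add: card fun_eq_iff tscale_def algebra_simps)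
  moreover have "(of_nat (n + J) - of_nat (col_len lam J) :: complex) \<noteq> 0"
  proof
    assume "(of_nat (n + J) - of_nat (col_len lam J) :: complex) = 0"
    then have "n + J = col_len lam J" by (metis eq_iff_diff_eq_0 of_nat_eq_iff)
    then have "J = 0" using col_len_le[of J] by simp
    then have J: "J = 0" "col_len lam 0 = n" using \<open>n + J = col_len lam J\<close> by simp_all
    have "lam = replicate n 1"
    proof (rule nth_equalityI)
      fix i assume i: "i < length lam"
      then have "lam ! i > 0" using J is_box_iff[of i 0] len by (simp add: is_box_def)
      moreover have "lam ! i \<le> 1" using part_le_first[of i] J(1) i len by (simp add: J_def)
      ultimately show "lam ! i = replicate n 1 ! i" using i len by simp
    qed (simp add: len)
    then show False using lam by simp
  qed
  ultimately show ?thesis by (simp add: fun_eq_iff tscale_def)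
qed

theorem proposition3p7:
  fixes G :: "int ^ 'm ^ 'm"
    and n :: nat
    and D :: "(complex ^ 'm) set"
    and \<Gamma> :: "(complex ^ 'm ^ 'm) set"
    and lam :: "nat list"
    and k :: int
    and I I' C :: "(complex ^ 'm) set"
    and e e' :: "complex ^ 'm"
    and f :: "complex ^ 'm \<Rightarrow> 'm tensor set"
    and a :: "complex ^ 'm \<Rightarrow> 'm tensor"
  assumes "gram_matrix G" and "signature G 2 n" and "n \<ge> 3"
    and "D \<in> components (period_cone G)"
    and "finite_index_subgroup G D \<Gamma>"
    and "is_partition n lam" and "col_len lam 0 + col_len lam 1 \<le> n"
    and "isotropic_rank_one G I" and "primitive_sublattice I"
    and "cusp_data G I e I' e'" and "tube_component G D e e' C"
    and "modular_form G D \<Gamma> lam k f"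
    and "fourier_expansion G \<Gamma> lam e e' C f a"
    and "lam \<noteq> replicate n 0" and "lam \<noteq> replicate n 1"
  shows "a 0 = 0"
proof -
  interpret rational_hyperbolic_pair G e e'
    using assms(1,8,10) by (rule cusp_data_rational_hyperbolic_pair)
  have sub: "\<Gamma> \<subseteq> orth G \<int> \<inter> orth_plus_real G D"
    using assms(5) subgroup.subset[of \<Gamma> "orth_plus G D"]
    by (simp add: finite_index_subgroup_def orth_plus_def)
  obtain y where y: "y \<in> VI G e e'" "y \<in> coords \<real>" "Re (form G y y) > 0"
    using tube_domain_nonempty[OF assms(11)] by blast
  interpret levi_invariant G e e' D \<Gamma> n "a 0"
  proof
    show "tmap \<gamma> (a 0) = a 0" if "\<gamma> \<in> \<Gamma>" "\<gamma> *v e = e" "\<gamma> *v e' = e'" for \<gamma>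
      using that sub
      by (intro constant_term_invariant[OF assms(11-13)]) (auto simp: orth_plus_real_def)
    show "\<exists>y\<in>VI G e e' \<inter> coords \<real>. 0 < Re (form G y y)" using y by blast
  qed (use assms in auto)
  have "0 \<in> U_dual G \<Gamma> e e'" by (auto simp: U_dual_def VI_iff coords_def)
  then have schur: "a 0 \<in> schur_sub G lam (VI G e e')"
    using assms(13) unfolding fourier_expansion_def by blast
  show ?thesis
  proof (rule traceless_schur_rotation_invariant_zero[OF _ _ _ assms(6,14,15) schur])
    show "rational_hyperbolic_pair G e e'" by (rule rational_hyperbolic_pair_axioms)
    show "CARD('m) = n + 2" using assms(2) by (simp add: signature_def)
    show "n > 0" using assms(3) by simp
  qed (rule rotation_kills)
qed

end
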